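(* Let $\mathbb{T}_n=\prod_{\ell=1}^d\{1,\dots,n_\ell\}$ with $n_\ell\to\infty$ for each $\ell$, and $|\mathbb{T}_n|=\prod_\ell n_\ell$. Let $\{X(t),t\in\mathbb{Z}^d\}$ be a real process in $\mathbb{H}$ which has mean zero and is second-order stationary with covariance operator $C$ satisfying $\sum_{k\in\mathbb{Z}^d}\|C(k)\|_{\rm tr}<\infty$. Assume that: $\mathbb{E}\|X(t)\|^4<\infty$ for all $t$; ${\rm cum}(X(t+\tau),X(s+\tau),X(w+\tau),X(v+\tau))={\rm cum}(X(t),X(s),X(w),X(v))$ for all $t,s,w,v,\tau\in\mathbb{Z}^d$; and $$\sup_{w\in\mathbb{Z}^d}\sum_{u\in\mathbb{Z}^d}\sum_{v\in\mathbb{Z}^d}|{\rm cum}(X(u),X(v),X(w),X(0))|<\infty.$$ Let $K:\mathbb{R}^d\to[0,\infty)$ be continuous with $S_K=\{t:K(t)>0\}$ bounded and containing $0$, $\sup_uK(u)=K(0)=1$, and, for some $\epsilon>0$, $K$ differentiable on $\{\|u\|_2<\epsilon\}$ with $\sup_{\|u\|_2<\epsilon}\|\nabla K(u)\|_2<\infty$. Let the bandwidth $\Delta_n$ satisfy $(\Delta_nS_K)\cap\mathbb{Z}^d\subset\mathbb{T}_n-\mathbb{T}_n$ for all $n$ and $\Delta_n^d/|\mathbb{T}_n|\to0$ as $n\to\infty$. Assume moreover that the spectral density $f$ of $X$ belongs to $\mathcal{P}_D(\beta,L)$ for some $\beta>0$ and $L>0$, and that for some integer $\lambda>0\vee(\beta-1)$,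 $$\partial^{\alpha}K(0)=0\ \text{ for all multi-indices }\alpha\in\mathbb{Z}_+^d\text{ with }1\le|\alpha|\le\lambda,\qquad \sup_h|\partial^\alpha K(h)|<\infty\ \text{ for all }\alpha\text{ with }|\alpha|=\lambda+1,$$ where $|\alpha|=\sum_i\alpha_i$. Then the following is a uniform bound on the rate of the bias of the estimator $\hat f_n$ defined in the context: $$\sup_{f\in\mathcal{P}_D(\beta,L)}\ \sup_{\theta\in[-\pi,\pi]^d}\|\mathbb{E}\hat f_n(\theta)-f(\theta)\|_{\rm HS}=\mathcal{O}(\Delta_n^{-\beta}),\qquad n\to\infty.$$ Combining this with the variance bound $\sup_{\theta\in[-\pi,\pi]^d}\mathbb{E}\|\hat f_n(\theta)-\mathbb{E}\hat f_n(\theta)\|_{\rm HS}^2=\mathcal{O}(\Delta_n^d/|\mathbb{T}_n|)$ and choosing the bandwidth $\Delta_n=|\mathbb{T}_n|^{1/(2\beta+d)}$, the following uniform bound on the mean squared error holds: $$\sup_{f\in\mathcal{P}_D(\beta,L)}\ \sup_{\theta\in[-\pi,\pi]^d}\Big(\mathbb{E}\|\hat f_n(\theta)-f(\theta)\|_{\rm HS}^2\Big)^{1/2}=\mathcal{O}\Big(|\mathbb{T}_n|^{-\frac{\beta}{2\beta+d}}\Big).$$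
   Context: $\mathbb{H}$ is a separable complex Hilbert space with inner product $\langle\cdot,\cdot\rangle$ (linear in the first argument) and norm $\|\cdot\|$. Fix a complete orthonormal system $\{e_j\}$ of $\mathbb{H}$ (the "real" CONS); $x\in\mathbb{H}$ is real if all $\langle x,e_j\rangle$ are real, and $\overline{x}=\sum_j\overline{\langle x,e_j\rangle}e_j$. A process is real if all its values are real elements of $\mathbb{H}$. $x\otimes y$ is the operator $z\mapsto x\langle z,y\rangle$. $\|\cdot\|_{\rm tr}$, $\|\cdot\|_{\rm HS}$ are the trace and Hilbert–Schmidt norms and $\langle\cdot,\cdot\rangle_{\rm HS}$ the Hilbert–Schmidt inner product. A real zero-mean process with $\mathbb{E}\|X(t)\|^2<\infty$ is second-order stationary if $C(k):=\mathbb{E}[X(t+k)\otimes X(t)]$ does not depend on $t$. If $\sum_k\|C(k)\|_{\rm tr}<\infty$ its spectral density is $f(\theta)=(2\pi)^{-d}\sum_{k\in\mathbb{Z}^d}e^{\mathrm{i}k^\top\theta}C(k)$, $\theta\in[-\pi,\pi]^d$. Power-law class: $\mathcal{P}_D(\beta,L)$ is the set of spectral densities $f(\theta)=(2\pi)^{-d}\sum_{k\in\mathbb{Z}^d}C(k)e^{\mathrm{i}\theta^\top k}$ with $\sum_{k\in\mathbb{Z}^d}\|C(k)\|_{\rm tr}(1+\|k\|_2^\beta)\le L$. Fourth-order cumulant of zero-mean $\mathbb{H}$-valued random elements: $${\rm cum}(Y_1,Y_2,Y_3,Y_4)=\mathbb{E}\langle Y_1\otimes Y_2,Y_3\otimes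 Y_4\rangle_{\rm HS}-\langle\mathbb{E}(Y_1\otimes Y_2),\mathbb{E}(Y_3\otimes Y_4)\rangle_{\rm HS}-\mathbb{E}\langle Y_1,Y_3\rangle\,\mathbb{E}\langle Y_4,Y_2\rangle-\langle\mathbb{E}(Y_1\otimes\overline{Y_4}),\mathbb{E}(Y_3\otimes\overline{Y_2})\rangle_{\rm HS}.$$ Estimator: with $T_n=\prod_{\ell=1}^d[0,n_\ell]$ and $|\cdot|$ Lebesgue measure for subsets of $\mathbb{R}^d$ such as $T_n\cap(T_n-h)$, and bandwidth $\Delta_n>0$, $$\hat f_n(\theta)=\frac{1}{(2\pi)^d}\sum_{t\in\mathbb{T}_n}\sum_{s\in\mathbb{T}_n}e^{\mathrm{i}(t-s)^\top\theta}\frac{X(t)\otimes X(s)}{|T_n\cap(T_n-(t-s))|}K\Big(\frac{t-s}{\Delta_n}\Big).$$ $A-B=\{a-b:a\in A,b\in B\}$.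
   Formalization: The variance bound is stated for bandwidths Δ_n bounded away from 0 (false otherwise), and the uniform mean squared error bound is over processes whose fourth-order cumulant supremum is at most κ, for each fixed κ (false without a uniform cumulant bound). *)

theory Defs
  imports "HOL-Probability.Probability"
begin

section \<open>Separable complex Hilbert spaces\<close>

class complex_hilbert_space = banach +
  fixes scaleC :: "complex \<Rightarrow> 'a \<Rightarrow> 'a" (infixr "*\<^sub>C" 75)
    and cinner :: "'a \<Rightarrow> 'a \<Rightarrow> complex"
  assumes scaleC_add_right: "a *\<^sub>C (x + y) = a *\<^sub>C x + a *\<^sub>C y"
    and scaleC_add_left: "(a + b) *\<^sub>C x = a *\<^sub>C x + b *\<^sub>C x"
    and scaleC_scaleC: "a *\<^sub>C b *\<^sub>C x = (a * b) *\<^sub>C x"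
    and scaleR_scaleC: "r *\<^sub>R x = complex_of_real r *\<^sub>C x"
    and cinner_commute: "cinner x y = cnj (cinner y x)"
    and cinner_add_left: "cinner (x + y) z = cinner x z + cinner y z"
    and cinner_scaleC_left: "cinner (a *\<^sub>C x) y = a * cinner x y"
    and cinner_self_nonneg: "0 \<le> Re (cinner x x)"
    and cinner_self_eq_zero: "cinner x x = 0 \<longleftrightarrow> x = 0"
    and norm_eq_sqrt_cinner: "norm x = sqrt (Re (cinner x x))"

class separable_complex_hilbert_space = complex_hilbert_space + second_countable_topology

instantiation complex :: separable_complex_hilbert_space
begin

definition scaleC_complex :: "complex \<Rightarrow> complex \<Rightarrow> complex" where
  "scaleC_complex a x = a * x"

definition cinner_complex :: "complex \<Rightarrow> complex \<Rightarrow> complex" where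
  "cinner_complex x y = x * cnj y"

instance
proof
  fix a b x y z :: complex and r :: real
  show "a *\<^sub>C (x + y) = a *\<^sub>C x + a *\<^sub>C y" "(a + b) *\<^sub>C x = a *\<^sub>C x + b *\<^sub>C x"
    "a *\<^sub>C b *\<^sub>C x = (a * b) *\<^sub>C x" "r *\<^sub>R x = complex_of_real r *\<^sub>C x"
    by (simp_all add: scaleC_complex_def distrib_left distrib_right mult.assoc scaleR_conv_of_real)
  show "cinner x y = cnj (cinner y x)" "cinner (x + y) z = cinner x z + cinner y z"
    "cinner (a *\<^sub>C x) y = a * cinner x y" "cinner x x = 0 \<longleftrightarrow> x = 0"
    by (simp_all add: cinner_complex_def scaleC_complex_def algebra_simps)
  show "0 \<le> Re (cinner x x)" "norm x = sqrt (Re (cinner x x))"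
    by (simp_all add: cinner_complex_def cmod_def power2_eq_square)
qed

end

definition complete_orthonormal :: "'h::complex_hilbert_space set \<Rightarrow> bool" where
  "complete_orthonormal E \<longleftrightarrow>
     (\<forall>e\<in>E. norm e = 1) \<and>
     (\<forall>e\<in>E. \<forall>e'\<in>E. e \<noteq> e' \<longrightarrow> cinner e e' = 0) \<and>
     (\<forall>x. (\<forall>e\<in>E. cinner x e = 0) \<longrightarrow> x = 0)"

definition real_element :: "'h::complex_hilbert_space set \<Rightarrow> 'h \<Rightarrow> bool" where
  "real_element E x \<longleftrightarrow> (\<forall>e\<in>E. cinner x e \<in> \<real>)"

definition conj_element :: "'h::complex_hilbert_space set \<Rightarrow> 'h \<Rightarrow> 'h" where
  "conj_element E x = (\<Sum>\<^sub>\<infinity>e\<in>E. cnj (cinner x e) *\<^sub>C e)"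

section \<open>Operators\<close>

definition tensor_op :: "'h::complex_hilbert_space \<Rightarrow> 'h \<Rightarrow> 'h \<Rightarrow> 'h" where
  "tensor_op x y = (\<lambda>z. cinner z y *\<^sub>C x)"

definition bounded_clinear :: "('h::complex_hilbert_space \<Rightarrow> 'h) \<Rightarrow> bool" where
  "bounded_clinear A \<longleftrightarrow> bounded_linear A \<and> (\<forall>c x. A (c *\<^sub>C x) = c *\<^sub>C A x)"

definition cadjoint :: "('h::complex_hilbert_space \<Rightarrow> 'h) \<Rightarrow> 'h \<Rightarrow> 'h" where
  "cadjoint A = (THE B. \<forall>x y. cinner (A x) y = cinner x (B y))"

definition positive_op :: "('h::complex_hilbert_space \<Rightarrow> 'h) \<Rightarrow> bool" where
  "positive_op A \<longleftrightarrow> bounded_clinear A \<and> (\<forall>x. cinner (A x) x \<in> \<real> \<and> 0 \<le> Re (cinner (A x) x))"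

(* The positive square root of A* A; it exists and is unique for every bounded operator A. *)
definition abs_op :: "('h::complex_hilbert_space \<Rightarrow> 'h) \<Rightarrow> 'h \<Rightarrow> 'h" where
  "abs_op A = (SOME B. positive_op B \<and> B \<circ> B = cadjoint A \<circ> A)"

text \<open>
  The trace norm, the Hilbert--Schmidt norm and the Hilbert--Schmidt inner product do not depend
  on the complete orthonormal system \<open>E\<close> by means of which they are computed. The norms take
  values in \<open>[0,\<infinity>]\<close>, so that a finite bound on them includes membership in the respective class.
\<close>

definition trace_norm :: "'h::complex_hilbert_space set \<Rightarrow> ('h \<Rightarrow> 'h) \<Rightarrow> ennreal" where
  "trace_norm E A =
     (if bounded_clinear A then (\<Sum>\<^sub>\<infinity>e\<in>E. ennreal (Re (cinner (abs_op A e) e))) else \<infinity>)"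

definition sqrt_ennreal :: "ennreal \<Rightarrow> ennreal" where
  "sqrt_ennreal x = (if x = \<infinity> then \<infinity> else ennreal (sqrt (enn2real x)))"

definition hs_norm :: "'h::complex_hilbert_space set \<Rightarrow> ('h \<Rightarrow> 'h) \<Rightarrow> ennreal" where
  "hs_norm E A = sqrt_ennreal (\<Sum>\<^sub>\<infinity>e\<in>E. ennreal ((norm (A e))\<^sup>2))"

definition hs_inner :: "'h::complex_hilbert_space set \<Rightarrow> ('h \<Rightarrow> 'h) \<Rightarrow> ('h \<Rightarrow> 'h) \<Rightarrow> complex" where
  "hs_inner E A B = (\<Sum>\<^sub>\<infinity>e\<in>E. cinner (A e) (B e))"

(* Pointwise Bochner integral. For the random operators below this is the same operator as the
   Bochner integral in the Hilbert--Schmidt or trace class norm. *)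
definition expect_op ::
  "'w measure \<Rightarrow> ('w \<Rightarrow> 'h \<Rightarrow> 'h) \<Rightarrow> 'h::separable_complex_hilbert_space \<Rightarrow> 'h" where
  "expect_op M A = (\<lambda>z. \<integral>\<omega>. A \<omega> z \<partial>M)"

section \<open>Processes on the integer lattice\<close>

definition real_vec :: "int ^ 'd \<Rightarrow> real ^ 'd" where
  "real_vec k = (\<chi> l. real_of_int (k $ l))"

definition second_order_stationary ::
  "'h::separable_complex_hilbert_space set \<Rightarrow> 'w measure \<Rightarrow> (int ^ 'd \<Rightarrow> 'w \<Rightarrow> 'h) \<Rightarrow> bool" where
  "second_order_stationary E M X \<longleftrightarrow>
     prob_space M \<and>
     (\<forall>t. X t \<in> borel_measurable M) \<and>
     (\<forall>t. \<forall>\<omega>\<in>space M. real_element E (X t \<omega>)) \<and>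
     (\<forall>t. integrable M (\<lambda>\<omega>. (norm (X t \<omega>))\<^sup>2)) \<and>
     (\<forall>t. (\<integral>\<omega>. X t \<omega> \<partial>M) = 0) \<and>
     (\<forall>k t s. expect_op M (\<lambda>\<omega>. tensor_op (X (t + k) \<omega>) (X t \<omega>)) =
              expect_op M (\<lambda>\<omega>. tensor_op (X (s + k) \<omega>) (X s \<omega>)))"

definition cov_op ::
  "'w measure \<Rightarrow> (int ^ 'd \<Rightarrow> 'w \<Rightarrow> 'h) \<Rightarrow> int ^ 'd \<Rightarrow> 'h::separable_complex_hilbert_space \<Rightarrow> 'h" where
  "cov_op M X k = expect_op M (\<lambda>\<omega>. tensor_op (X k \<omega>) (X 0 \<omega>))"

definition summable_cov ::
  "'h::separable_complex_hilbert_space set \<Rightarrow> 'w measure \<Rightarrow> (int ^ 'd \<Rightarrow> 'w \<Rightarrow> 'h) \<Rightarrow> bool" where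
  "summable_cov E M X \<longleftrightarrow> (\<Sum>\<^sub>\<infinity>k. trace_norm E (cov_op M X k)) < \<infinity>"

definition spectral_density ::
  "'w measure \<Rightarrow> (int ^ 'd \<Rightarrow> 'w \<Rightarrow> 'h) \<Rightarrow> real ^ 'd \<Rightarrow> 'h::separable_complex_hilbert_space \<Rightarrow> 'h" where
  "spectral_density M X \<theta> =
     (\<lambda>z. complex_of_real (1 / (2 * pi) ^ CARD('d)) *\<^sub>C
            (\<Sum>\<^sub>\<infinity>k. cis (real_vec k \<bullet> \<theta>) *\<^sub>C cov_op M X k z))"

(* The type argument is the type of the sample space of the processes whose spectral densities
   are collected. *)
definition power_law_class ::
  "'w itself \<Rightarrow> 'h::separable_complex_hilbert_space set \<Rightarrow> real \<Rightarrow> real \<Rightarrow>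
     (real ^ 'd \<Rightarrow> 'h \<Rightarrow> 'h) set" where
  "power_law_class W E \<beta> L =
     {spectral_density M X | (M :: 'w measure) (X :: int ^ 'd \<Rightarrow> 'w \<Rightarrow> 'h).
        second_order_stationary E M X \<and> summable_cov E M X \<and>
        (\<Sum>\<^sub>\<infinity>k. trace_norm E (cov_op M X k) * ennreal (1 + norm (real_vec k) powr \<beta>)) \<le> ennreal L}"

definition cum4 ::
  "'h::separable_complex_hilbert_space set \<Rightarrow> 'w measure \<Rightarrow>
     ('w \<Rightarrow> 'h) \<Rightarrow> ('w \<Rightarrow> 'h) \<Rightarrow> ('w \<Rightarrow> 'h) \<Rightarrow> ('w \<Rightarrow> 'h) \<Rightarrow> complex" where
  "cum4 E M Y1 Y2 Y3 Y4 =
     (\<integral>\<omega>. hs_inner E (tensor_op (Y1 \<omega>) (Y2 \<omega>)) (tensor_op (Y3 \<omega>) (Y4 \<omega>)) \<partial>M)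
     - hs_inner E (expect_op M (\<lambda>\<omega>. tensor_op (Y1 \<omega>) (Y2 \<omega>)))
                  (expect_op M (\<lambda>\<omega>. tensor_op (Y3 \<omega>) (Y4 \<omega>)))
     - (\<integral>\<omega>. cinner (Y1 \<omega>) (Y3 \<omega>) \<partial>M) * (\<integral>\<omega>. cinner (Y4 \<omega>) (Y2 \<omega>) \<partial>M)
     - hs_inner E (expect_op M (\<lambda>\<omega>. tensor_op (Y1 \<omega>) (conj_element E (Y4 \<omega>))))
                  (expect_op M (\<lambda>\<omega>. tensor_op (Y3 \<omega>) (conj_element E (Y2 \<omega>))))"

definition cum_bound ::
  "'h::separable_complex_hilbert_space set \<Rightarrow> 'w measure \<Rightarrow> (int ^ 'd \<Rightarrow> 'w \<Rightarrow> 'h) \<Rightarrow> ennreal" where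
  "cum_bound E M X =
     (SUP w. \<Sum>\<^sub>\<infinity>u. \<Sum>\<^sub>\<infinity>v. ennreal (cmod (cum4 E M (X u) (X v) (X w) (X 0))))"

definition admissible_processes ::
  "'h::separable_complex_hilbert_space set \<Rightarrow> (real ^ 'd \<Rightarrow> 'h \<Rightarrow> 'h) \<Rightarrow>
     ('w measure \<times> (int ^ 'd \<Rightarrow> 'w \<Rightarrow> 'h)) set" where
  "admissible_processes E f =
     {(M, X). second_order_stationary E M X \<and> summable_cov E M X \<and> spectral_density M X = f \<and>
        (\<forall>t. integrable M (\<lambda>\<omega>. norm (X t \<omega>) ^ 4)) \<and>
        (\<forall>t s w v \<tau>. cum4 E M (X (t + \<tau>)) (X (s + \<tau>)) (X (w + \<tau>)) (X (v + \<tau>)) =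
                      cum4 E M (X t) (X s) (X w) (X v)) \<and>
        cum_bound E M X < \<infinity>}"

section \<open>Kernel and estimator\<close>

definition lattice_box :: "nat ^ 'd \<Rightarrow> (int ^ 'd) set" where
  "lattice_box n = {t. \<forall>l. 1 \<le> t $ l \<and> t $ l \<le> int (n $ l)}"

definition solid_box :: "nat ^ 'd \<Rightarrow> (real ^ 'd) set" where
  "solid_box n = cbox 0 (\<chi> l. real (n $ l))"

definition overlap_volume :: "nat ^ 'd \<Rightarrow> int ^ 'd \<Rightarrow> real" where
  "overlap_volume n h =
     measure lebesgue (solid_box n \<inter> (\<lambda>x. x - real_vec h) ` solid_box n)"

definition spectral_estimator ::
  "(real ^ 'd \<Rightarrow> real) \<Rightarrow> nat ^ 'd \<Rightarrow> real \<Rightarrow> (int ^ 'd \<Rightarrow> 'w \<Rightarrow> 'h) \<Rightarrow> real ^ 'd \<Rightarrow>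
     'w \<Rightarrow> 'h::separable_complex_hilbert_space \<Rightarrow> 'h" where
  "spectral_estimator K n D X \<theta> \<omega> =
     (\<lambda>z. complex_of_real (1 / (2 * pi) ^ CARD('d)) *\<^sub>C
        (\<Sum>t\<in>lattice_box n. \<Sum>s\<in>lattice_box n.
           (cis (real_vec (t - s) \<bullet> \<theta>) *
            complex_of_real (K (real_vec (t - s) /\<^sub>R D) / overlap_volume n (t - s)))
           *\<^sub>C tensor_op (X t \<omega>) (X s \<omega>) z))"

definition gradient :: "(real ^ 'd \<Rightarrow> real) \<Rightarrow> real ^ 'd \<Rightarrow> real ^ 'd" where
  "gradient g u = (\<chi> i. frechet_derivative g (at u) (axis i 1))"

text \<open>
  Iterated partial derivatives are indexed by the list of the coordinates with respect to which
  one differentiates (the head of the list comes last). A multi-index \<open>\<alpha>\<close> is represented by all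
  lists in which each coordinate \<open>i\<close> occurs \<open>\<alpha> $ i\<close> times, so that nothing is presupposed about
  the interchangeability of partial derivatives.
\<close>

fun iter_partial :: "'d::finite list \<Rightarrow> (real ^ 'd \<Rightarrow> real) \<Rightarrow> real ^ 'd \<Rightarrow> real" where
  "iter_partial [] g = g"
| "iter_partial (i # js) g = (\<lambda>x. deriv (\<lambda>s. iter_partial js g (x + s *\<^sub>R axis i 1)) 0)"

definition partials_exist :: "nat \<Rightarrow> (real ^ 'd::finite \<Rightarrow> real) \<Rightarrow> bool" where
  "partials_exist m g \<longleftrightarrow>
     (\<forall>js i x. length js < m \<longrightarrow>
        (\<lambda>s. iter_partial js g (x + s *\<^sub>R axis i 1)) differentiable (at (0::real)))"

definition orderings_of :: "nat ^ 'd \<Rightarrow> 'd::finite list set" where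
  "orderings_of \<alpha> = {js. \<forall>i. count_list js i = \<alpha> $ i}"

definition multi_size :: "nat ^ 'd::finite \<Rightarrow> nat" where
  "multi_size \<alpha> = (\<Sum>i\<in>UNIV. \<alpha> $ i)"

end

theory Submission
  imports Defs
begin

text \<open>
  On the support of the scaled kernel the normalisation \<open>|T\<^sub>n \<inter> (T\<^sub>n - k)|\<close> equals the number of pairs
  of lattice points with difference \<open>k\<close>, so the mean of the estimator is the Fourier series of \<open>f\<close>
  with \<open>C(k)\<close> multiplied by \<open>K(k / \<Delta>)\<close>. The bias bound is then \<open>|1 - K(u)| \<le> c |u|\<^sup>\<beta>\<close> together with
  the fact that the trace norm dominates the Hilbert--Schmidt norm; that the bound on the
  covariances is a property of \<open>f\<close> alone is the uniqueness of Fourier coefficients.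

  The variance is a quadratic form in the weights whose matrix is a fourth-order cumulant plus two
  products of second-order terms. Its row and column sums are bounded, by the summability of the
  cumulants and by \<open>|E \<langle>X(t), X(s)\<rangle>| \<le> |C(t - s)|\<^sub>t\<^sub>r\<close>, so a Schur test leaves the sum of the squared
  weights, \<open>\<Sum>\<^sub>k K(k / \<Delta>)\<^sup>2 / |T\<^sub>n \<inter> (T\<^sub>n - k)|\<close>. As \<open>\<Delta>\<close> may be of the order of some \<open>n\<^sub>l\<close>, this sum is
  controlled only because the kernel is Lipschitz along the axes and vanishes outside the box of
  differences.
\<close>

section \<open>Inner products and orthonormal systems\<close>

text \<open>\<open>abs_op\<close> is defined by a choice, so the trace norm says nothing until
  positive square roots are known to exist; hence the operator theory at the start. Its main yield
  is that the trace is bounded by the trace norm: E <X(t), X(s)> is the trace of C(t - s), and a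
  Hilbert-Schmidt bound would not control it. The suprema run over densities f and then over all
  processes with that density, whereas membership of f in the class bounds the covariances of some
  process only; this is the gap that uniqueness closes. Constants have to be fixed before f, the
  process and \<theta>. The bias constant depends on K, \<beta> and L. The variance constant is
  \<kappa> + 2 L^2 times a kernel constant, so uniformity of the mean squared error is relative to a
  common cumulant bound \<kappa>. The kernel constant requires a lower bound on the bandwidth: lag 0
  alone contributes 1 / |T_n| to the sum of squared weights, which is not O(\<Delta>^d / |T_n|) when
  \<Delta> tends to 0.\<close>

lemma cinner_add_right: "cinner x (y + z) = cinner x y + cinner x z"
  by (metis cinner_add_left cinner_commute complex_cnj_add)

lemma cinner_scaleC_right: "cinner x (a *\<^sub>C y) = cnj a * cinner x y"
  by (metis cinner_commute cinner_scaleC_left complex_cnj_mult)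

lemma cinner_zero_left [simp]: "cinner 0 x = 0"
  using cinner_add_left[of 0 0 x] by simp

lemma cinner_zero_right [simp]: "cinner x 0 = 0"
  using cinner_add_right[of x 0 0] by simp

lemma cinner_minus_left: "cinner (- x) y = - cinner x y"
  using cinner_add_left[of x "- x" y] by (simp add: eq_neg_iff_add_eq_0 add.commute)

lemma cinner_minus_right: "cinner x (- y) = - cinner x y"
  by (metis cinner_commute cinner_minus_left complex_cnj_minus)

lemma cinner_diff_left: "cinner (x - y) z = cinner x z - cinner y z"
  using cinner_add_left[of x "- y" z] by (simp add: cinner_minus_left)

lemma cinner_diff_right: "cinner x (y - z) = cinner x y - cinner x z"
  using cinner_add_right[of x y "- z"] by (simp add: cinner_minus_right)

lemma cinner_sum_left: "cinner (sum f S) y = (\<Sum>i\<in>S. cinner (f i) y)"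
  by (induction S rule: infinite_finite_induct) (simp_all add: cinner_add_left)

lemma cinner_sum_right: "cinner x (sum f S) = (\<Sum>i\<in>S. cinner x (f i))"
  by (induction S rule: infinite_finite_induct) (simp_all add: cinner_add_right)

lemma cinner_self: "cinner x x = complex_of_real ((norm x)\<^sup>2)"
proof -
  have "Im (cinner x x) = 0"
    using arg_cong[OF cinner_commute[of x x], of Im] by simp
  then show ?thesis
    by (simp add: complex_eq_iff norm_eq_sqrt_cinner cinner_self_nonneg)
qed

text \<open>Stated for an arbitrary semidefinite Hermitian form because it is applied both to the
  inner product and to the form <A x, y> of a positive operator, which may be degenerate.\<close>

lemma hermitian_form_Cauchy_Schwarz:
  fixes q :: "'h::complex_hilbert_space \<Rightarrow> 'h \<Rightarrow> complex"
  assumes diff: "\<And>x y z. q (x - y) z = q x z - q y z"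
    and scale: "\<And>a x y. q (a *\<^sub>C x) y = a * q x y"
    and herm: "\<And>x y. q y x = cnj (q x y)"
    and nonneg: "\<And>x. 0 \<le> Re (q x x)"
  shows "(cmod (q x y))\<^sup>2 \<le> Re (q x x) * Re (q y y)"
proof -
  have diff': "q x (y - z) = q x y - q x z" for x y z
    by (metis herm diff complex_cnj_diff)
  have scale': "q x (a *\<^sub>C y) = cnj a * q x y" for a x y
    by (metis herm scale complex_cnj_mult)
  define c where "c = q x y"
  have real: "q z z = complex_of_real (Re (q z z))" for z
    using arg_cong[OF herm[of z z], of Im] by (simp add: complex_eq_iff)
  \<comment> \<open>The coefficient a = t c carries the phase of c, so q(x - a y, x - a y) becomes a
    real quadratic polynomial in t.\<close>
  have ineq: "0 \<le> Re (q x x) - 2 * t * (cmod c)\<^sup>2 + t\<^sup>2 * (cmod c)\<^sup>2 * Re (q y y)" for t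
  proof -
    define a where "a = complex_of_real t * c"
    have "q (x - a *\<^sub>C y) (x - a *\<^sub>C y)
        = q x x - cnj a * c - a * cnj c + a * cnj a * q y y"
      unfolding diff diff' scale scale' using herm[of y x] herm[of x y]
      by (simp add: c_def algebra_simps)
    also have "\<dots> = q x x - complex_of_real (2 * t) * (c * cnj c)
                   + complex_of_real (t\<^sup>2) * (c * cnj c) * q y y"
      unfolding a_def by (simp add: power2_eq_square algebra_simps)
    also have "\<dots> = complex_of_real (Re (q x x) - 2 * t * (cmod c)\<^sup>2
                      + t\<^sup>2 * (cmod c)\<^sup>2 * Re (q y y))"
      by (subst (1 2) real) (simp flip: complex_norm_square add: algebra_simps)
    finally show ?thesis
      using nonneg[of "x - a *\<^sub>C y"] by simp
  qed
  show ?thesis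
  proof (cases "Re (q y y) = 0")
    case True
    have "c = 0"
    proof (rule ccontr)
      assume "c \<noteq> 0"
      then have "(cmod c)\<^sup>2 > 0" by simp
      \<comment> \<open>For a degenerate y the polynomial is affine in t, and this t gives it the
        value -1.\<close>
      then show False
        using ineq[of "(Re (q x x) + 1) / (2 * (cmod c)\<^sup>2)"] True by simp
    qed
    then show ?thesis using True by (simp add: c_def)
  next
    case False
    then have p: "Re (q y y) > 0" using nonneg[of y] by simp
    \<comment> \<open>The polynomial is minimal at t = 1 / q(y, y).\<close>
    have "2 * (1 / Re (q y y)) * (cmod c)\<^sup>2 = 2 * ((cmod c)\<^sup>2 / Re (q y y))" by simp
    moreover have "(1 / Re (q y y))\<^sup>2 * (cmod c)\<^sup>2 * Re (q y y) = (cmod c)\<^sup>2 / Re (q y y)"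
      using p by (simp add: power2_eq_square)
    ultimately have "(cmod c)\<^sup>2 / Re (q y y) \<le> Re (q x x)"
      using ineq[of "1 / Re (q y y)"] by linarith
    then show ?thesis using p by (simp add: c_def field_simps)
  qed
qed

lemma cinner_Cauchy_Schwarz: "cmod (cinner x y) \<le> norm x * norm y"
proof -
  have "(cmod (cinner x y))\<^sup>2 \<le> Re (cinner x x) * Re (cinner y y)"
    by (rule hermitian_form_Cauchy_Schwarz[of cinner])
       (use cinner_commute in \<open>auto simp: cinner_diff_left cinner_scaleC_left cinner_self_nonneg\<close>)
  also have "\<dots> = (norm x * norm y)\<^sup>2"
    by (simp add: cinner_self power_mult_distrib)
  finally show ?thesis by (rule power2_le_imp_le) simp
qed

lemma norm_scaleC: "norm (a *\<^sub>C x) = cmod a * norm x"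
proof -
  have "complex_of_real ((norm (a *\<^sub>C x))\<^sup>2) = a * cnj a * complex_of_real ((norm x)\<^sup>2)"
    by (simp only: cinner_self[symmetric] cinner_scaleC_left cinner_scaleC_right mult_ac)
  also have "\<dots> = complex_of_real ((cmod a * norm x)\<^sup>2)"
    by (simp flip: complex_norm_square add: power_mult_distrib)
  finally have "(norm (a *\<^sub>C x))\<^sup>2 = (cmod a * norm x)\<^sup>2"
    using of_real_eq_iff by blast
  then show ?thesis by (simp add: power2_eq_iff_nonneg)
qed

lemma scaleC_one [simp]: "1 *\<^sub>C x = x"
  using scaleR_scaleC[of 1 x] by simp

text \<open>Conjugate linearity in the second argument is invisible over the reals, so the theory of
  real bilinear maps supplies limits, continuity and integrals.\<close>

lemma bounded_bilinear_cinner: "bounded_bilinear cinner"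
  by (standard; (rule exI[of _ 1])?)
     (auto simp: cinner_add_left cinner_add_right scaleR_scaleC cinner_scaleC_left
        cinner_scaleC_right cinner_Cauchy_Schwarz scaleC_complex_def)

lemma bounded_bilinear_scaleC: "bounded_bilinear (*\<^sub>C)"
  by (standard; (rule exI[of _ 1])?)
     (auto simp: scaleC_add_left scaleC_add_right scaleR_scaleC scaleC_scaleC norm_scaleC
        scaleC_complex_def mult.commute)

lemmas bounded_linear_cinner_left = bounded_bilinear.bounded_linear_left[OF bounded_bilinear_cinner]
lemmas bounded_linear_cinner_right = bounded_bilinear.bounded_linear_right[OF bounded_bilinear_cinner]
lemmas bounded_linear_scaleC_right = bounded_bilinear.bounded_linear_right[OF bounded_bilinear_scaleC]
lemmas tendsto_cinner = bounded_bilinear.tendsto[OF bounded_bilinear_cinner]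
lemmas tendsto_scaleC = bounded_bilinear.tendsto[OF bounded_bilinear_scaleC]

lemmas scaleC_zero_left [simp] = bounded_bilinear.zero_left[OF bounded_bilinear_scaleC]
lemmas scaleC_zero_right [simp] = bounded_bilinear.zero_right[OF bounded_bilinear_scaleC]
lemmas scaleC_diff_left = bounded_bilinear.diff_left[OF bounded_bilinear_scaleC]
lemmas scaleC_diff_right = bounded_bilinear.diff_right[OF bounded_bilinear_scaleC]
lemmas scaleC_sum_right = bounded_bilinear.sum_right[OF bounded_bilinear_scaleC]

lemma norm_diff_sqr: "(norm (x - y))\<^sup>2 = (norm x)\<^sup>2 - 2 * Re (cinner x y) + (norm y)\<^sup>2"
proof -
  have "complex_of_real ((norm (x - y))\<^sup>2) = cinner x x - cinner x y - cnj (cinner x y) + cinner y y"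
    unfolding cinner_self[symmetric] cinner_diff_left cinner_diff_right
    by (subst cinner_commute[of y x]) simp
  from arg_cong[OF this, of Re] show ?thesis by (simp add: cinner_self)
qed

section \<open>Bessel's inequality, orthonormal expansions and Parseval's identity\<close>

lemma orthonormal_cinner:
  assumes "complete_orthonormal E" "e \<in> E" "e' \<in> E"
  shows "cinner e e' = (if e = e' then 1 else 0)"
  using assms by (auto simp: complete_orthonormal_def cinner_self)

lemma orthonormal_sum_norm_sqr:
  assumes "complete_orthonormal E" "finite F" "F \<subseteq> E"
  shows "(norm (\<Sum>e\<in>F. c e *\<^sub>C e))\<^sup>2 = (\<Sum>e\<in>F. (cmod (c e))\<^sup>2)"
proof -
  have "complex_of_real ((norm (\<Sum>e\<in>F. c e *\<^sub>C e))\<^sup>2)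
      = (\<Sum>e\<in>F. \<Sum>e'\<in>F. c e * (cnj (c e') * cinner e e'))"
    unfolding cinner_self[symmetric] cinner_sum_left cinner_sum_right cinner_scaleC_left
      cinner_scaleC_right by (subst sum.swap) (simp only: sum_distrib_left mult_ac)
  also have "\<dots> = (\<Sum>e\<in>F. \<Sum>e'\<in>F. if e = e' then c e * cnj (c e') else 0)"
    using assms by (intro sum.cong refl) (auto simp: orthonormal_cinner subset_iff)
  also have "\<dots> = (\<Sum>e\<in>F. c e * cnj (c e))"
    using assms by (simp add: sum.delta)
  also have "\<dots> = complex_of_real (\<Sum>e\<in>F. (cmod (c e))\<^sup>2)"
    by (simp add: complex_norm_square[symmetric])
  finally show ?thesis using of_real_eq_iff by blast
qed

text \<open>Pythagoras for the projection onto the span of F. Since the right-hand side decreases in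
  F, so does the distance of the partial expansions from x; this later carries convergence from a
  sequence of finite sets to the net of all of them.\<close>

lemma orthonormal_defect:
  assumes "complete_orthonormal E" "finite F" "F \<subseteq> E"
  shows "(norm (x - (\<Sum>e\<in>F. cinner x e *\<^sub>C e)))\<^sup>2 = (norm x)\<^sup>2 - (\<Sum>e\<in>F. (cmod (cinner x e))\<^sup>2)"
proof -
  have "cinner x (\<Sum>e\<in>F. cinner x e *\<^sub>C e) = complex_of_real (\<Sum>e\<in>F. (cmod (cinner x e))\<^sup>2)"
    unfolding cinner_sum_right cinner_scaleC_right of_real_sum
    by (intro sum.cong refl) (simp only: complex_norm_square mult.commute)
  then show ?thesis
    by (simp add: norm_diff_sqr orthonormal_sum_norm_sqr[OF assms])
qed

lemma Bessel_inequality: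
  assumes "complete_orthonormal E" "finite F" "F \<subseteq> E"
  shows "(\<Sum>e\<in>F. (cmod (cinner x e))\<^sup>2) \<le> (norm x)\<^sup>2"
  using orthonormal_defect[OF assms, of x] zero_le_power2[of "norm (x - (\<Sum>e\<in>F. cinner x e *\<^sub>C e))"]
  by linarith

text \<open>Finite sets whose Bessel sums approach the supremum S have Cauchy partial expansions,
  since any larger set can add only little. Completeness of the system identifies the limit as x,
  and the monotone defect passes to the net of finite subsets.\<close>

lemma has_sum_orthonormal_expansion:
  assumes E: "complete_orthonormal E"
  shows "((\<lambda>e. cinner x e *\<^sub>C e) has_sum x) E"
proof -
  let ?fin = "{F. finite F \<and> F \<subseteq> E}"
  let ?s = "\<lambda>F. \<Sum>e\<in>F. cinner x e *\<^sub>C e" and ?r = "\<lambda>F. \<Sum>e\<in>F. (cmod (cinner x e))\<^sup>2"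
  define S where "S = (SUP F\<in>?fin. ?r F)"
  have bdd: "bdd_above (?r ` ?fin)"
    using Bessel_inequality[OF E, of _ x] by (auto intro!: bdd_aboveI2)
  have le_S: "?r F \<le> S" if "finite F" "F \<subseteq> E" for F
    unfolding S_def using that by (intro cSUP_upper bdd) auto
  have "\<exists>F\<in>?fin. S - 1 / real (Suc m) < ?r F" for m
    unfolding S_def
    by (rule less_cSUP_iff[THEN iffD1]) (use bdd in \<open>auto intro!: exI[of _ "{}"]\<close>)
  then obtain \<Phi> where \<Phi>: "\<And>m. finite (\<Phi> m)" "\<And>m. \<Phi> m \<subseteq> E" "\<And>m. S - 1 / real (Suc m) < ?r (\<Phi> m)"
    by (metis (mono_tags, lifting) mem_Collect_eq)
  \<comment> \<open>Unions make the near-optimal sets increasing, so that \<open>close\<close>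
    compares any two of the partial sums.\<close>
  define G where "G m = (\<Union>i\<le>m. \<Phi> i)" for m :: nat
  have G: "finite (G m)" "G m \<subseteq> E" for m
    using \<Phi> by (auto simp: G_def)
  have G_mono: "G m \<subseteq> G k" if "m \<le> k" for m k
    using that by (fastforce simp: G_def)
  have G_large: "S - 1 / real (Suc m) < ?r (G m)" for m
  proof -
    have "?r (\<Phi> m) \<le> ?r (G m)"
      by (rule sum_mono2) (use G in \<open>auto simp: G_def\<close>)
    then show ?thesis using \<Phi>(3)[of m] by linarith
  qed
  have close: "(norm (?s F - ?s (G m)))\<^sup>2 \<le> 1 / real (Suc m)" if "finite F" "F \<subseteq> E" "G m \<subseteq> F" for F m
  proof -
    have "?s F - ?s (G m) = ?s (F - G m)"
      using that G by (simp add: sum_diff)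
    then have "(norm (?s F - ?s (G m)))\<^sup>2 = ?r (F - G m)"
      using that by (simp add: orthonormal_sum_norm_sqr[OF E] finite_subset subset_iff)
    also have "\<dots> = ?r F - ?r (G m)"
      using that G by (simp add: sum_diff)
    finally show ?thesis using le_S[OF that(1,2)] G_large[of m] by linarith
  qed
  have "Cauchy (\<lambda>m. ?s (G m))"
  proof (rule CauchyI')
    fix \<epsilon> :: real assume "0 < \<epsilon>"
    then obtain m0 where m0: "1 / real (Suc m0) < \<epsilon>\<^sup>2"
      using reals_Archimedean[of "\<epsilon>\<^sup>2"] by (auto simp: inverse_eq_divide)
    show "\<exists>m0. \<forall>m\<ge>m0. \<forall>k>m. dist (?s (G m)) (?s (G k)) < \<epsilon>"
    proof (intro exI allI impI)
      fix m k assume "m0 \<le> m" "m < k"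
      have "(dist (?s (G m)) (?s (G k)))\<^sup>2 \<le> 1 / real (Suc m)"
        using close[OF G, of m k] G_mono[of m k] \<open>m < k\<close>
        by (simp add: dist_norm norm_minus_commute)
      also have "\<dots> \<le> 1 / real (Suc m0)" using \<open>m0 \<le> m\<close> by (simp add: field_simps)
      also note m0
      finally show "dist (?s (G m)) (?s (G k)) < \<epsilon>"
        by (rule power2_less_imp_less) (use \<open>0 < \<epsilon>\<close> in simp)
    qed
  qed
  then obtain y where y: "(\<lambda>m. ?s (G m)) \<longlonglongrightarrow> y"
    by (metis Cauchy_convergent convergent_def)
  have "cinner (x - y) e = 0" if e: "e \<in> E" for e
  proof -
    have coeff: "cinner (?s (G m)) e = (if e \<in> G m then cinner x e else 0)" for m
    proof -
      have "cinner (?s (G m)) e = (\<Sum>e'\<in>G m. if e' = e then cinner x e' else 0)"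
        unfolding cinner_sum_left cinner_scaleC_left using G e
        by (intro sum.cong refl) (auto simp: orthonormal_cinner[OF E] subset_iff)
      then show ?thesis using G by simp
    qed
    \<comment> \<open>If e is outside \<open>G m\<close>, inserting it raises the Bessel sum by less
      than 1 / (m + 1), because S is an upper bound.\<close>
    have small: "cmod (cinner x e - cinner (?s (G m)) e) ^ 2 \<le> 1 / real (Suc m)" for m
    proof (cases "e \<in> G m")
      case False
      have "?r (insert e (G m)) = (cmod (cinner x e))\<^sup>2 + ?r (G m)"
        using False G by simp
      then show ?thesis
        using le_S[of "insert e (G m)"] G_large[of m] G e False by (simp add: coeff)
    qed (simp add: coeff)
    have "(\<lambda>m. cmod (cinner x e - cinner (?s (G m)) e) ^ 2) \<longlonglongrightarrow> cmod (cinner x e - cinner y e) ^ 2"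
      by (intro tendsto_intros tendsto_cinner y)
    moreover have "(\<lambda>m. 1 / real (Suc m)) \<longlonglongrightarrow> 0"
      using LIMSEQ_inverse_real_of_nat by (simp add: inverse_eq_divide)
    ultimately have "cmod (cinner x e - cinner y e) ^ 2 \<le> 0"
      using small by (intro LIMSEQ_le) auto
    then show ?thesis by (simp add: cinner_diff_left)
  qed
  then have "y = x"
    using E unfolding complete_orthonormal_def by (metis right_minus_eq)
  show ?thesis
    unfolding has_sum_def tendsto_iff eventually_finite_subsets_at_top
  proof (intro allI impI)
    fix \<epsilon> :: real assume \<epsilon>: "0 < \<epsilon>"
    then obtain m where m: "dist (?s (G m)) x < \<epsilon>"
      using y \<open>y = x\<close> by (auto simp: lim_sequentially)
    show "\<exists>X. finite X \<and> X \<subseteq> E \<and> (\<forall>Y. finite Y \<and> X \<subseteq> Y \<and> Y \<subseteq> E \<longrightarrow> dist (?s Y) x < \<epsilon>)"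
    proof (intro exI[of _ "G m"] conjI allI impI G)
      fix Y assume Y: "finite Y \<and> G m \<subseteq> Y \<and> Y \<subseteq> E"
      have "?r (G m) \<le> ?r Y" using Y by (intro sum_mono2) auto
      then have "(norm (x - ?s Y))\<^sup>2 \<le> (norm (x - ?s (G m)))\<^sup>2"
        using Y G by (simp add: orthonormal_defect[OF E])
      then have "norm (x - ?s Y) \<le> norm (x - ?s (G m))"
        by (rule power2_le_imp_le) simp
      then show "dist (?s Y) x < \<epsilon>"
        using m by (simp add: dist_norm norm_minus_commute)
    qed
  qed
qed

lemma has_sum_Parseval:
  assumes "complete_orthonormal E"
  shows "((\<lambda>e. cinner x e * cinner e y) has_sum cinner x y) E"
  using has_sum_bounded_linear[OF bounded_linear_cinner_left has_sum_orthonormal_expansion[OF assms]]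
  by (simp add: cinner_scaleC_left)

lemma has_sum_Parseval_norm:
  assumes "complete_orthonormal E"
  shows "((\<lambda>e. (cmod (cinner x e))\<^sup>2) has_sum (norm x)\<^sup>2) E"
proof -
  have "((\<lambda>e. complex_of_real ((cmod (cinner x e))\<^sup>2)) has_sum complex_of_real ((norm x)\<^sup>2)) E"
    using has_sum_Parseval[OF assms, of x x]
    unfolding cinner_self complex_norm_square cinner_commute[of _ x, symmetric] .
  then show ?thesis using has_sum_Re by fastforce
qed

lemma conj_element_real:
  assumes "complete_orthonormal E" "real_element E x"
  shows "conj_element E x = x"
proof -
  have "conj_element E x = (\<Sum>\<^sub>\<infinity>e\<in>E. cinner x e *\<^sub>C e)"
    unfolding conj_element_def using assms(2)
    by (intro infsum_cong) (auto simp: real_element_def Reals_cnj_iff)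
  also have "\<dots> = x"
    using has_sum_orthonormal_expansion[OF assms(1)] by (rule infsumI)
  finally show ?thesis .
qed

text \<open>Distinct elements are at distance sqrt 2, so the balls of radius 1/2 around them are
  disjoint, and a second countable space holds only countably many disjoint nonempty open
  sets.\<close>

lemma countable_complete_orthonormal:
  fixes E :: "'h::separable_complex_hilbert_space set"
  assumes E: "complete_orthonormal E"
  shows "countable E"
proof -
  have far: "dist e e' > 1" if "e \<in> E" "e' \<in> E" "e \<noteq> e'" for e e'
  proof -
    have "(dist e e')\<^sup>2 = 2"
      using that E unfolding dist_norm norm_diff_sqr by (simp add: complete_orthonormal_def)
    then have "1\<^sup>2 < (dist e e')\<^sup>2" by simp
    then show ?thesis by (rule power2_less_imp_less) simp
  qed
  have far': "False" if "e \<in> E" "e' \<in> E" "e \<noteq> e'" "z \<in> ball e (1/2)" "z \<in> ball e' (1/2)" for e e' z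
    using far[OF that(1-3)] dist_triangle_lt[of e z e' 1] that(4,5) by (auto simp: dist_commute)
  have inj: "inj_on (\<lambda>e. ball e (1/2)) E"
    using far' by (intro inj_onI) (metis centre_in_ball half_gt_zero_iff zero_less_one)
  have "countable ((\<lambda>e. ball e (1/2)) ` E)"
    by (rule countable_disjoint_open_subsets) (use far' in \<open>force simp: pairwise_def disjnt_def simp del: mem_ball\<close>)+
  then show ?thesis using inj by (rule countable_image_inj_on)
qed

text \<open>Replaces the net of finite subsets of a countable set by a sequence, as dominated
  convergence and Fatou's lemma require.\<close>

lemma filterlim_finite_subsets_at_top:
  assumes "countable E"
  obtains F :: "nat \<Rightarrow> 'a set"
  where "\<And>m. finite (F m)" "\<And>m. F m \<subseteq> E" "filterlim F (finite_subsets_at_top E) sequentially"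
proof
  define F where "F m = {e\<in>E. to_nat_on E e < m}" for m
  show fin: "finite (F m)" for m
  proof -
    have "inj_on (to_nat_on E) (F m)"
      by (rule inj_on_subset[OF inj_on_to_nat_on[OF assms]]) (auto simp: F_def)
    moreover have "to_nat_on E ` F m \<subseteq> {..<m}" by (auto simp: F_def)
    ultimately show ?thesis using finite_imageD finite_subset by blast
  qed
  show sub: "F m \<subseteq> E" for m by (auto simp: F_def)
  show "filterlim F (finite_subsets_at_top E) sequentially"
    unfolding filterlim_iff
  proof (intro allI impI)
    fix P assume "eventually P (finite_subsets_at_top E)"
    then obtain X where X: "finite X" "X \<subseteq> E" "\<And>Y. finite Y \<Longrightarrow> X \<subseteq> Y \<Longrightarrow> Y \<subseteq> E \<Longrightarrow> P Y"
      by (auto simp: eventually_finite_subsets_at_top)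
    obtain m0 where m0: "\<And>e. e \<in> X \<Longrightarrow> to_nat_on E e < m0"
      using X(1) by (metis finite_imageI finite_nat_set_iff_bounded imageI)
    have "P (F m)" if "m \<ge> m0" for m
      using X m0 that fin sub by (force simp: F_def intro!: X(3))
    then show "eventually (\<lambda>m. P (F m)) sequentially"
      by (auto simp: eventually_sequentially)
  qed
qed

lemma infsum_ennreal_le:
  fixes f :: "'a \<Rightarrow> ennreal"
  assumes "\<And>F. finite F \<Longrightarrow> F \<subseteq> A \<Longrightarrow> sum f F \<le> c"
  shows "infsum f A \<le> c"
  unfolding nonneg_infsum_complete[of A f, simplified] using assms by (auto intro!: SUP_least)

lemma sum_le_infsum_ennreal:
  fixes f :: "'a \<Rightarrow> ennreal"
  assumes "finite F" "F \<subseteq> A"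
  shows "sum f F \<le> infsum f A"
  unfolding nonneg_infsum_complete[of A f, simplified] using assms by (auto intro!: SUP_upper)

section \<open>Positive operators and their square roots\<close>

lemma bounded_clinear_add: "bounded_clinear A \<Longrightarrow> A (x + y) = A x + A y"
  unfolding bounded_clinear_def using linear_simps(1) by blast

lemma bounded_clinear_diff: "bounded_clinear A \<Longrightarrow> A (x - y) = A x - A y"
  unfolding bounded_clinear_def using linear_simps(2) by blast

lemma bounded_clinear_scaleC: "bounded_clinear A \<Longrightarrow> A (c *\<^sub>C x) = c *\<^sub>C A x"
  unfolding bounded_clinear_def by blast

lemma bounded_clinear_zero: "bounded_clinear A \<Longrightarrow> A 0 = 0"
  unfolding bounded_clinear_def using linear_simps(3) by blast

lemma bounded_clinear_compose:
  "bounded_clinear A \<Longrightarrow> bounded_clinear B \<Longrightarrow> bounded_clinear (\<lambda>x. A (B x))"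
  unfolding bounded_clinear_def using bounded_linear_compose by metis

lemma positive_op_nonneg: "positive_op A \<Longrightarrow> 0 \<le> Re (cinner (A x) x)"
  by (simp add: positive_op_def)

lemma positive_op_clinear: "positive_op A \<Longrightarrow> bounded_clinear A"
  by (simp add: positive_op_def)

text \<open>Polarisation: reality of the quadratic form at x + y gives the imaginary part of
  Hermitian symmetry, reality at x + i y the real part.\<close>

lemma positive_op_selfadjoint:
  assumes "positive_op A"
  shows "cinner (A x) y = cinner x (A y)"
proof -
  let ?q = "\<lambda>x y. cinner (A x) y"
  note lin = positive_op_clinear[OF assms]
  have real: "Im (?q z z) = 0" for z
    using assms by (auto simp: positive_op_def complex_is_Real_iff)
  have "Im (?q x y) + Im (?q y x) = 0"
    using real[of "x + y"] real[of x] real[of y]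
    by (simp add: bounded_clinear_add[OF lin] cinner_add_left cinner_add_right)
  moreover have "Re (?q y x) - Re (?q x y) = 0"
    using real[of "x + \<i> *\<^sub>C y"] real[of x] real[of y]
    by (simp add: bounded_clinear_add[OF lin] bounded_clinear_scaleC[OF lin] cinner_add_left
        cinner_add_right cinner_scaleC_left cinner_scaleC_right)
  ultimately have "?q x y = cnj (?q y x)" by (simp add: complex_eq_iff)
  then show ?thesis by (simp add: cinner_commute[of x "A y"])
qed

lemma positive_op_Cauchy_Schwarz:
  assumes "positive_op A"
  shows "(cmod (cinner (A x) y))\<^sup>2 \<le> Re (cinner (A x) x) * Re (cinner (A y) y)"
proof (rule hermitian_form_Cauchy_Schwarz[of "\<lambda>x y. cinner (A x) y"])
  note lin = positive_op_clinear[OF assms]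
  show "cinner (A (x - y)) z = cinner (A x) z - cinner (A y) z" for x y z
    by (simp add: bounded_clinear_diff[OF lin] cinner_diff_left)
  show "cinner (A (a *\<^sub>C x)) y = a * cinner (A x) y" for a x y
    by (simp add: bounded_clinear_scaleC[OF lin] cinner_scaleC_left)
  show "cinner (A y) x = cnj (cinner (A x) y)" for x y
    by (metis positive_op_selfadjoint[OF assms] cinner_commute)
qed (simp add: positive_op_nonneg[OF assms])

text \<open>Cauchy-Schwarz for the form of A, taken at x and A x, turns a bound on the quadratic
  form into a bound on the operator after cancelling |A x|^2.\<close>

lemma positive_op_norm_le:
  assumes "positive_op A" and le: "\<And>z. Re (cinner (A z) z) \<le> (norm z)\<^sup>2"
  shows "norm (A x) \<le> norm x"
proof -
  have "cmod (cinner (A x) (A x)) = (norm (A x))\<^sup>2"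
    by (simp add: cinner_self norm_power)
  then have "((norm (A x))\<^sup>2)\<^sup>2 \<le> Re (cinner (A x) x) * Re (cinner (A (A x)) (A x))"
    using positive_op_Cauchy_Schwarz[OF assms(1), of x "A x"] by simp
  also have "\<dots> \<le> (norm x)\<^sup>2 * (norm (A x))\<^sup>2"
    by (intro mult_mono le) (auto simp: positive_op_nonneg[OF assms(1)])
  finally have "(norm (A x))\<^sup>2 * (norm (A x))\<^sup>2 \<le> (norm x)\<^sup>2 * (norm (A x))\<^sup>2"
    by (simp add: power2_eq_square)
  then have "A x = 0 \<or> (norm (A x))\<^sup>2 \<le> (norm x)\<^sup>2"
    using mult_le_cancel_right[of "(norm (A x))\<^sup>2" "(norm (A x))\<^sup>2" "(norm x)\<^sup>2"]
    by (metis norm_eq_zero not_less zero_eq_power2 zero_le_power2 order_le_less)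
  then show ?thesis
    by (auto intro: power2_le_imp_le)
qed

lemma bounded_clinear_pos_bound:
  assumes "bounded_clinear A"
  obtains c where "c > 0" "\<And>x. norm (A x) \<le> c * norm x"
  using bounded_linear.pos_bounded[of A] assms unfolding bounded_clinear_def
  by (metis mult.commute)

text \<open>The quadratic form of 1 - A / c lies between 0 and |x|^2, because that of A lies between
  0 and c |x|^2.\<close>

lemma positive_op_compl:
  assumes A: "positive_op A" and c: "c > 0" "\<And>x. norm (A x) \<le> c * norm x"
  shows "positive_op (\<lambda>x. x - (1 / c) *\<^sub>R A x)" "norm (x - (1 / c) *\<^sub>R A x) \<le> norm x"
proof -
  let ?T = "\<lambda>x. x - (1 / c) *\<^sub>R A x"
  note lin = positive_op_clinear[OF A]
  have q: "cinner (?T x) x = complex_of_real ((norm x)\<^sup>2 - Re (cinner (A x) x) / c)" for x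
  proof -
    have "cinner (A x) x = complex_of_real (Re (cinner (A x) x))"
      using A by (simp add: positive_op_def complex_is_Real_iff complex_eq_iff)
    then show ?thesis
      by (simp add: cinner_diff_left scaleR_scaleC cinner_scaleC_left cinner_self)
  qed
  have le: "Re (cinner (A x) x) \<le> c * (norm x)\<^sup>2" for x
  proof -
    have "Re (cinner (A x) x) \<le> norm (A x) * norm x"
      using complex_Re_le_cmod cinner_Cauchy_Schwarz order_trans by blast
    also have "\<dots> \<le> c * norm x * norm x" by (intro mult_right_mono c) auto
    finally show ?thesis by (simp add: power2_eq_square mult.assoc)
  qed
  have bl: "bounded_linear ?T"
    using lin unfolding bounded_clinear_def by (intro bounded_linear_intros) auto
  show pos: "positive_op ?T"
    unfolding positive_op_def bounded_clinear_def
  proof (intro conjI allI bl)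
    show "?T (a *\<^sub>C x) = a *\<^sub>C ?T x" for a x
      by (simp add: bounded_clinear_scaleC[OF lin] scaleC_diff_right scaleR_scaleC scaleC_scaleC
          mult.commute)
    show "cinner (?T x) x \<in> \<real>" "0 \<le> Re (cinner (?T x) x)" for x
      unfolding q using le[of x] c(1) by (auto simp: field_simps)
  qed
  have "Re (cinner (?T z) z) \<le> (norm z)\<^sup>2" for z
    unfolding q using positive_op_nonneg[OF A, of z] c(1) by simp
  then show "norm (?T x) \<le> norm x" by (rule positive_op_norm_le[OF pos])
qed

text \<open>
  With \<open>T = 1 - A\<close>, the square root of \<open>A\<close> is \<open>1 - Y\<close> where \<open>Y\<close> is a fixed point of
  \<open>Y \<mapsto> (T + Y\<^sup>2) / 2\<close>. Started at \<open>0\<close>, the iteration is dominated in norm, increment by increment,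
  by the scalar iteration in which \<open>T\<close> is replaced by \<open>1\<close>.
\<close>

lemma positive_sqrt_exists:
  assumes A: "positive_op A"
  shows "\<exists>S. positive_op S \<and> S \<circ> S = A"
proof -
  note lin = positive_op_clinear[OF A]
  obtain c where c: "c > 0" "\<And>x. norm (A x) \<le> c * norm x"
    using bounded_clinear_pos_bound[OF lin] by blast
  define T where "T = (\<lambda>x. x - (1 / c) *\<^sub>R A x)"
  have T: "positive_op T" "\<And>x. norm (T x) \<le> norm x"
    using positive_op_compl[OF A c] by (auto simp: T_def)
  note linT = positive_op_clinear[OF T(1)]
  define Tb where "Tb = Blinfun T"
  have Tb: "blinfun_apply Tb = T"
    unfolding Tb_def using linT by (simp add: bounded_clinear_def bounded_linear_Blinfun_apply)
  have normTb: "norm Tb \<le> 1"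
    by (rule norm_blinfun_bound) (simp_all add: Tb T)
  define Y where "Y = rec_nat (0 :: 'a \<Rightarrow>\<^sub>L 'a) (\<lambda>_ y. (1/2) *\<^sub>R (Tb + (y o\<^sub>L y)))"
  have Y0: "Y 0 = 0" and YS: "Y (Suc m) = (1/2) *\<^sub>R (Tb + (Y m o\<^sub>L Y m))" for m
    by (simp_all add: Y_def)
  define y where "y = rec_nat (0 :: real) (\<lambda>_ y. (1/2) * (1 + y * y))"
  have y0: "y 0 = 0" and yS: "y (Suc m) = (1/2) * (1 + y m * y m)" for m
    by (simp_all add: y_def)
  note bil = bounded_bilinear_blinfun_compose
  have y01: "0 \<le> y m \<and> y m \<le> 1" for m
    by (induction m) (auto simp: y0 yS mult_le_one)
  have y_inc: "y m \<le> y (Suc m)" for m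
    using zero_le_power2[of "1 - y m"] by (simp add: yS power2_eq_square algebra_simps)
  have norm_Y: "norm (Y m) \<le> y m" for m
  proof (induction m)
    case (Suc m)
    have "norm ((Y m o\<^sub>L Y m)) \<le> y m * y m"
      using norm_blinfun_compose[of "Y m" "Y m"] Suc y01[of m]
        mult_mono[of "norm (Y m)" "y m" "norm (Y m)" "y m"] by fastforce
    then have "norm (Tb + (Y m o\<^sub>L Y m)) \<le> 1 + y m * y m"
      using norm_triangle_ineq[of Tb "(Y m o\<^sub>L Y m)"] normTb by linarith
    then show ?case by (simp add: YS yS)
  qed (simp add: Y0 y0)
  have assoc: "(U o\<^sub>L V) o\<^sub>L W = U o\<^sub>L (V o\<^sub>L W)" for U V W :: "'a \<Rightarrow>\<^sub>L 'a"
    by (rule blinfun_eqI) simp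
  note bilin = bounded_bilinear.add_left[OF bil] bounded_bilinear.add_right[OF bil]
    bounded_bilinear.scaleR_left[OF bil] bounded_bilinear.scaleR_right[OF bil]
  \<comment> \<open>All iterates are polynomials in T and hence commute; this lets the difference of
    two squares factor in the estimate of the increments.\<close>
  have comm_T: "Tb o\<^sub>L Y m = Y m o\<^sub>L Tb" for m
  proof (induction m)
    case (Suc m)
    then have "Tb o\<^sub>L (Y m o\<^sub>L Y m) = (Y m o\<^sub>L Y m) o\<^sub>L Tb"
      by (metis assoc)
    then show ?case by (simp only: YS bilin)
  qed (simp add: Y0)
  have comm: "Y (Suc m) o\<^sub>L Y m = Y m o\<^sub>L Y (Suc m)" for m
    by (simp only: YS bilin comm_T assoc)
  have incr: "norm (Y (Suc m) - Y m) \<le> y (Suc m) - y m" for m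
  proof (induction m)
    case 0
    then show ?case using normTb by (simp add: Y0 y0 YS yS)
  next
    case (Suc m)
    have "Y (Suc (Suc m)) - Y (Suc m) = (1/2) *\<^sub>R ((Y (Suc m) o\<^sub>L Y (Suc m)) - (Y m o\<^sub>L Y m))"
      by (subst (1 2) YS) (simp add: algebra_simps)
    also have "\<dots> = (1/2) *\<^sub>R ((Y (Suc m) - Y m) o\<^sub>L (Y (Suc m) + Y m))"
      using comm[of m] by (simp add: bounded_bilinear.add_right[OF bil] bounded_bilinear.diff_left[OF bil])
    finally have "norm (Y (Suc (Suc m)) - Y (Suc m))
        \<le> (1/2) * (norm (Y (Suc m) - Y m) * norm (Y (Suc m) + Y m))"
      using norm_blinfun_compose[of "Y (Suc m) - Y m" "Y (Suc m) + Y m"] by simp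
    also have "\<dots> \<le> (1/2) * ((y (Suc m) - y m) * (y (Suc m) + y m))"
      using Suc norm_Y[of m] norm_Y[of "Suc m"] norm_triangle_ineq[of "Y (Suc m)" "Y m"] y_inc[of m]
      by (intro mult_left_mono mult_mono) auto
    also have "\<dots> = y (Suc (Suc m)) - y (Suc m)"
      by (simp add: yS[of "Suc m"] yS[of m] algebra_simps)
    finally show ?case .
  qed
  have incr': "norm (Y (m + k) - Y m) \<le> y (m + k) - y m" for m k
  proof (induction k)
    case (Suc k)
    show ?case
      using Suc incr[of "m + k"] norm_triangle_ineq[of "Y (Suc (m + k)) - Y (m + k)" "Y (m + k) - Y m"]
      by simp
  qed simp
  \<comment> \<open>The scalar sequence is increasing and bounded by 1; as its increments dominate
    those of \<open>Y\<close>, its convergence makes \<open>Y\<close> Cauchy.\<close>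
  have "incseq y" using y_inc by (simp add: incseq_SucI)
  then have "Cauchy y"
    using incseq_convergent[of y 1] y01 by (metis LIMSEQ_imp_Cauchy)
  have "Cauchy Y"
  proof (rule CauchyI')
    fix e :: real assume "0 < e"
    then obtain M where M: "\<And>m k. m \<ge> M \<Longrightarrow> k \<ge> M \<Longrightarrow> dist (y m) (y k) < e"
      using \<open>Cauchy y\<close> by (metis Cauchy_def)
    show "\<exists>M. \<forall>m\<ge>M. \<forall>n>m. dist (Y m) (Y n) < e"
    proof (intro exI[of _ M] allI impI)
      fix m n assume mn: "M \<le> m" "m < n"
      have "norm (Y n - Y m) \<le> y n - y m" using incr'[of m "n - m"] mn by simp
      also have "\<dots> \<le> dist (y m) (y n)" by (simp add: dist_real_def)
      also have "\<dots> < e" using M mn by simp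
      finally show "dist (Y m) (Y n) < e" by (simp add: dist_norm norm_minus_commute)
    qed
  qed
  then obtain Z where Z: "Y \<longlonglongrightarrow> Z"
    by (metis Cauchy_convergent convergent_def)
  have fixZ: "Z = (1/2) *\<^sub>R (Tb + (Z o\<^sub>L Z))"
  proof (rule LIMSEQ_unique)
    show "(\<lambda>m. Y (Suc m)) \<longlonglongrightarrow> Z" using Z by (rule LIMSEQ_Suc)
    show "(\<lambda>m. Y (Suc m)) \<longlonglongrightarrow> (1/2) *\<^sub>R (Tb + (Z o\<^sub>L Z))"
      unfolding YS by (intro tendsto_intros bounded_bilinear.tendsto[OF bil] Z)
  qed
  have lim: "(\<lambda>m. blinfun_apply (Y m) x) \<longlonglongrightarrow> blinfun_apply Z x" for x
    by (intro blinfun.tendsto Z tendsto_const)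
  have Y_scaleC: "blinfun_apply (Y m) (a *\<^sub>C x) = a *\<^sub>C blinfun_apply (Y m) x" for m a x
  proof (induction m arbitrary: x)
    case (Suc m)
    then show ?case
      by (simp add: YS blinfun.bilinear_simps Tb bounded_clinear_scaleC[OF linT] scaleC_add_right
          scaleR_scaleC scaleC_scaleC mult.commute)
  qed (simp add: Y0)
  have Z_scaleC: "blinfun_apply Z (a *\<^sub>C x) = a *\<^sub>C blinfun_apply Z x" for a x
    using lim[of "a *\<^sub>C x"] tendsto_scaleC[OF tendsto_const lim[of x], of a]
    unfolding Y_scaleC by (rule LIMSEQ_unique)
  have Y_sym: "cinner (blinfun_apply (Y m) x) z = cinner x (blinfun_apply (Y m) z)" for m x z
  proof (induction m arbitrary: x z)
    case (Suc m)
    then show ?case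
      by (simp add: YS blinfun.bilinear_simps Tb positive_op_selfadjoint[OF T(1)] cinner_add_left
          cinner_add_right scaleR_scaleC cinner_scaleC_left cinner_scaleC_right)
  qed (simp add: Y0)
  have Z_sym: "cinner (blinfun_apply Z x) z = cinner x (blinfun_apply Z z)" for x z
    using tendsto_cinner[OF lim[of x] tendsto_const, of z] tendsto_cinner[OF tendsto_const lim[of z], of x]
    unfolding Y_sym by (rule LIMSEQ_unique)
  have "norm Z \<le> 1"
    using norm_Y y01 by (intro LIMSEQ_le_const2[OF tendsto_norm[OF Z]]) (meson order_trans)
  then have Z_norm: "norm (blinfun_apply Z x) \<le> norm x" for x
    using norm_blinfun[of Z x] mult_right_mono[of "norm Z" 1 "norm x"] by simp
  \<comment> \<open>The factor sqrt c undoes the normalisation of A to A / c: the fixed point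
    equation gives (1 - Z)^2 = 1 - T = A / c.\<close>
  define r where "r = sqrt c"
  have r: "r * r = c" "r > 0" using c(1) by (simp_all add: r_def)
  define S where "S = (\<lambda>x. r *\<^sub>R (x - blinfun_apply Z x))"
  have "positive_op S"
    unfolding positive_op_def bounded_clinear_def
  proof (intro conjI allI)
    show "bounded_linear S"
      unfolding S_def by (intro bounded_linear_intros)
    show "S (a *\<^sub>C x) = a *\<^sub>C S x" for a x
      by (simp add: S_def Z_scaleC scaleC_diff_right[symmetric] scaleR_scaleC scaleC_scaleC mult.commute)
    show "cinner (S x) x \<in> \<real>" for x
    proof -
      have "Im (cinner (blinfun_apply Z x) x) = 0"
        using Z_sym[of x x] arg_cong[OF cinner_commute[of "blinfun_apply Z x" x], of Im] by simp
      then show ?thesis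
        by (simp add: S_def complex_is_Real_iff scaleR_scaleC cinner_scaleC_left cinner_diff_left cinner_self)
    qed
    show "0 \<le> Re (cinner (S x) x)" for x
    proof -
      have "Re (cinner (blinfun_apply Z x) x) \<le> norm (blinfun_apply Z x) * norm x"
        using complex_Re_le_cmod cinner_Cauchy_Schwarz order_trans by blast
      also have "\<dots> \<le> norm x * norm x" by (intro mult_right_mono Z_norm) auto
      finally show ?thesis using r
        by (simp add: S_def scaleR_scaleC cinner_scaleC_left cinner_diff_left cinner_self power2_eq_square)
    qed
  qed
  moreover have "S (S x) = A x" for x
  proof -
    have "blinfun_apply Z x = (1/2) *\<^sub>R (T x + blinfun_apply Z (blinfun_apply Z x))"
      by (subst fixZ) (simp add: blinfun.bilinear_simps Tb)
    from arg_cong[OF this, of "(*\<^sub>R) 2"]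
    have "2 *\<^sub>R blinfun_apply Z x = T x + blinfun_apply Z (blinfun_apply Z x)"
      unfolding scaleR_scaleR by simp
    then have "x - 2 *\<^sub>R blinfun_apply Z x + blinfun_apply Z (blinfun_apply Z x) = (1 / c) *\<^sub>R A x"
      by (simp add: T_def algebra_simps)
    moreover have "S (S x) = (r * r) *\<^sub>R (x - 2 *\<^sub>R blinfun_apply Z x + blinfun_apply Z (blinfun_apply Z x))"
      by (simp add: S_def blinfun.bilinear_simps algebra_simps scaleR_2)
    ultimately show ?thesis using r c(1) by simp
  qed
  ultimately show ?thesis by (auto simp: fun_eq_iff)
qed

section \<open>Hilbert--Schmidt and trace norms\<close>

lemma sqrt_ennreal_le:
  assumes "x \<le> ennreal (c\<^sup>2)" "0 \<le> c"
  shows "sqrt_ennreal x \<le> ennreal c"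
proof -
  have "x \<noteq> \<infinity>" using assms(1) by (auto simp: top_unique)
  have "enn2real x \<le> c\<^sup>2"
    using enn2real_mono[OF assms(1)] by simp
  then have "sqrt (enn2real x) \<le> c"
    using assms(2) real_le_lsqrt by simp
  then show ?thesis
    using \<open>x \<noteq> \<infinity>\<close> by (simp add: sqrt_ennreal_def ennreal_leI)
qed

lemma sqrt_ennreal_sqr: "(sqrt_ennreal x)\<^sup>2 = x"
  by (cases x) (auto simp: sqrt_ennreal_def power2_eq_square ennreal_mult_top simp flip: ennreal_mult)

text \<open>A real-valued form of the bound on \<open>hs_norm\<close>, phrased by finite partial
  sums so that the inequalities for \<open>L2_set\<close> apply. Only the values of A on E enter, so
  A may be a pointwise series whose convergence is known on E alone.\<close>

definition hs_le :: "'h::complex_hilbert_space set \<Rightarrow> ('h \<Rightarrow> 'h) \<Rightarrow> real \<Rightarrow> bool" where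
  "hs_le E A c \<longleftrightarrow> 0 \<le> c \<and> (\<forall>F. finite F \<longrightarrow> F \<subseteq> E \<longrightarrow> (\<Sum>e\<in>F. (norm (A e))\<^sup>2) \<le> c\<^sup>2)"

lemma hs_leI:
  assumes "0 \<le> c" "\<And>F. finite F \<Longrightarrow> F \<subseteq> E \<Longrightarrow> (\<Sum>e\<in>F. (norm (A e))\<^sup>2) \<le> c\<^sup>2"
  shows "hs_le E A c"
  using assms by (simp add: hs_le_def)

lemma hs_leD:
  assumes "hs_le E A c"
  shows "0 \<le> c" "finite F \<Longrightarrow> F \<subseteq> E \<Longrightarrow> (\<Sum>e\<in>F. (norm (A e))\<^sup>2) \<le> c\<^sup>2"
    "finite F \<Longrightarrow> F \<subseteq> E \<Longrightarrow> L2_set (\<lambda>e. norm (A e)) F \<le> c" "e \<in> E \<Longrightarrow> norm (A e) \<le> c"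
proof -
  show c: "0 \<le> c" and sum: "finite F \<Longrightarrow> F \<subseteq> E \<Longrightarrow> (\<Sum>e\<in>F. (norm (A e))\<^sup>2) \<le> c\<^sup>2" for F
    using assms by (auto simp: hs_le_def)
  show "finite F \<Longrightarrow> F \<subseteq> E \<Longrightarrow> L2_set (\<lambda>e. norm (A e)) F \<le> c" for F
    using sum c by (simp add: L2_set_def real_le_lsqrt)
  show "norm (A e) \<le> c" if "e \<in> E"
    using sum[of "{e}"] that c by (auto intro: power2_le_imp_le)
qed

lemma hs_le_dominated:
  assumes "hs_le E A c" "\<And>e. norm (B e) \<le> norm (A e)"
  shows "hs_le E B c"
proof (rule hs_leI)
  fix F assume "finite F" "F \<subseteq> E"
  then have "(\<Sum>e\<in>F. (norm (A e))\<^sup>2) \<le> c\<^sup>2" by (rule hs_leD(2)[OF assms(1)])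
  moreover have "(\<Sum>e\<in>F. (norm (B e))\<^sup>2) \<le> (\<Sum>e\<in>F. (norm (A e))\<^sup>2)"
    by (intro sum_mono power_mono assms(2)) simp
  ultimately show "(\<Sum>e\<in>F. (norm (B e))\<^sup>2) \<le> c\<^sup>2" by simp
qed (rule hs_leD(1)[OF assms(1)])

lemma hs_norm_sqr: "(hs_norm E A)\<^sup>2 = (\<Sum>\<^sub>\<infinity>e\<in>E. ennreal ((norm (A e))\<^sup>2))"
  by (simp add: hs_norm_def sqrt_ennreal_sqr)

lemma hs_norm_sqr_le:
  assumes "hs_le E A c"
  shows "(hs_norm E A)\<^sup>2 \<le> ennreal (c\<^sup>2)"
  unfolding hs_norm_sqr
  by (rule infsum_ennreal_le) (use hs_leD(2)[OF assms] in \<open>auto simp: sum_ennreal ennreal_leI\<close>)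

lemma hs_norm_le:
  assumes "hs_le E A c"
  shows "hs_norm E A \<le> ennreal c"
  using hs_norm_sqr_le[OF assms] hs_leD(1)[OF assms]
  by (simp add: hs_norm_def sqrt_ennreal_sqr sqrt_ennreal_le)

lemma hs_le_scaleC:
  assumes "hs_le E A c"
  shows "hs_le E (\<lambda>z. a *\<^sub>C A z) (cmod a * c)"
  using hs_leD[OF assms]
  by (intro hs_leI) (auto simp: norm_scaleC power_mult_distrib simp flip: sum_distrib_left
      intro!: mult_left_mono)

text \<open>The triangle inequality for \<open>L2_set\<close> over a finite F bounds every partial
  sum of the series by s, and the bound survives the limit because F is finite. At an element of E
  the series converges absolutely, each term being dominated by b.\<close>

lemma hs_le_infsum:
  assumes v: "\<And>k. hs_le E (v k) (b k)" and b: "\<And>G. finite G \<Longrightarrow> sum b G \<le> s"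
  shows "hs_le E (\<lambda>z. \<Sum>\<^sub>\<infinity>k. v k z) s"
    and "e \<in> E \<Longrightarrow> (\<lambda>k. v k e) summable_on UNIV"
proof -
  have sum_b: "b summable_on UNIV"
    using hs_leD(1)[OF v] b by (intro nonneg_bdd_above_summable_on bdd_aboveI2) auto
  have abs: "(\<lambda>k. norm (v k e)) summable_on UNIV" if "e \<in> E" for e
    by (rule summable_on_comparison_test[OF sum_b]) (use hs_leD(4)[OF v that] in auto)
  then have summable: "(\<lambda>k. v k e) summable_on UNIV" if "e \<in> E" for e
    by (rule abs_summable_summable[OF _]) (rule that)
  then show "e \<in> E \<Longrightarrow> (\<lambda>k. v k e) summable_on UNIV" .
  have s: "0 \<le> s" using b[of "{}"] by simp
  show "hs_le E (\<lambda>z. \<Sum>\<^sub>\<infinity>k. v k z) s"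
  proof (rule hs_leI[OF s])
    fix F assume F: "finite F" "F \<subseteq> E"
    have "((\<lambda>G. L2_set (\<lambda>e. norm (\<Sum>k\<in>G. v k e)) F) \<longlongrightarrow> L2_set (\<lambda>e. norm (\<Sum>\<^sub>\<infinity>k. v k e)) F)
            (finite_subsets_at_top UNIV)"
      unfolding L2_set_def using F summable
      by (intro tendsto_intros) (auto simp: has_sum_def[symmetric] intro!: has_sum_infsum)
    moreover have "L2_set (\<lambda>e. norm (\<Sum>k\<in>G. v k e)) F \<le> s" if "finite G" for G
    proof -
      have "L2_set (\<lambda>e. norm (\<Sum>k\<in>G. v k e)) F \<le> (\<Sum>k\<in>G. L2_set (\<lambda>e. norm (v k e)) F)"
        using that
      proof (induction G)
        case (insert k G)
        have "L2_set (\<lambda>e. norm (\<Sum>k\<in>insert k G. v k e)) F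
            \<le> L2_set (\<lambda>e. norm (v k e) + norm (\<Sum>k\<in>G. v k e)) F"
          using insert by (intro L2_set_mono) (auto intro: norm_triangle_ineq)
        also have "\<dots> \<le> L2_set (\<lambda>e. norm (v k e)) F + L2_set (\<lambda>e. norm (\<Sum>k\<in>G. v k e)) F"
          by (rule L2_set_triangle_ineq)
        finally show ?case using insert by simp
      qed (simp add: L2_set_def)
      also have "\<dots> \<le> sum b G"
        using F by (intro sum_mono hs_leD(3)[OF v])
      finally show ?thesis using b[OF that] by simp
    qed
    ultimately have "L2_set (\<lambda>e. norm (\<Sum>\<^sub>\<infinity>k. v k e)) F \<le> s"
      by (intro tendsto_upperbound) (auto intro: eventually_finite_subsets_at_top_weakI)
    then show "(\<Sum>e\<in>F. (norm (\<Sum>\<^sub>\<infinity>k. v k e))\<^sup>2) \<le> s\<^sup>2"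
      by (simp add: L2_set_def sqrt_le_D)
  qed
qed

lemma hs_inner_summable_bound:
  assumes A: "hs_le E A a" and B: "hs_le E B b"
  shows "(\<lambda>e. cinner (A e) (B e)) summable_on E" "cmod (hs_inner E A B) \<le> a * b"
proof -
  have bound: "(\<Sum>e\<in>F. cmod (cinner (A e) (B e))) \<le> a * b" if "finite F" "F \<subseteq> E" for F
  proof -
    have "(\<Sum>e\<in>F. cmod (cinner (A e) (B e))) \<le> (\<Sum>e\<in>F. \<bar>norm (A e)\<bar> * \<bar>norm (B e)\<bar>)"
      by (intro sum_mono) (simp add: cinner_Cauchy_Schwarz)
    also have "\<dots> \<le> L2_set (\<lambda>e. norm (A e)) F * L2_set (\<lambda>e. norm (B e)) F"
      by (rule L2_set_mult_ineq)
    also have "\<dots> \<le> a * b"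
      using hs_leD[OF A] hs_leD[OF B] that by (intro mult_mono) auto
    finally show ?thesis .
  qed
  have "(\<lambda>e. cmod (cinner (A e) (B e))) summable_on E"
    using bound by (intro nonneg_bdd_above_summable_on bdd_aboveI2[where M = "a * b"]) auto
  then show sum: "(\<lambda>e. cinner (A e) (B e)) summable_on E"
    by (rule abs_summable_summable)
  show "cmod (hs_inner E A B) \<le> a * b"
  proof (rule tendsto_upperbound)
    show "((\<lambda>F. cmod (\<Sum>e\<in>F. cinner (A e) (B e))) \<longlongrightarrow> cmod (hs_inner E A B)) (finite_subsets_at_top E)"
      unfolding hs_inner_def using has_sum_infsum[OF sum] by (intro tendsto_norm) (simp add: has_sum_def)
    show "\<forall>\<^sub>F F in finite_subsets_at_top E. cmod (\<Sum>e\<in>F. cinner (A e) (B e)) \<le> a * b"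
      using bound by (auto intro!: eventually_finite_subsets_at_top_weakI intro: order_trans[OF norm_sum])
  qed simp
qed

text \<open>By Parseval it suffices to bound squared matrix entries over finite rectangles, where
  rows and columns can be exchanged freely.\<close>

lemma sum_norm_sqr_le_double:
  assumes E: "complete_orthonormal E" and F: "finite F"
    and le: "\<And>G. finite G \<Longrightarrow> G \<subseteq> E \<Longrightarrow> (\<Sum>x\<in>F. \<Sum>e\<in>G. (cmod (cinner (v x) e))\<^sup>2) \<le> c"
  shows "(\<Sum>x\<in>F. (norm (v x))\<^sup>2) \<le> c"
proof (rule tendsto_upperbound)
  show "((\<lambda>G. \<Sum>x\<in>F. \<Sum>e\<in>G. (cmod (cinner (v x) e))\<^sup>2) \<longlongrightarrow> (\<Sum>x\<in>F. (norm (v x))\<^sup>2))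
          (finite_subsets_at_top E)"
    using has_sum_Parseval_norm[OF E] by (intro tendsto_sum) (simp add: has_sum_def)
qed (use le in \<open>auto intro!: eventually_finite_subsets_at_top_weakI\<close>)

text \<open>The matrix of the adjoint is the conjugate transpose, |<A' x, e>| = |<A e, x>|; Bessel's
  inequality then sums over x.\<close>

lemma hs_le_adjoint:
  assumes E: "complete_orthonormal E" and adj: "\<And>x y. cinner (A x) y = cinner x (A' y)"
    and A: "hs_le E A c"
  shows "hs_le E A' c"
proof (rule hs_leI)
  show "0 \<le> c" using hs_leD(1)[OF A] .
  fix F assume F: "finite F" "F \<subseteq> E"
  show "(\<Sum>x\<in>F. (norm (A' x))\<^sup>2) \<le> c\<^sup>2"
  proof (rule sum_norm_sqr_le_double[OF E F(1)])
    fix G assume G: "finite G" "G \<subseteq> E"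
    have "cmod (cinner (A' x) e) = cmod (cinner (A e) x)" for x e
      by (metis adj cinner_commute complex_mod_cnj)
    then have "(\<Sum>x\<in>F. \<Sum>e\<in>G. (cmod (cinner (A' x) e))\<^sup>2) = (\<Sum>e\<in>G. \<Sum>x\<in>F. (cmod (cinner (A e) x))\<^sup>2)"
      by (subst sum.swap) simp
    also have "\<dots> \<le> (\<Sum>e\<in>G. (norm (A e))\<^sup>2)"
      by (intro sum_mono Bessel_inequality[OF E F])
    also have "\<dots> \<le> c\<^sup>2" by (rule hs_leD(2)[OF A G])
    finally show "(\<Sum>x\<in>F. \<Sum>e\<in>G. (cmod (cinner (A' x) e))\<^sup>2) \<le> c\<^sup>2" .
  qed
qed

text \<open>The adjoint is supplied as A' rather than constructed; for covariance operators it will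
  be C(-k). Existence of positive square roots turns the choice in \<open>abs_op\<close> into a
  genuine |A|, and norms agree because its square is A' A.\<close>

lemma abs_op_properties:
  assumes A: "bounded_clinear A" and A': "bounded_clinear A'"
    and adj: "\<And>x y. cinner (A x) y = cinner x (A' y)"
  shows "positive_op (abs_op A)" "norm (abs_op A x) = norm (A x)"
proof -
  have "cadjoint A = A'"
    unfolding cadjoint_def
  proof (rule the_equality)
    fix B assume B: "\<forall>x y. cinner (A x) y = cinner x (B y)"
    have "cinner (B y - A' y) (B y - A' y) = 0" for y
      using B adj by (simp add: cinner_diff_right)
    then show "B = A'" by (auto simp: cinner_self_eq_zero)
  qed (use adj in auto)
  moreover have "positive_op (A' \<circ> A)"
    unfolding positive_op_def
  proof (intro conjI allI)
    show "bounded_clinear (A' \<circ> A)"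
      using bounded_clinear_compose[OF A' A] by (simp add: o_def)
    have "cinner ((A' \<circ> A) x) x = complex_of_real ((norm (A x))\<^sup>2)" for x
      by (metis adj cinner_commute cinner_self comp_apply complex_cnj_complex_of_real)
    then show "cinner ((A' \<circ> A) x) x \<in> \<real>" "0 \<le> Re (cinner ((A' \<circ> A) x) x)" for x
      by auto
  qed
  ultimately have abs: "positive_op (abs_op A) \<and> abs_op A \<circ> abs_op A = A' \<circ> A"
    unfolding abs_op_def by (metis (mono_tags, lifting) positive_sqrt_exists someI_ex)
  then show "positive_op (abs_op A)" by simp
  have "cinner (abs_op A x) (abs_op A x) = cinner x (abs_op A (abs_op A x))"
    using abs positive_op_selfadjoint by blast
  also have "\<dots> = cinner (A x) (A x)"
    using abs by (metis adj comp_apply)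
  finally show "norm (abs_op A x) = norm (A x)"
    by (simp add: norm_eq_sqrt_cinner)
qed

lemma bounded_clinear_trace_norm: "trace_norm E A < \<infinity> \<Longrightarrow> bounded_clinear A"
  by (auto simp: trace_norm_def split: if_splits)

lemma sum_abs_op_le_trace_norm:
  assumes fin: "trace_norm E A < \<infinity>" and pos: "positive_op (abs_op A)" and F: "finite F" "F \<subseteq> E"
  shows "(\<Sum>e\<in>F. Re (cinner (abs_op A e) e)) \<le> enn2real (trace_norm E A)"
proof -
  have "ennreal (\<Sum>e\<in>F. Re (cinner (abs_op A e) e)) \<le> trace_norm E A"
    using sum_le_infsum_ennreal[OF F, of "\<lambda>e. ennreal (Re (cinner (abs_op A e) e))"] bounded_clinear_trace_norm[OF fin]
    by (simp add: trace_norm_def sum_ennreal positive_op_nonneg[OF pos])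
  from enn2real_mono[OF this] fin show ?thesis
    by (simp add: sum_nonneg positive_op_nonneg[OF pos])
qed

text \<open>For B = |A|, the squared entry |<B x, e>|^2 is at most the product of two diagonal
  entries, so the sum of all squared entries is at most the square of the trace. This replaces a
  comparison of singular values.\<close>

lemma hs_le_trace_norm:
  assumes E: "complete_orthonormal E" and fin: "trace_norm E A < \<infinity>" and A': "bounded_clinear A'"
    and adj: "\<And>x y. cinner (A x) y = cinner x (A' y)"
  shows "hs_le E A (enn2real (trace_norm E A))"
proof (rule hs_leI)
  let ?t = "enn2real (trace_norm E A)" and ?B = "abs_op A"
  note A = bounded_clinear_trace_norm[OF fin]
  note B = abs_op_properties[OF A A' adj]
  note tr = sum_abs_op_le_trace_norm[OF fin B(1)]
  fix F assume F: "finite F" "F \<subseteq> E"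
  have "(\<Sum>x\<in>F. (norm (?B x))\<^sup>2) \<le> ?t\<^sup>2"
  proof (rule sum_norm_sqr_le_double[OF E F(1)])
    fix G assume G: "finite G" "G \<subseteq> E"
    have "(\<Sum>x\<in>F. \<Sum>e\<in>G. (cmod (cinner (?B x) e))\<^sup>2)
        \<le> (\<Sum>x\<in>F. \<Sum>e\<in>G. Re (cinner (?B x) x) * Re (cinner (?B e) e))"
      by (intro sum_mono positive_op_Cauchy_Schwarz B)
    also have "\<dots> = (\<Sum>x\<in>F. Re (cinner (?B x) x)) * (\<Sum>e\<in>G. Re (cinner (?B e) e))"
      by (simp add: sum_product)
    also have "\<dots> \<le> ?t * ?t"
      by (intro mult_mono tr F G) (auto intro!: sum_nonneg positive_op_nonneg B)
    finally show "(\<Sum>x\<in>F. \<Sum>e\<in>G. (cmod (cinner (?B x) e))\<^sup>2) \<le> ?t\<^sup>2"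
      by (simp add: power2_eq_square)
  qed
  then show "(\<Sum>e\<in>F. (norm (A e))\<^sup>2) \<le> ?t\<^sup>2" by (simp add: B(2))
qed simp

section \<open>The diagonal sum is dominated by the trace norm\<close>

lemma bounded_clinear_scaleR: "bounded_clinear A \<Longrightarrow> A (r *\<^sub>R x) = r *\<^sub>R A x"
  by (simp add: bounded_clinear_scaleC scaleR_scaleC)

lemma bounded_clinear_sum:
  "bounded_clinear A \<Longrightarrow> A (sum f F) = (\<Sum>i\<in>F. A (f i))"
  by (induction F rule: infinite_finite_induct)
     (simp_all add: bounded_clinear_zero bounded_clinear_add)

text \<open>Cauchy-Schwarz at x and A x once more. In operator terms this is A^2 <= A, which drives
  the decay of the powers of T below.\<close>

lemma positive_contraction_sqr_le:
  assumes A: "positive_op A" and le: "\<And>z. norm (A z) \<le> norm z"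
  shows "(norm (A x))\<^sup>2 \<le> Re (cinner (A x) x)"
proof -
  have "cmod (cinner (A x) (A x)) = (norm (A x))\<^sup>2"
    by (simp add: cinner_self norm_power)
  then have "((norm (A x))\<^sup>2)\<^sup>2 \<le> Re (cinner (A x) x) * Re (cinner (A (A x)) (A x))"
    using positive_op_Cauchy_Schwarz[OF A, of x "A x"] by simp
  also have "Re (cinner (A (A x)) (A x)) \<le> norm (A (A x)) * norm (A x)"
    using complex_Re_le_cmod cinner_Cauchy_Schwarz order_trans by blast
  also have "\<dots> \<le> (norm (A x))\<^sup>2"
    using le[of "A x"] by (simp add: power2_eq_square mult_right_mono)
  finally have *: "(norm (A x))\<^sup>2 * (norm (A x))\<^sup>2 \<le> Re (cinner (A x) x) * (norm (A x))\<^sup>2"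
    using positive_op_nonneg[OF A, of x] by (simp add: power2_eq_square mult_left_mono)
  show ?thesis
  proof (cases "A x = 0")
    case False
    then show ?thesis by (intro mult_right_le_imp_le[OF *]) simp
  qed (simp add: positive_op_nonneg[OF A])
qed

text \<open>
  Instead of a polar decomposition \<open>A = U B\<close> with \<open>B = |A|\<close>, regularise: let \<open>S\<^sup>2 = B\<close> and
  \<open>T = 1 - B / c\<close>. Then \<open>1 - T\<^sup>m = B P / c\<close> for a polynomial \<open>P\<close> in \<open>T\<close>, hence
  \<open>A (1 - T\<^sup>m) = G S\<close> with \<open>G = A S P / c\<close>, and the Hilbert--Schmidt norms of \<open>G\<close> and \<open>S\<close> are
  at most the square root of the trace of \<open>B\<close>. Finally \<open>B T\<^sup>m\<close> tends to \<open>0\<close> pointwise.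
\<close>

lemma sum_cinner_le_trace_norm:
  assumes E: "complete_orthonormal E" and fin: "trace_norm E A < \<infinity>" and A': "bounded_clinear A'"
    and adj: "\<And>x y. cinner (A x) y = cinner x (A' y)" and F: "finite F" "F \<subseteq> E"
  shows "(\<Sum>e\<in>F. cmod (cinner (A e) e)) \<le> enn2real (trace_norm E A)"
proof -
  define t where "t = enn2real (trace_norm E A)"
  define B where "B = abs_op A"
  note A = bounded_clinear_trace_norm[OF fin]
  have B: "positive_op B" "\<And>x. norm (B x) = norm (A x)"
    using abs_op_properties[OF A A' adj] by (auto simp: B_def)
  have tr: "(\<Sum>e\<in>H. Re (cinner (B e) e)) \<le> t" if "finite H" "H \<subseteq> E" for H
    using sum_abs_op_le_trace_norm[OF fin _ that] B(1) by (simp add: B_def t_def)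
  note linB = positive_op_clinear[OF B(1)]
  obtain S where S: "positive_op S" and SS: "\<And>x. S (S x) = B x"
    using positive_sqrt_exists[OF B(1)] by (auto simp: fun_eq_iff)
  note linS = positive_op_clinear[OF S]
  obtain c where c: "c > 0" "\<And>x. norm (B x) \<le> c * norm x"
    using bounded_clinear_pos_bound[OF linB] by blast
  obtain s where s: "s > 0" "\<And>x. norm (S x) \<le> s * norm x"
    using bounded_clinear_pos_bound[OF linS] by blast
  define T where "T = (\<lambda>x. x - (1 / c) *\<^sub>R B x)"
  have T: "positive_op T" "\<And>x. norm (T x) \<le> norm x"
    using positive_op_compl[OF B(1) c] by (auto simp: T_def)
  note linT = positive_op_clinear[OF T(1)]
  have ST: "S (T x) = T (S x)" for x
    by (simp add: T_def bounded_clinear_diff[OF linS] bounded_clinear_scaleR[OF linS] flip: SS)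
  have ST_pow: "S ((T ^^ j) x) = (T ^^ j) (S x)" for j x
    by (induction j) (simp_all add: ST)
  have T_pow_norm: "norm ((T ^^ j) x) \<le> norm x" for j x
    by (induction j) (auto intro: order_trans[OF T(2)])
  have T_pow_adj: "cinner ((T ^^ j) x) y = cinner x ((T ^^ j) y)" for j x y
    by (induction j arbitrary: y) (simp_all add: positive_op_selfadjoint[OF T(1)], simp only: funpow_swap1)
  define P where "P m x = (\<Sum>j<m. (T ^^ j) x)" for m x
  have P_adj: "cinner (P m x) y = cinner x (P m y)" for m x y
    by (simp add: P_def cinner_sum_left cinner_sum_right T_pow_adj)
  have SP: "S (P m x) = P m (S x)" for m x
    by (simp add: P_def bounded_clinear_sum[OF linS] ST_pow)
  have BP: "(1 / c) *\<^sub>R B (P m x) = x - (T ^^ m) x" for m x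
  proof (induction m)
    case (Suc m)
    have "(1 / c) *\<^sub>R B ((T ^^ m) x) = (T ^^ m) x - T ((T ^^ m) x)" by (simp add: T_def)
    then show ?case
      using Suc by (simp add: P_def bounded_clinear_add[OF linB] scaleR_add_right)
  qed (simp add: P_def bounded_clinear_zero[OF linB])
  have S_sqr: "(norm (S x))\<^sup>2 = Re (cinner (B x) x)" for x
  proof -
    have "cinner (S x) (S x) = cinner (B x) x"
      by (metis SS positive_op_selfadjoint[OF S])
    then show ?thesis by (metis Re_complex_of_real cinner_self)
  qed
  have t0: "0 \<le> t" by (simp add: t_def)
  have hs_S: "hs_le E S (sqrt t)"
    using t0 tr by (intro hs_leI) (simp_all add: S_sqr)
  \<comment> \<open>Even exponents give <x, T^(2j) x> = |T^j x|^2, which dominates |T^(2j) x|^2;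
    expanding the square yields the contraction.\<close>
  have contraction: "norm (x - (T ^^ (j + j)) x) \<le> norm x" for j x
  proof -
    have "Re (cinner x ((T ^^ (j + j)) x)) = (norm ((T ^^ j) x))\<^sup>2"
      by (simp add: funpow_add cinner_self flip: T_pow_adj)
    moreover have "norm ((T ^^ (j + j)) x) \<le> norm ((T ^^ j) x)"
      by (simp add: funpow_add T_pow_norm)
    ultimately have "(norm (x - (T ^^ (j + j)) x))\<^sup>2 \<le> (norm x)\<^sup>2"
      unfolding norm_diff_sqr
      by (smt (verit) norm_ge_zero power_mono zero_le_power2)
    then show ?thesis by (rule power2_le_imp_le) simp
  qed
  have main: "(\<Sum>e\<in>F. cmod (cinner (A (e - (T ^^ (j + j)) e)) e)) \<le> t" for j
  proof -
    define m where "m = j + j"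
    \<comment> \<open>G stands in for the polar part: |G x| = |B S P x| / c = |(1 - T^m) S x| <= |S
      x|, so it inherits the Hilbert-Schmidt bound of S without a partial isometry.\<close>
    define G where "G = (\<lambda>x. (1 / c) *\<^sub>R A (S (P m x)))"
    define G' where "G' = (\<lambda>x. (1 / c) *\<^sub>R P m (S (A' x)))"
    have adjG: "cinner (G x) y = cinner x (G' y)" for x y
      by (simp add: G_def G'_def scaleR_scaleC cinner_scaleC_left cinner_scaleC_right adj P_adj
          positive_op_selfadjoint[OF S])
    have GS: "cinner (A (e - (T ^^ m) e)) e = cinner (S e) (G' e)" for e
      by (simp add: BP[symmetric] adjG[symmetric] G_def bounded_clinear_scaleR[OF A] SP[symmetric] SS)
    have "norm (G x) \<le> norm (S x)" for x
    proof -
      have "norm (G x) = norm ((1 / c) *\<^sub>R B (S (P m x)))" by (simp add: G_def B(2))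
      also have "\<dots> = norm (S x - (T ^^ m) (S x))" by (simp add: SP BP)
      also have "\<dots> \<le> norm (S x)" unfolding m_def by (rule contraction)
      finally show ?thesis .
    qed
    then have "hs_le E G (sqrt t)"
      by (rule hs_le_dominated[OF hs_S])
    then have hs_G': "hs_le E G' (sqrt t)"
      by (rule hs_le_adjoint[OF E adjG])
    have "cmod (cinner (S e) (G' e)) \<le> ((norm (S e))\<^sup>2 + (norm (G' e))\<^sup>2) / 2" for e
      using cinner_Cauchy_Schwarz[of "S e" "G' e"] sum_squares_bound[of "norm (S e)" "norm (G' e)"]
      by (simp add: mult.assoc)
    then have "(\<Sum>e\<in>F. cmod (cinner (A (e - (T ^^ m) e)) e))
        \<le> ((\<Sum>e\<in>F. (norm (S e))\<^sup>2) + (\<Sum>e\<in>F. (norm (G' e))\<^sup>2)) / 2"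
      unfolding GS sum.distrib[symmetric] sum_divide_distrib by (rule sum_mono)
    also have "\<dots> \<le> t"
      using hs_leD(2)[OF hs_S F] hs_leD(2)[OF hs_G' F] t0 by simp
    finally show ?thesis by (simp add: m_def)
  qed
  have vanish: "(\<lambda>j. A ((T ^^ j) x)) \<longlonglongrightarrow> 0" for x
  proof -
    define u where "u j = (norm ((T ^^ j) x))\<^sup>2" for j
    \<comment> \<open>Every application of T costs energy: T^2 <= T gives |T z|^2 <= |z|^2 - <B z,
      z> / c. The norms of T^j x decrease to a limit, so <B z, z> = |S z|^2 tends to 0 along z = T^j
      x.\<close>
    have energy: "(norm (S ((T ^^ j) x)))\<^sup>2 \<le> c * (u j - u (Suc j))" for j
    proof -
      let ?z = "(T ^^ j) x"
      have "(norm (T ?z))\<^sup>2 \<le> Re (cinner (T ?z) ?z)"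
        by (rule positive_contraction_sqr_le[OF T])
      also have "\<dots> = (norm ?z)\<^sup>2 - Re (cinner (B ?z) ?z) / c"
        by (simp add: T_def cinner_diff_left cinner_self scaleR_scaleC cinner_scaleC_left)
      finally have "Re (cinner (B ?z) ?z) / c \<le> u j - u (Suc j)"
        by (simp add: u_def)
      then show ?thesis using c(1) by (simp add: S_sqr field_simps)
    qed
    have "decseq u"
      unfolding u_def by (rule decseq_SucI) (simp add: T power_mono)
    then obtain l where l: "u \<longlonglongrightarrow> l"
      using decseq_convergent[of u 0] by (auto simp: u_def)
    have lim_u: "(\<lambda>j. c * (u j - u (Suc j))) \<longlonglongrightarrow> c * (l - l)"
      by (intro tendsto_intros l LIMSEQ_Suc)
    have "(\<lambda>j. (norm (S ((T ^^ j) x)))\<^sup>2) \<longlonglongrightarrow> 0"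
    proof (rule tendsto_sandwich[OF _ _ tendsto_const])
      show "(\<lambda>j. c * (u j - u (Suc j))) \<longlonglongrightarrow> 0" using lim_u by simp
    qed (use energy in auto)
    from tendsto_real_sqrt[OF this] have "(\<lambda>j. s * norm (S ((T ^^ j) x))) \<longlonglongrightarrow> s * 0"
      by (intro tendsto_mult_left) simp
    then have lim_S: "(\<lambda>j. s * norm (S ((T ^^ j) x))) \<longlonglongrightarrow> 0" by simp
    have "norm (A ((T ^^ j) x)) \<le> s * norm (S ((T ^^ j) x))" for j
      using s(2)[of "S ((T ^^ j) x)"] by (simp add: SS B(2))
    then show ?thesis
      by (intro Lim_null_comparison[OF _ lim_S]) auto
  qed
  have "(\<lambda>j. \<Sum>e\<in>F. cmod (cinner (A e - A ((T ^^ (j + j)) e)) e))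
      \<longlonglongrightarrow> (\<Sum>e\<in>F. cmod (cinner (A e - 0) e))"
  proof (intro tendsto_intros tendsto_cinner)
    fix e show "(\<lambda>j. A ((T ^^ (j + j)) e)) \<longlonglongrightarrow> 0"
      using LIMSEQ_subseq_LIMSEQ[OF vanish[of e], of "\<lambda>j. j + j"]
      by (simp add: strict_mono_def o_def)
  qed
  then show ?thesis
    using main LIMSEQ_le_const2 by (force simp: bounded_clinear_diff[OF A] t_def)
qed

section \<open>Flatness and Lipschitz continuity of the kernel\<close>

text \<open>The mean value inequality on a line. \<open>iter_partial\<close> differentiates at 0
  after a translation, so the derivative at a general s is obtained by shifting the
  parameter.\<close>

lemma axis_increment:
  fixes g :: "real ^ 'd::finite \<Rightarrow> real"
  assumes diff: "\<And>x. (\<lambda>s. g (x + s *\<^sub>R axis i 1)) differentiable (at (0::real))"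
    and bound: "\<And>s. \<bar>s\<bar> \<le> \<bar>t\<bar> \<Longrightarrow> \<bar>deriv (\<lambda>r. g ((x + s *\<^sub>R axis i 1) + r *\<^sub>R axis i 1)) 0\<bar> \<le> B"
  shows "\<bar>g (x + t *\<^sub>R axis i 1) - g x\<bar> \<le> B * \<bar>t\<bar>"
proof -
  define \<phi> where "\<phi> s = g (x + s *\<^sub>R axis i 1)" for s
  define \<phi>' where "\<phi>' s = deriv (\<lambda>r. g ((x + s *\<^sub>R axis i 1) + r *\<^sub>R axis i 1)) 0" for s
  have der: "(\<phi> has_real_derivative \<phi>' s) (at s)" for s
  proof -
    have "((\<lambda>r. g ((x + s *\<^sub>R axis i 1) + r *\<^sub>R axis i 1)) has_real_derivative \<phi>' s) (at 0)"
      using diff[of "x + s *\<^sub>R axis i 1"] DERIV_imp_deriv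
      by (force simp: real_differentiable_def \<phi>'_def)
    then have "((\<lambda>r. \<phi> (r + s)) has_real_derivative \<phi>' s) (at 0)"
      by (simp add: \<phi>_def algebra_simps scaleR_add_left)
    then show ?thesis using DERIV_shift[of \<phi> "\<phi>' s" 0 s] by simp
  qed
  have "norm (\<phi> t - \<phi> 0) \<le> B * norm (t - 0)"
    by (rule field_differentiable_bound[of "cball 0 \<bar>t\<bar>" \<phi> \<phi>'])
       (use der bound in \<open>auto simp: \<phi>'_def intro: DERIV_subset\<close>)
  then show ?thesis by (simp add: \<phi>_def)
qed

text \<open>The path from 0 to x changes one coordinate at a time, so partial derivatives suffice.
  Every point on it has 1-norm at most that of x, which is why the bound is required only
  there.\<close>

lemma coordinatewise_increment:
  fixes g :: "real ^ 'd::finite \<Rightarrow> real"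
  assumes diff: "\<And>i x. (\<lambda>s. g (x + s *\<^sub>R axis i 1)) differentiable (at (0::real))"
    and bound: "\<And>i y. (\<Sum>j\<in>UNIV. \<bar>y $ j\<bar>) \<le> (\<Sum>j\<in>UNIV. \<bar>x $ j\<bar>) \<Longrightarrow>
                  \<bar>deriv (\<lambda>s. g (y + s *\<^sub>R axis i 1)) 0\<bar> \<le> B"
  shows "\<bar>g x - g 0\<bar> \<le> B * (\<Sum>j\<in>UNIV. \<bar>x $ j\<bar>)"
proof -
  define r where "r I = (\<chi> j. if j \<in> I then x $ j else 0)" for I
  have "\<bar>g (r I) - g 0\<bar> \<le> B * (\<Sum>j\<in>I. \<bar>x $ j\<bar>)" if "finite I" for I
    using that
  proof induction
    case empty
    have "r {} = 0" by (simp add: r_def vec_eq_iff)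
    then show ?case by simp
  next
    case (insert i I)
    have "r (insert i I) = r I + (x $ i) *\<^sub>R axis i 1"
      using insert by (auto simp: r_def vec_eq_iff axis_def)
    moreover have "\<bar>g (r I + (x $ i) *\<^sub>R axis i 1) - g (r I)\<bar> \<le> B * \<bar>x $ i\<bar>"
    proof (rule axis_increment[OF diff])
      fix s assume "\<bar>s\<bar> \<le> \<bar>x $ i\<bar>"
      then have "(\<Sum>j\<in>UNIV. \<bar>(r I + s *\<^sub>R axis i 1) $ j\<bar>) \<le> (\<Sum>j\<in>UNIV. \<bar>x $ j\<bar>)"
        using insert by (intro sum_mono) (auto simp: r_def axis_def)
      then show "\<bar>deriv (\<lambda>s'. g ((r I + s *\<^sub>R axis i 1) + s' *\<^sub>R axis i 1)) 0\<bar> \<le> B"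
        by (rule bound)
    qed
    ultimately show ?case using insert by (simp add: distrib_left)
  qed
  from this[of UNIV] show ?thesis by (simp add: r_def)
qed

lemma partials_differentiable:
  assumes "partials_exist m g" "length js < m"
  shows "(\<lambda>s. iter_partial js g (x + s *\<^sub>R axis i 1)) differentiable (at (0::real))"
  using assms by (auto simp: partials_exist_def)

text \<open>
  No Taylor formula is needed: integrating along the coordinate axes from the origin, a bound
  \<open>B r\<^sup>j\<close> for all partial derivatives of order \<open>m - j\<close> becomes a bound \<open>B r\<^sup>j\<^sup>+\<^sup>1\<close> for those of
  order \<open>m - j - 1\<close>, where \<open>r\<close> is the 1-norm of the argument.
\<close>

lemma iter_partial_flat_bound:
  fixes g :: "real ^ 'd::finite \<Rightarrow> real"
  assumes smooth: "partials_exist m g"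
    and flat: "\<And>js. js \<noteq> [] \<Longrightarrow> length js < m \<Longrightarrow> iter_partial js g 0 = 0"
    and top: "\<And>js x. length js = m \<Longrightarrow> \<bar>iter_partial js g x\<bar> \<le> B"
    and m: "0 < m" and len: "length js + j = m"
  shows "\<bar>iter_partial js g x - (if js = [] then g 0 else 0)\<bar> \<le> B * (\<Sum>i\<in>UNIV. \<bar>x $ i\<bar>) ^ j"
  using len
proof (induction j arbitrary: js x)
  case 0
  then show ?case using top[of js x] m by auto
next
  case (Suc j)
  let ?r = "\<Sum>i\<in>UNIV. \<bar>x $ i\<bar>"
  \<comment> \<open>Any list of length m exhibits a nonnegative number below B.\<close>
  have B: "0 \<le> B" using top[of "replicate m undefined" 0] by force
  have "\<bar>iter_partial js g x - iter_partial js g 0\<bar> \<le> (B * ?r ^ j) * ?r"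
  proof (rule coordinatewise_increment)
    show "(\<lambda>s. iter_partial js g (y + s *\<^sub>R axis i 1)) differentiable (at 0)" for i y
      using Suc.prems by (intro partials_differentiable[OF smooth]) auto
    fix i and y :: "real ^ 'd" assume le: "(\<Sum>j\<in>UNIV. \<bar>y $ j\<bar>) \<le> ?r"
    have "\<bar>iter_partial (i # js) g y\<bar> \<le> B * (\<Sum>i\<in>UNIV. \<bar>y $ i\<bar>) ^ j"
      using Suc.IH[of "i # js" y] Suc.prems by simp
    also have "\<dots> \<le> B * ?r ^ j"
      using le B by (intro mult_left_mono power_mono) (auto intro: sum_nonneg)
    finally show "\<bar>deriv (\<lambda>s. iter_partial js g (y + s *\<^sub>R axis i 1)) 0\<bar> \<le> B * ?r ^ j"
      by simp
  qed
  moreover have "iter_partial js g 0 = (if js = [] then g 0 else 0)"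
    using flat[of js] Suc.prems by auto
  ultimately show ?case by (simp add: mult_ac)
qed

text \<open>The exterior of a closed ball is open, so a function that vanishes there vanishes near
  each of its points, and differentiation preserves this.\<close>

lemma iter_partial_outside_support:
  fixes g :: "real ^ 'd::finite \<Rightarrow> real"
  assumes supp: "\<And>x. R < norm x \<Longrightarrow> g x = 0" and "R < norm x"
  shows "iter_partial js g x = 0"
  using assms(2)
proof (induction js arbitrary: x)
  case (Cons i js)
  have "((\<lambda>s::real. norm (x + s *\<^sub>R axis i 1)) \<longlongrightarrow> norm (x + 0 *\<^sub>R axis i 1)) (nhds 0)"
    by (intro tendsto_intros filterlim_ident)
  then have "\<forall>\<^sub>F s::real in nhds 0. R < norm (x + s *\<^sub>R axis i 1)"
    using Cons.prems by (intro order_tendstoD(1)) auto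
  then have "\<forall>\<^sub>F s::real in nhds 0. iter_partial js g (x + s *\<^sub>R axis i 1) = 0"
    by eventually_elim (rule Cons.IH)
  then have "deriv (\<lambda>s::real. iter_partial js g (x + s *\<^sub>R axis i 1)) 0 = deriv (\<lambda>_. 0) (0::real)"
    by (rule deriv_cong_ev) simp
  then show ?case by simp
qed (simp add: supp)

text \<open>Every axis leaves the support within distance \<open>2 R + 1\<close>.\<close>

lemma iter_partial_compact_support_bound:
  fixes g :: "real ^ 'd::finite \<Rightarrow> real"
  assumes smooth: "partials_exist m g" and supp: "\<And>x. R < norm x \<Longrightarrow> g x = 0" and R: "0 \<le> R"
    and top: "\<And>js x. length js = m \<Longrightarrow> \<bar>iter_partial js g x\<bar> \<le> B"
    and len: "length js + j = m"
  shows "\<bar>iter_partial js g x\<bar> \<le> B * (2 * R + 1) ^ j"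
  using len
proof (induction j arbitrary: js x)
  case 0
  then show ?case using top[of js x] by simp
next
  case (Suc j)
  have B: "0 \<le> B" using top[of "replicate m undefined" 0] by force
  show ?case
  proof (cases "R < norm x")
    case True
    then show ?thesis
      using iter_partial_outside_support[of R g x js] supp R B by simp
  next
    case False
    fix i :: 'd
    let ?y = "x + (2 * R + 1) *\<^sub>R axis i 1"
    have "norm ((2 * R + 1) *\<^sub>R axis i 1 :: real ^ 'd) - norm x \<le> norm ?y"
      by (metis add.commute norm_diff_ineq)
    then have "R < norm ?y" using False R by (simp add: norm_eq_sqrt_inner inner_axis_axis)
    then have "iter_partial js g ?y = 0"
      using iter_partial_outside_support supp by blast
    moreover have "\<bar>iter_partial js g ?y - iter_partial js g x\<bar> \<le> B * (2 * R + 1) ^ j * \<bar>2 * R + 1\<bar>"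
    proof (rule axis_increment)
      show "(\<lambda>s. iter_partial js g (y + s *\<^sub>R axis i 1)) differentiable (at 0)" for y
        using Suc.prems by (intro partials_differentiable[OF smooth]) auto
      show "\<bar>deriv (\<lambda>r. iter_partial js g (x + s *\<^sub>R axis i 1 + r *\<^sub>R axis i 1)) 0\<bar>
              \<le> B * (2 * R + 1) ^ j" for s
        using Suc.IH[of "i # js" "x + s *\<^sub>R axis i 1"] Suc.prems by simp
    qed
    ultimately show ?thesis using R by (simp add: mult_ac)
  qed
qed

text \<open>Every list is an ordering of its own vector of multiplicities; this converts hypotheses
  on multi-indices into statements about lists of a given length.\<close>

lemma multi_size_count_list:
  fixes js :: "'d::finite list"
  shows "multi_size (\<chi> i. count_list js i) = length js" "js \<in> orderings_of (\<chi> i. count_list js i)"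
  by (simp_all add: multi_size_def orderings_of_def sum_count_set)

text \<open>There are finitely many lists of length m over the coordinates, so the separate bounds
  have a common one.\<close>

lemma top_partials_bounded:
  fixes g :: "real ^ 'd::finite \<Rightarrow> real"
  assumes top: "\<And>\<alpha> js. multi_size \<alpha> = m \<Longrightarrow> js \<in> orderings_of \<alpha> \<Longrightarrow> bounded (range (iter_partial js g))"
  shows "\<exists>B. \<forall>js x. length js = m \<longrightarrow> \<bar>iter_partial js g x\<bar> \<le> B"
proof -
  have "finite {js :: 'd list. length js = m}"
    using finite_lists_length_eq[of "UNIV :: 'd set" m] by simp
  moreover have "bounded (range (iter_partial js g))" if "length js = m" for js
    using top[of "\<chi> i. count_list js i" js] that multi_size_count_list[of js] by simp
  ultimately have "bounded (\<Union>js\<in>{js. length js = m}. range (iter_partial js g))"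
    by (intro bounded_UN) auto
  then show ?thesis by (fastforce simp: bounded_iff)
qed

text \<open>Inside the unit ball, flatness of order lam + 1 is stronger than order \<beta>; outside
  it, 0 <= K <= 1 already suffices because |x|^\<beta> >= 1.\<close>

lemma kernel_flat_at_origin:
  fixes K :: "real ^ 'd::finite \<Rightarrow> real"
  assumes smooth: "partials_exist (lam + 1) K"
    and flat: "\<And>\<alpha> js. 1 \<le> multi_size \<alpha> \<Longrightarrow> multi_size \<alpha> \<le> lam \<Longrightarrow> js \<in> orderings_of \<alpha> \<Longrightarrow>
                 iter_partial js K 0 = 0"
    and top: "\<And>\<alpha> js. multi_size \<alpha> = lam + 1 \<Longrightarrow> js \<in> orderings_of \<alpha> \<Longrightarrow>
                bounded (range (iter_partial js K))"
    and range: "\<And>x. 0 \<le> K x" "\<And>x. K x \<le> 1" "K 0 = 1" and \<beta>: "0 < \<beta>" "\<beta> \<le> real lam + 1"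
  obtains c where "0 \<le> c" "\<And>x. \<bar>1 - K x\<bar> \<le> c * norm x powr \<beta>"
proof -
  obtain B where B: "\<And>js x. length js = lam + 1 \<Longrightarrow> \<bar>iter_partial js K x\<bar> \<le> B"
    using top_partials_bounded[of "lam + 1" K] top by blast
  have B0: "0 \<le> B" using B[of "replicate (lam + 1) undefined" 0] by force
  have flat': "iter_partial js K 0 = 0" if "js \<noteq> []" "length js < lam + 1" for js
    using flat[of "\<chi> i. count_list js i" js] that multi_size_count_list[of js]
    by (cases js) auto
  have bound: "\<bar>K x - 1\<bar> \<le> B * (\<Sum>i\<in>UNIV. \<bar>x $ i\<bar>) ^ (lam + 1)" for x
    using iter_partial_flat_bound[OF smooth flat' B, where js = "[]" and j = "lam + 1" and x = x]
      range(3) by simp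
  \<comment> \<open>The power of the dimension compares the 1-norm with the Euclidean norm; the
    summand 1 serves the region |x| > 1.\<close>
  define c where "c = B * real CARD('d) ^ (lam + 1) + 1"
  have c: "1 \<le> c" using B0 by (simp add: c_def)
  have "\<bar>1 - K x\<bar> \<le> c * norm x powr \<beta>" for x
  proof (cases "norm x \<le> 1")
    case False
    then have "1 \<le> norm x powr \<beta>" using \<beta> by (simp add: ge_one_powr_ge_zero)
    then have "1 * 1 \<le> c * norm x powr \<beta>" using c by (intro mult_mono) auto
    then show ?thesis using range(1,2)[of x] by simp
  next
    case True
    have "(\<Sum>i\<in>UNIV. \<bar>x $ i\<bar>) \<le> real CARD('d) * norm x"
      using sum_bounded_above[of UNIV "\<lambda>i. \<bar>x $ i\<bar>" "norm x"] component_le_norm_cart[where x = x]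
      by simp
    then have "\<bar>1 - K x\<bar> \<le> B * (real CARD('d) * norm x) ^ (lam + 1)"
      using bound[of x] mult_left_mono[OF power_mono B0]
      by (smt (verit) sum_nonneg abs_ge_zero)
    also have "\<dots> = (c - 1) * norm x ^ (lam + 1)" by (simp add: c_def power_mult_distrib)
    also have "\<dots> \<le> c * norm x ^ (lam + 1)" by (intro mult_right_mono) auto
    also have "\<dots> \<le> c * norm x powr \<beta>"
    proof (cases "x = 0")
      case False
      then have "norm x ^ (lam + 1) = norm x powr (real lam + 1)"
        by (simp add: powr_realpow[symmetric] powr_add)
      also have "\<dots> \<le> norm x powr \<beta>" using True \<beta> False by (intro powr_mono') auto
      finally show ?thesis using c by (intro mult_left_mono) auto
    qed simp
    finally show ?thesis .
  qed
  then show ?thesis using that[of c] c by simp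
qed

text \<open>Bounds are assumed for the top derivatives; compact support passes them down to the
  first ones. The purpose is to make K small near the faces of the box of differences.\<close>

lemma kernel_axis_Lipschitz:
  fixes K :: "real ^ 'd::finite \<Rightarrow> real"
  assumes smooth: "partials_exist (lam + 1) K"
    and top: "\<And>\<alpha> js. multi_size \<alpha> = lam + 1 \<Longrightarrow> js \<in> orderings_of \<alpha> \<Longrightarrow>
                bounded (range (iter_partial js K))"
    and supp: "\<And>x. R < norm x \<Longrightarrow> K x = 0" and R: "0 \<le> R"
  obtains Q where "0 \<le> Q" "\<And>x i t. \<bar>K (x + t *\<^sub>R axis i 1) - K x\<bar> \<le> Q * \<bar>t\<bar>"
proof -
  obtain B where B: "\<And>js x. length js = lam + 1 \<Longrightarrow> \<bar>iter_partial js K x\<bar> \<le> B"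
    using top_partials_bounded[of "lam + 1" K] top by blast
  have B0: "0 \<le> B" using B[of "replicate (lam + 1) undefined" 0] by force
  have first: "\<bar>iter_partial [i] K x\<bar> \<le> B * (2 * R + 1) ^ lam" for i x
    by (rule iter_partial_compact_support_bound[OF smooth supp R B]) auto
  have "\<bar>K (x + t *\<^sub>R axis i 1) - K x\<bar> \<le> B * (2 * R + 1) ^ lam * \<bar>t\<bar>" for x i t
    using first partials_differentiable[OF smooth, of "[]"] by (intro axis_increment) auto
  then show ?thesis using B0 R by (intro that[of "B * (2 * R + 1) ^ lam"]) auto
qed

section \<open>Uniqueness of absolutely convergent Fourier series\<close>

text \<open>Distributivity over a product of finite sets; it factorises grid characters,
  cardinalities and axis weights.\<close>

lemma sum_vec_prod:
  fixes f :: "'d::finite \<Rightarrow> 'b \<Rightarrow> 'c::comm_semiring_1"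
  assumes "\<And>l. finite (S l)"
  shows "(\<Sum>t\<in>{t. \<forall>l. t $ l \<in> S l}. \<Prod>l\<in>UNIV. f l (t $ l)) = (\<Prod>l\<in>UNIV. \<Sum>j\<in>S l. f l j)"
proof -
  have "(\<Sum>t\<in>{t. \<forall>l. t $ l \<in> S l}. \<Prod>l\<in>UNIV. f l (t $ l))
      = (\<Sum>g\<in>PiE UNIV S. \<Prod>l\<in>UNIV. f l (g l))"
    by (rule sum.reindex_bij_witness[of _ vec_lambda vec_nth]) auto
  also have "\<dots> = (\<Prod>l\<in>UNIV. \<Sum>j\<in>S l. f l j)"
    using assms by (subst prod_sum_PiE) auto
  finally show ?thesis .
qed

lemma finite_vec_box:
  assumes "\<And>l::'d::finite. finite (S l)"
  shows "finite {t :: 'b ^ 'd. \<forall>l. t $ l \<in> S l}"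
proof -
  have "{t :: 'b ^ 'd. \<forall>l. t $ l \<in> S l} = vec_lambda ` PiE UNIV S"
    by (force simp: image_iff intro: bexI[of _ "vec_nth _"])
  then show ?thesis using assms by (simp add: finite_PiE)
qed

lemma card_vec_box:
  assumes "\<And>l::'d::finite. finite (S l)"
  shows "card {t :: 'b ^ 'd. \<forall>l. t $ l \<in> S l} = (\<Prod>l\<in>UNIV. card (S l))"
  using sum_vec_prod[OF assms, of "\<lambda>_ _. 1 :: nat"] by simp

lemma has_sum_sum:
  fixes f :: "'a \<Rightarrow> 'b \<Rightarrow> 'c::topological_comm_monoid_add"
  assumes "finite T" "\<And>t. t \<in> T \<Longrightarrow> ((\<lambda>k. f t k) has_sum s t) A"
  shows "((\<lambda>k. \<Sum>t\<in>T. f t k) has_sum (\<Sum>t\<in>T. s t)) A"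
  using assms by (induction T) (auto intro!: has_sum_add)

lemma real_vec_diff: "real_vec (a - b) = real_vec a - real_vec b"
  by (simp add: real_vec_def vec_eq_iff)

lemma cis_eq_1_iff: "cis x = 1 \<longleftrightarrow> (\<exists>n::int. x = of_int (2 * n) * pi)"
  by (simp add: cis_conv_exp exp_eq_1)

lemma cis_sum: "finite S \<Longrightarrow> cis (sum f S) = (\<Prod>i\<in>S. cis (f i))"
  by (induction S rule: finite_induct) (simp_all flip: cis_mult)

lemma sum_roots_of_unity:
  assumes N: "0 < N"
  shows "(\<Sum>j<N. cis (2 * pi * real_of_int a * real j / real N)) = (if int N dvd a then of_nat N else 0)"
proof -
  define z where "z = cis (2 * pi * real_of_int a / real N)"
  have pow: "cis (2 * pi * real_of_int a * real j / real N) = z ^ j" for j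
    unfolding z_def Complex.DeMoivre by (rule arg_cong[of _ _ cis]) simp
  have zN: "z ^ N = 1"
    unfolding z_def Complex.DeMoivre cis_eq_1_iff using N by (intro exI[of _ a]) simp
  have z1: "z = 1 \<longleftrightarrow> int N dvd a"
  proof
    assume "z = 1"
    then obtain k where "2 * pi * real_of_int a / real N = of_int (2 * k) * pi"
      unfolding z_def cis_eq_1_iff by blast
    then have "real_of_int a = real_of_int (int N * k)"
      using N by (simp add: field_simps)
    then show "int N dvd a" by (metis dvd_triv_left of_int_eq_iff)
  next
    assume "int N dvd a"
    then obtain k where "a = int N * k" by blast
    then show "z = 1"
      unfolding z_def cis_eq_1_iff using N by (intro exI[of _ k]) simp
  qed
  show ?thesis
  proof (cases "z = 1")
    case True
    then show ?thesis using z1 by (simp add: pow)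
  next
    case False
    then show ?thesis using z1 zN by (simp add: pow geometric_sum)
  qed
qed

text \<open>
  Averaging \<open>e\<^sup>-\<^sup>i\<^sup>m\<^sup>\<theta>\<close> times the series over the grid \<open>\<theta> \<in> (2 \<pi> / N) {0, \<dots>, N - 1}\<^sup>d\<close> leaves exactly the
  coefficients with index congruent to \<open>m\<close> modulo \<open>N\<close>.
\<close>

lemma sum_grid_characters:
  fixes k :: "int ^ 'd::finite"
  assumes "0 < N"
  shows "(\<Sum>t\<in>{t. \<forall>l. t $ l \<in> {..<N}}. cis (real_vec k \<bullet> (\<chi> l. 2 * pi * real (t $ l) / real N)))
      = (if \<forall>l. int N dvd k $ l then of_nat N ^ CARD('d) else 0)"
proof -
  have "cis (real_vec k \<bullet> (\<chi> l. 2 * pi * real (t $ l) / real N))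
      = (\<Prod>l\<in>UNIV. cis (2 * pi * real_of_int (k $ l) * real (t $ l) / real N))" for t :: "nat ^ 'd"
  proof -
    have "real_vec k \<bullet> (\<chi> l. 2 * pi * real (t $ l) / real N)
        = (\<Sum>l\<in>UNIV. 2 * pi * real_of_int (k $ l) * real (t $ l) / real N)"
      by (auto simp: inner_vec_def real_vec_def intro!: sum.cong)
    then show ?thesis by (simp only: cis_sum finite)
  qed
  then have "(\<Sum>t\<in>{t. \<forall>l. t $ l \<in> {..<N}}. cis (real_vec k \<bullet> (\<chi> l. 2 * pi * real (t $ l) / real N)))
      = (\<Prod>l\<in>UNIV. \<Sum>j<N. cis (2 * pi * real_of_int (k $ l) * real j / real N))"
    using sum_vec_prod[of "\<lambda>_. {..<N}"
        "\<lambda>l j. cis (2 * pi * real_of_int (k $ l) * real j / real N)"] by simp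
  also have "\<dots> = (\<Prod>l\<in>UNIV. if int N dvd k $ l then of_nat N else 0)"
    by (simp only: sum_roots_of_unity[OF assms])
  also have "\<dots> = (if \<forall>l. int N dvd k $ l then of_nat N ^ CARD('d) else 0)"
    by auto
  finally show ?thesis .
qed

text \<open>Let F leave at most |a m| / 2 of the total mass outside, and let N be so large that no
  other element of F is congruent to m. The grid average keeps the residue class of m only, and the
  rest of that class is too light to cancel a nonzero a m.\<close>

lemma Fourier_coefficients_unique:
  fixes a :: "int ^ 'd::finite \<Rightarrow> complex"
  assumes abs: "(\<lambda>k. norm (a k)) summable_on UNIV"
    and zero: "\<And>\<theta>. (\<Sum>\<^sub>\<infinity>k. cis (real_vec k \<bullet> \<theta>) * a k) = 0"
  shows "a m = 0"
proof (rule ccontr)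
  assume am: "a m \<noteq> 0"
  obtain F where F: "finite F" and tail: "\<And>G. finite G \<Longrightarrow> G \<inter> F = {} \<Longrightarrow> (\<Sum>k\<in>G. norm (a k)) \<le> norm (a m) / 2"
  proof -
    have "((\<lambda>k. norm (a k)) has_sum infsum (\<lambda>k. norm (a k)) UNIV) UNIV"
      using abs by (rule has_sum_infsum)
    then obtain F where F: "finite F"
      "\<And>Y. finite Y \<Longrightarrow> F \<subseteq> Y \<Longrightarrow> dist (\<Sum>k\<in>Y. norm (a k)) (infsum (\<lambda>k. norm (a k)) UNIV) < norm (a m) / 4"
      using am unfolding has_sum_def tendsto_iff eventually_finite_subsets_at_top
      by (metis (no_types, lifting) subset_UNIV zero_less_divide_iff zero_less_norm_iff zero_less_numeral)
    have "(\<Sum>k\<in>G. norm (a k)) \<le> norm (a m) / 2" if "finite G" "G \<inter> F = {}" for G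
    proof -
      have "(\<Sum>k\<in>F \<union> G. norm (a k)) = (\<Sum>k\<in>F. norm (a k)) + (\<Sum>k\<in>G. norm (a k))"
        using that F by (intro sum.union_disjoint) auto
      moreover have "\<bar>(\<Sum>k\<in>F. norm (a k)) - infsum (\<lambda>k. norm (a k)) UNIV\<bar> < norm (a m) / 4"
        "\<bar>(\<Sum>k\<in>F \<union> G. norm (a k)) - infsum (\<lambda>k. norm (a k)) UNIV\<bar> < norm (a m) / 4"
        using F(2)[of F] F(2)[of "F \<union> G"] F(1) that by (simp_all add: dist_real_def)
      ultimately show ?thesis by linarith
    qed
    then show thesis using that F(1) by blast
  qed
  obtain N where N: "0 < N" "\<And>k. k \<in> F \<Longrightarrow> (\<forall>l. int N dvd (k - m) $ l) \<Longrightarrow> k = m"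
  proof -
    \<comment> \<open>b exceeds every coordinate of k - m in absolute value for k in F, so a
      coordinate divisible by b must vanish.\<close>
    define b where "b = (\<Sum>k\<in>F. \<Sum>l\<in>UNIV. \<bar>(k - m) $ l\<bar>) + 1"
    have le: "\<bar>(k - m) $ l\<bar> < b" if "k \<in> F" for k l
    proof -
      have "\<bar>(k - m) $ l\<bar> \<le> (\<Sum>l\<in>UNIV. \<bar>(k - m) $ l\<bar>)"
        by (rule member_le_sum) auto
      also have "\<dots> \<le> (\<Sum>k\<in>F. \<Sum>l\<in>UNIV. \<bar>(k - m) $ l\<bar>)"
        using that F by (intro member_le_sum[of k F "\<lambda>k. \<Sum>l\<in>UNIV. \<bar>(k - m) $ l\<bar>"]) (auto intro: sum_nonneg)
      finally show ?thesis by (simp add: b_def)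
    qed
    have b: "0 < b" by (simp add: b_def add_nonneg_pos sum_nonneg)
    have "k = m" if "k \<in> F" "\<forall>l. int (nat b) dvd (k - m) $ l" for k
    proof -
      have "(k - m) $ l = 0" for l
        using that le[OF that(1), of l] b zdvd_not_zless[of "\<bar>(k - m) $ l\<bar>" b] by auto
      then show ?thesis by (simp add: vec_eq_iff)
    qed
    then show thesis using that[of "nat b"] b by simp
  qed
  define D where "D = {k. \<forall>l. int N dvd (k - m) $ l}"
  let ?T = "{t :: nat ^ 'd. \<forall>l. t $ l \<in> {..<N}}"
  let ?\<theta> = "\<lambda>t :: nat ^ 'd. \<chi> l. 2 * pi * real (t $ l) / real N :: real ^ 'd"
  have fin_T: "finite ?T" by (rule finite_vec_box) simp
  have term_sum: "(\<lambda>k. cis (real_vec k \<bullet> \<theta>) * a k) summable_on UNIV" for \<theta>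
    using abs by (intro abs_summable_summable[where f = "\<lambda>k. cis (real_vec k \<bullet> \<theta>) * a k"])
      (simp add: norm_mult)
  have "((\<lambda>k. \<Sum>t\<in>?T. cnj (cis (real_vec m \<bullet> ?\<theta> t)) * (cis (real_vec k \<bullet> ?\<theta> t) * a k)) has_sum
         (\<Sum>t\<in>?T. cnj (cis (real_vec m \<bullet> ?\<theta> t)) * 0)) UNIV"
    using has_sum_infsum[OF term_sum] unfolding zero
    by (intro has_sum_sum[OF fin_T] has_sum_cmult_right)
  moreover have "(\<Sum>t\<in>?T. cnj (cis (real_vec m \<bullet> ?\<theta> t)) * (cis (real_vec k \<bullet> ?\<theta> t) * a k))
      = (if k \<in> D then of_nat N ^ CARD('d) * a k else 0)" for k
  proof -
    have "cnj (cis (real_vec m \<bullet> \<theta>)) * (cis (real_vec k \<bullet> \<theta>) * a k) = cis (real_vec (k - m) \<bullet> \<theta>) * a k" for \<theta>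
      by (simp add: cis_cnj cis_mult real_vec_diff inner_diff_left flip: mult.assoc)
    then have "(\<Sum>t\<in>?T. cnj (cis (real_vec m \<bullet> ?\<theta> t)) * (cis (real_vec k \<bullet> ?\<theta> t) * a k))
        = (\<Sum>t\<in>?T. cis (real_vec (k - m) \<bullet> ?\<theta> t)) * a k"
      by (simp only: sum_distrib_right)
    also have "\<dots> = (if k \<in> D then of_nat N ^ CARD('d) * a k else 0)"
      by (subst sum_grid_characters[OF N(1)]) (simp add: D_def)
    finally show ?thesis .
  qed
  ultimately have "((\<lambda>k. if k \<in> D then of_nat N ^ CARD('d) * a k else 0) has_sum 0) UNIV"
    by simp
  then have "((\<lambda>k. inverse (of_nat N ^ CARD('d)) * (if k \<in> D then of_nat N ^ CARD('d) * a k else 0)) has_sum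
       inverse (of_nat N ^ CARD('d)) * 0) UNIV"
    by (rule has_sum_cmult_right)
  then have hs0: "((\<lambda>k. if k \<in> D then a k else 0) has_sum 0) UNIV"
    using N(1) by (simp add: if_distrib mult.assoc[symmetric] cong: if_cong)
  have "norm (a m) \<le> norm (a m) / 2"
  proof (rule tendsto_upperbound)
    have "((\<lambda>G. norm (a m - (\<Sum>k\<in>G. if k \<in> D then a k else 0))) \<longlongrightarrow> norm (a m - 0)) (finite_subsets_at_top UNIV)"
      using hs0 by (intro tendsto_intros) (simp add: has_sum_def)
    then show "((\<lambda>G. norm (a m - (\<Sum>k\<in>G. if k \<in> D then a k else 0))) \<longlongrightarrow> norm (a m)) (finite_subsets_at_top UNIV)"
      by simp
    show "\<forall>\<^sub>F G in finite_subsets_at_top UNIV. norm (a m - (\<Sum>k\<in>G. if k \<in> D then a k else 0)) \<le> norm (a m) / 2"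
      unfolding eventually_finite_subsets_at_top
    proof (intro exI[of _ "insert m F"] conjI allI impI)
      fix G assume G: "finite G \<and> insert m F \<subseteq> G \<and> G \<subseteq> UNIV"
      let ?H = "(G \<inter> D) - {m}"
      have "m \<in> D" by (simp add: D_def)
      have "(\<Sum>k\<in>G. if k \<in> D then a k else 0) = (\<Sum>k\<in>G \<inter> D. a k)"
        using G by (simp add: sum.inter_restrict)
      also have "\<dots> = a m + (\<Sum>k\<in>?H. a k)"
        using G \<open>m \<in> D\<close> by (intro sum.remove) auto
      finally have "norm (a m - (\<Sum>k\<in>G. if k \<in> D then a k else 0)) = norm (\<Sum>k\<in>?H. a k)"
        by (simp add: norm_minus_cancel)
      also have "\<dots> \<le> (\<Sum>k\<in>?H. norm (a k))" by (rule norm_sum)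
      also have "\<dots> \<le> norm (a m) / 2"
        using G N(2) by (intro tail) (auto simp: D_def)
      finally show "norm (a m - (\<Sum>k\<in>G. if k \<in> D then a k else 0)) \<le> norm (a m) / 2" .
    qed (use F in auto)
  qed simp
  then show False using am by simp
qed

section \<open>Lattice boxes and the kernel sum\<close>

text \<open>For a nonempty \<open>lattice_box n\<close> this is the set of its differences. The
  description by coordinates makes it a product set for \<open>sum_vec_prod\<close>, and the strict
  inequality keeps the overlaps positive.\<close>

definition diff_box :: "nat ^ 'd \<Rightarrow> (int ^ 'd) set" where
  "diff_box n = {k. \<forall>l. k $ l \<in> {j. \<bar>j\<bar> < int (n $ l)}}"

lemma abs_of_int_less_of_nat: "\<bar>j\<bar> < int m \<Longrightarrow> \<bar>real_of_int j\<bar> < real m"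
  by (metis of_int_abs of_int_less_iff of_int_of_nat_eq)

lemma finite_abs_less_int: "finite {j :: int. \<bar>j\<bar> < b}"
  by (rule finite_subset[of _ "{- b..b}"]) auto

lemma finite_diff_box: "finite (diff_box (n :: nat ^ 'd::finite))"
  unfolding diff_box_def by (rule finite_vec_box) (rule finite_abs_less_int)

lemma lattice_box_eq: "lattice_box n = {t. \<forall>l. t $ l \<in> {1..int (n $ l)}}"
  by (auto simp: lattice_box_def)

lemma finite_lattice_box: "finite (lattice_box (n :: nat ^ 'd::finite))"
  unfolding lattice_box_eq by (rule finite_vec_box) simp

lemma card_lattice_box: "card (lattice_box (n :: nat ^ 'd::finite)) = (\<Prod>l\<in>UNIV. n $ l)"
  unfolding lattice_box_eq by (subst card_vec_box) auto

lemma lattice_box_diff: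
  assumes "a \<in> lattice_box n" "b \<in> lattice_box n"
  shows "a - b \<in> diff_box n"
proof -
  have "\<bar>a $ l - b $ l\<bar> < int (n $ l)" for l
    using assms by (auto simp: lattice_box_def abs_less_iff dest!: spec[of _ l])
  then show ?thesis by (simp add: diff_box_def)
qed

lemma overlap_volume_eq:
  fixes k :: "int ^ 'd::finite"
  assumes "k \<in> diff_box n"
  shows "overlap_volume n k = (\<Prod>l\<in>UNIV. real (n $ l) - \<bar>real_of_int (k $ l)\<bar>)"
proof -
  \<comment> \<open>The box meets its translate in a box again, with sides n_l - |k_l|.\<close>
  let ?a = "\<chi> l. max 0 (- real_of_int (k $ l))" and ?b = "\<chi> l. min (real (n $ l)) (real (n $ l) - real_of_int (k $ l))"
  have less: "\<bar>real_of_int (k $ l)\<bar> < real (n $ l)" for l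
    using assms by (simp add: diff_box_def abs_of_int_less_of_nat)
  have "x \<in> (\<lambda>x. x - real_vec k) ` solid_box n \<longleftrightarrow> x + real_vec k \<in> solid_box n" for x
    by (auto simp: image_iff algebra_simps intro!: bexI[of _ "x + real_vec k"])
  then have "solid_box n \<inter> (\<lambda>x. x - real_vec k) ` solid_box n = cbox ?a ?b"
    by (auto simp: solid_box_def mem_box_cart real_vec_def) (smt (verit))+
  then have "overlap_volume n k = measure lborel (cbox ?a ?b)"
    unfolding overlap_volume_def by (simp add: measure_completion)
  also have "\<dots> = (\<Prod>l\<in>UNIV. ?b $ l - ?a $ l)"
  proof (rule content_cbox_cart)
    have "?a \<in> cbox ?a ?b" using less by (auto simp: mem_box_cart) (smt (verit))+
    then show "cbox ?a ?b \<noteq> {}" by blast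
  qed
  also have "\<dots> = (\<Prod>l\<in>UNIV. real (n $ l) - \<bar>real_of_int (k $ l)\<bar>)"
    using less by (intro prod.cong) (auto simp: max_def min_def)
  finally show ?thesis .
qed

lemma overlap_volume_pos:
  assumes "k \<in> diff_box (n :: nat ^ 'd::finite)"
  shows "0 < overlap_volume n k"
  unfolding overlap_volume_eq[OF assms]
proof (rule prod_pos)
  fix l show "0 < real (n $ l) - \<bar>real_of_int (k $ l)\<bar>"
    using assms by (simp add: diff_box_def abs_of_int_less_of_nat)
qed

text \<open>In each coordinate, n_l consecutive integers and their translate by k_l share n_l -
  |k_l| points, which is also the length of the overlap of the real intervals. The normalisation by
  volume is therefore exact and leaves no edge effect in the mean.\<close>

lemma card_pairs_with_difference:
  fixes k :: "int ^ 'd::finite"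
  assumes k: "k \<in> diff_box n"
  shows "real (card {p \<in> lattice_box n \<times> lattice_box n. fst p - snd p = k}) = overlap_volume n k"
proof -
  let ?S = "\<lambda>l. {max 1 (1 - k $ l)..min (int (n $ l)) (int (n $ l) - k $ l)}"
  have box: "s + k \<in> lattice_box n \<and> s \<in> lattice_box n \<longleftrightarrow> (\<forall>l. s $ l \<in> ?S l)" for s
  proof -
    have "(1 \<le> s $ l + k $ l \<and> s $ l + k $ l \<le> int (n $ l)) \<and> (1 \<le> s $ l \<and> s $ l \<le> int (n $ l))
        \<longleftrightarrow> s $ l \<in> ?S l" for l
      by auto
    then show ?thesis unfolding lattice_box_def mem_Collect_eq vector_add_component by blast
  qed
  have "{p \<in> lattice_box n \<times> lattice_box n. fst p - snd p = k} = (\<lambda>s. (s + k, s)) ` {s. \<forall>l. s $ l \<in> ?S l}"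
    unfolding box[symmetric] by (auto simp: image_iff algebra_simps)
  then have "card {p \<in> lattice_box n \<times> lattice_box n. fst p - snd p = k} = card {s. \<forall>l. s $ l \<in> ?S l}"
    by (simp only:) (rule card_image, simp add: inj_on_def)
  also have "\<dots> = (\<Prod>l\<in>UNIV. card (?S l))"
    by (rule card_vec_box) simp
  finally have "real (card {p \<in> lattice_box n \<times> lattice_box n. fst p - snd p = k})
      = (\<Prod>l\<in>UNIV. real (card (?S l)))" by simp
  also have "\<dots> = (\<Prod>l\<in>UNIV. real (n $ l) - \<bar>real_of_int (k $ l)\<bar>)"
  proof (rule prod.cong)
    fix l
    have "\<bar>k $ l\<bar> < int (n $ l)" using k by (simp add: diff_box_def)
    then have "card (?S l) = nat (int (n $ l) - \<bar>k $ l\<bar>)" by auto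
    then show "real (card (?S l)) = real (n $ l) - \<bar>real_of_int (k $ l)\<bar>"
      using \<open>\<bar>k $ l\<bar> < int (n $ l)\<close> by (simp add: of_nat_nat)
  qed simp
  finally show ?thesis by (simp add: overlap_volume_eq[OF k])
qed

lemma sum_lattice_box_diff:
  fixes h :: "int ^ 'd::finite \<Rightarrow> 'a::real_vector"
  shows "(\<Sum>t\<in>lattice_box n. \<Sum>s\<in>lattice_box n. h (t - s)) = (\<Sum>k\<in>diff_box n. overlap_volume n k *\<^sub>R h k)"
proof -
  let ?P = "lattice_box n \<times> lattice_box n"
  have "(\<Sum>t\<in>lattice_box n. \<Sum>s\<in>lattice_box n. h (t - s)) = (\<Sum>p\<in>?P. h (fst p - snd p))"
    by (simp add: sum.cartesian_product case_prod_unfold)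
  also have "\<dots> = (\<Sum>k\<in>diff_box n. \<Sum>p\<in>{p \<in> ?P. fst p - snd p = k}. h (fst p - snd p))"
    by (rule sum.group[symmetric]) (auto simp: finite_lattice_box finite_diff_box lattice_box_diff)
  also have "\<dots> = (\<Sum>k\<in>diff_box n. \<Sum>p\<in>{p \<in> ?P. fst p - snd p = k}. h k)"
    by (intro sum.cong) auto
  also have "\<dots> = (\<Sum>k\<in>diff_box n. overlap_volume n k *\<^sub>R h k)"
    by (intro sum.cong refl) (simp only: sum_constant_scaleR card_pairs_with_difference)
  finally show ?thesis .
qed

text \<open>Comparison with the integral of x^(p - 1), by induction: the increment of x^p / p over
  [m, m + 1] is at least (m + 1)^(p - 1).\<close>

lemma sum_powr_minus_one_le:
  assumes p: "0 < p" "p \<le> 1"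
  shows "(\<Sum>a<m. real (Suc a) powr (p - 1)) \<le> real m powr p / p"
proof (induction m)
  case (Suc m)
  show ?case
  \<comment> \<open>x^p need not be differentiable at 0, so the mean value theorem is used from m =
    1 onwards.\<close>
  proof (cases "m = 0")
    case True
    then show ?thesis using p by simp
  next
    case False
    have "\<exists>z>real m. z < real m + 1 \<and> (real m + 1) powr p - real m powr p = (real m + 1 - real m) * (p * z powr (p - 1))"
      using False by (intro MVT2) (auto intro!: derivative_eq_intros)
    then obtain z where z: "real m < z" "z < real m + 1" "(real m + 1) powr p - real m powr p = p * z powr (p - 1)"
      by auto
    have "(real m + 1) powr (p - 1) \<le> z powr (p - 1)"
      using z False p by (intro powr_mono2') auto
    then have "p * (real m + 1) powr (p - 1) \<le> (real m + 1) powr p - real m powr p"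
      using z(3) p by simp
    then show ?thesis using Suc p by (simp add: field_simps)
  qed
qed simp

text \<open>
  If the support of the kernel, scaled by the bandwidth \<open>D\<close>, reaches the faces of the box, then the
  weights \<open>1 / (m - |j|)\<close> are not comparable with \<open>1 / m\<close>; the decay of order \<open>p\<close> of the numerator
  at the faces then compensates the logarithmic divergence of the sum.
\<close>

lemma axis_weight_sum_bound:
  assumes p: "0 < p" "p \<le> 1" and \<delta>: "0 < \<delta>" and R: "0 \<le> R" and Q: "0 \<le> Q"
  obtains c where "0 \<le> c"
    "\<And>m D. \<delta> \<le> D \<Longrightarrow>
       (\<Sum>j\<in>{j :: int. \<bar>j\<bar> < int m}.
          (if \<bar>real_of_int j\<bar> \<le> R * D then min 1 (Q * (real m - \<bar>real_of_int j\<bar>) / D) powr p else 0)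
            / (real m - \<bar>real_of_int j\<bar>)) \<le> c * (D / real m)"
proof -
  \<comment> \<open>\<open>c1\<close> belongs to the regime 2 R D <= m, where the support stays away
    from the faces and there are at most R D + 1 <= (R + 1 / \<delta>) D indices; \<open>c2\<close>
    belongs to the opposite regime, where m / D < 2 R.\<close>
  define c1 where "c1 = 2 * (R + 1 / \<delta>)"
  define c2 where "c2 = (2 * R * Q) powr p / p * (2 * R)"
  have c12: "0 \<le> c1" "0 \<le> c2" using R \<delta> p by (auto simp: c1_def c2_def)
  have main: "(\<Sum>j\<in>{j :: int. \<bar>j\<bar> < int m}.
          (if \<bar>real_of_int j\<bar> \<le> R * D then min 1 (Q * (real m - \<bar>real_of_int j\<bar>) / D) powr p else 0)
            / (real m - \<bar>real_of_int j\<bar>)) \<le> 2 * (c1 + c2) * (D / real m)" if D: "\<delta> \<le> D" for m D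
  proof (cases "m = 0")
    case False
    then have m: "0 < real m" by simp
    have D0: "0 < D" using D \<delta> by simp
    define w where "w i = (if real i \<le> R * D then min 1 (Q * (real m - real i) / D) powr p else 0) / (real m - real i)" for i
    have w0: "0 \<le> w i" if "i < m" for i using that by (simp add: w_def)
    \<comment> \<open>The two halves overlap at j = 0; counting it twice is harmless as the weights
      are nonnegative.\<close>
    have "{j :: int. \<bar>j\<bar> < int m} = int ` {..<m} \<union> (\<lambda>i. - int i) ` {..<m}"
    proof (intro equalityI subsetI)
      fix j assume "j \<in> {j :: int. \<bar>j\<bar> < int m}"
      then show "j \<in> int ` {..<m} \<union> (\<lambda>i. - int i) ` {..<m}"
        by (cases "0 \<le> j") (auto simp: image_iff intro: bexI[of _ "nat j"] bexI[of _ "nat (- j)"])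
    qed auto
    then have "(\<Sum>j\<in>{j :: int. \<bar>j\<bar> < int m}. w (nat \<bar>j\<bar>))
        \<le> (\<Sum>j\<in>int ` {..<m}. w (nat \<bar>j\<bar>)) + (\<Sum>j\<in>(\<lambda>i. - int i) ` {..<m}. w (nat \<bar>j\<bar>))"
      using sum.union_inter[of "int ` {..<m}" "(\<lambda>i. - int i) ` {..<m}" "\<lambda>j. w (nat \<bar>j\<bar>)"]
        sum_nonneg[of "int ` {..<m} \<inter> (\<lambda>i. - int i) ` {..<m}" "\<lambda>j. w (nat \<bar>j\<bar>)"] w0
      by force
    also have "\<dots> = 2 * (\<Sum>i<m. w i)"
      by (simp add: sum.reindex inj_on_def)
    finally have double: "(\<Sum>j\<in>{j :: int. \<bar>j\<bar> < int m}. w (nat \<bar>j\<bar>)) \<le> 2 * (\<Sum>i<m. w i)" .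
    have "(\<Sum>i<m. w i) \<le> (c1 + c2) * (D / real m)"
    proof (cases "2 * R * D \<le> real m")
      case True
      have "w i \<le> (if real i \<le> R * D then 2 / real m else 0)" if "i < m" for i
      proof (cases "real i \<le> R * D")
        case le: True
        have "min 1 (Q * (real m - real i) / D) powr p \<le> 1 powr p"
          using Q D0 that p by (intro powr_mono2) auto
        then have "w i \<le> 1 / (real m - real i)"
          using that le unfolding w_def by (auto intro!: divide_right_mono)
        also have "\<dots> \<le> 1 / (real m / 2)"
          using True le m by (intro divide_left_mono) auto
        finally show ?thesis using le by simp
      qed (simp add: w_def)
      then have "(\<Sum>i<m. w i) \<le> (\<Sum>i<m. if real i \<le> R * D then 2 / real m else 0)"
        by (intro sum_mono) auto
      also have "\<dots> = real (card {i\<in>{..<m}. real i \<le> R * D}) * (2 / real m)"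
        by (simp add: sum.If_cases Int_def)
      also have "\<dots> \<le> (R * D + 1) * (2 / real m)"
      proof (intro mult_right_mono)
        have "{i\<in>{..<m}. real i \<le> R * D} \<subseteq> {..nat \<lfloor>R * D\<rfloor>}"
          by (auto simp: le_nat_floor)
        then have "card {i\<in>{..<m}. real i \<le> R * D} \<le> nat \<lfloor>R * D\<rfloor> + 1"
          by (metis card_atMost card_mono finite_atMost Suc_eq_plus1)
        moreover have "real (nat \<lfloor>R * D\<rfloor>) \<le> R * D" using R D0 by simp
        ultimately show "real (card {i\<in>{..<m}. real i \<le> R * D}) \<le> R * D + 1" by linarith
      qed (use m in auto)
      also have "\<dots> \<le> (R * D + D / \<delta>) * (2 / real m)"
        using D \<delta> m by (intro mult_right_mono) auto
      also have "\<dots> = c1 * (D / real m)" by (simp add: c1_def algebra_simps)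
      also have "\<dots> \<le> (c1 + c2) * (D / real m)"
        using c12 D0 by (intro mult_right_mono) auto
      finally show ?thesis .
    next
      case False
      \<comment> \<open>The minimum is replaced by its second entry, so the weight is of order (m -
        i)^(p - 1), whose sum is of order m^p instead of carrying a logarithm.\<close>
      have "w i \<le> (Q / D) powr p * (real m - real i) powr (p - 1)" if "i < m" for i
      proof -
        have "w i \<le> (Q * (real m - real i) / D) powr p / (real m - real i)"
          using that Q D0 p unfolding w_def
          by (auto intro!: divide_right_mono powr_mono2)
        also have "\<dots> = (Q / D) powr p * ((real m - real i) powr p / (real m - real i))"
          using that Q D0 by (simp add: powr_mult powr_divide)
        also have "(real m - real i) powr p / (real m - real i) = (real m - real i) powr (p - 1)"
          using that by (simp add: powr_diff)
        finally show ?thesis .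
      qed
      then have "(\<Sum>i<m. w i) \<le> (\<Sum>i<m. (Q / D) powr p * (real m - real i) powr (p - 1))"
        by (intro sum_mono) auto
      also have "\<dots> = (Q / D) powr p * (\<Sum>i<m. real (Suc i) powr (p - 1))"
        unfolding sum_distrib_left[symmetric]
        by (rule arg_cong[of _ _ "\<lambda>s. (Q / D) powr p * s"], rule sum.reindex_bij_witness[of _ "\<lambda>i. m - Suc i" "\<lambda>i. m - Suc i"])
          (auto simp: of_nat_diff)
      also have "\<dots> \<le> (Q / D) powr p * (real m powr p / p)"
        by (intro mult_left_mono sum_powr_minus_one_le p) auto
      also have "\<dots> = (Q * (real m / D)) powr p / p"
        using Q D0 by (simp add: powr_mult powr_divide)
      also have "\<dots> \<le> (Q * (2 * R)) powr p / p"
        using Q D0 False p by (intro divide_right_mono powr_mono2 mult_left_mono) (auto simp: field_simps)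
      also have "\<dots> = (2 * R * Q) powr p / p * 1" by (simp add: mult_ac)
      \<comment> \<open>In this regime 1 < 2 R D / m, which restores the required factor D /
        m.\<close>
      also have "\<dots> \<le> (2 * R * Q) powr p / p * (2 * R * D / real m)"
        using False p m by (intro mult_left_mono) (auto simp: field_simps)
      also have "\<dots> = c2 * (D / real m)" by (simp add: c2_def)
      also have "\<dots> \<le> (c1 + c2) * (D / real m)"
        using c12 D0 by (intro mult_right_mono) auto
      finally show ?thesis .
    qed
    with double have "(\<Sum>j\<in>{j :: int. \<bar>j\<bar> < int m}. w (nat \<bar>j\<bar>)) \<le> 2 * (c1 + c2) * (D / real m)"
      unfolding mult.assoc by linarith
    moreover have real_nat: "real (nat \<bar>j\<bar>) = \<bar>real_of_int j\<bar>" for j :: int by simp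
    ultimately show ?thesis unfolding w_def real_nat by blast
  qed simp
  show ?thesis using c12 main by (intro that[of "2 * (c1 + c2)"]) auto
qed

text \<open>A value u in [0, 1] is the product of d copies of u^(1/d). Bounding each copy by the
  distance to the faces in one coordinate makes the sum over lags factorise into one-dimensional
  sums, for which a small positive exponent is enough.\<close>

lemma kernel_square_sum_bound:
  fixes K :: "real ^ 'd::finite \<Rightarrow> real"
  assumes K: "\<And>x. 0 \<le> K x" "\<And>x. K x \<le> 1" and supp: "\<And>x. R < norm x \<Longrightarrow> K x = 0" and R: "0 \<le> R"
    and Lip: "\<And>x i t. \<bar>K (x + t *\<^sub>R axis i 1) - K x\<bar> \<le> Q * \<bar>t\<bar>" and Q: "0 \<le> Q" and \<delta>: "0 < \<delta>"
  obtains c where "0 \<le> c"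
    "\<And>n D. \<delta> \<le> D \<Longrightarrow> (\<And>k. 0 < K (real_vec k /\<^sub>R D) \<Longrightarrow> k \<in> diff_box n) \<Longrightarrow>
       (\<Sum>k\<in>diff_box n. (K (real_vec k /\<^sub>R D))\<^sup>2 / overlap_volume n k)
         \<le> c * (D ^ CARD('d) / real (card (lattice_box n)))"
proof -
  define p where "p = 1 / real CARD('d)"
  have card: "1 \<le> real CARD('d)" by (simp add: Suc_leI)
  have p: "0 < p" "p \<le> 1" using card by (auto simp: p_def)
  obtain c where c: "0 \<le> c"
    "\<And>m D. \<delta> \<le> D \<Longrightarrow>
       (\<Sum>j\<in>{j :: int. \<bar>j\<bar> < int m}.
          (if \<bar>real_of_int j\<bar> \<le> R * D then min 1 (Q * (real m - \<bar>real_of_int j\<bar>) / D) powr p else 0)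
            / (real m - \<bar>real_of_int j\<bar>)) \<le> c * (D / real m)"
    using axis_weight_sum_bound[OF p \<delta> R Q] by blast
  show ?thesis
  proof (rule that[of "c ^ CARD('d)"])
    fix n :: "nat ^ 'd" and D assume D: "\<delta> \<le> D" and box: "\<And>k. 0 < K (real_vec k /\<^sub>R D) \<Longrightarrow> k \<in> diff_box n"
    have D0: "0 < D" using D \<delta> by simp
    define v where "v l j = real (n $ l) - \<bar>real_of_int j\<bar>" for l and j :: int
    define h where "h l j = (if \<bar>real_of_int j\<bar> \<le> R * D then min 1 (Q * v l j / D) powr p else 0)" for l j
    have v_pos: "0 < v l (k $ l)" if "k \<in> diff_box n" for k l
      using that by (simp add: diff_box_def v_def abs_of_int_less_of_nat)
    have le: "(K (real_vec k /\<^sub>R D))\<^sup>2 \<le> (\<Prod>l\<in>UNIV. h l (k $ l))" if k: "k \<in> diff_box n" for k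
    proof (cases "K (real_vec k /\<^sub>R D) = 0")
      case True
      then show ?thesis by (auto simp: h_def intro!: prod_nonneg)
    next
      case False
      define u where "u = K (real_vec k /\<^sub>R D)"
      have u: "0 < u" "u \<le> 1" using False K by (auto simp: u_def less_le)
      have in_supp: "\<bar>real_of_int (k $ l)\<bar> \<le> R * D" for l
      proof -
        have "\<bar>(real_vec k /\<^sub>R D) $ l\<bar> \<le> R"
          using component_le_norm_cart[of "real_vec k /\<^sub>R D" l] supp[of "real_vec k /\<^sub>R D"] False by force
        then show ?thesis using D0 by (simp add: real_vec_def abs_mult field_simps)
      qed
      have "u \<le> Q * v l (k $ l) / D" for l
      proof -
        \<comment> \<open>Moving k outwards along the axis l until |k_l| = n_l leaves the box of
          differences, where K vanishes; the Lipschitz bound over this move, of scaled length |t|,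
          bounds u.\<close>
        define \<sigma> where "\<sigma> = (if 0 \<le> k $ l then 1 else - 1 :: int)"
        define k' where "k' = (\<chi> j. if j = l then \<sigma> * int (n $ l) else k $ j)"
        define t where "t = real_of_int \<sigma> * (v l (k $ l) / D)"
        have "\<bar>k' $ l\<bar> = int (n $ l)" by (simp add: k'_def \<sigma>_def)
        then have "k' \<notin> diff_box n" unfolding diff_box_def by (metis (lifting) less_irrefl mem_Collect_eq)
        then have "K (real_vec k' /\<^sub>R D) = 0" using box[of k'] K(1)[of "real_vec k' /\<^sub>R D"] by force
        moreover have "real_vec k' /\<^sub>R D = real_vec k /\<^sub>R D + t *\<^sub>R axis l 1"
          using D0 by (auto simp: vec_eq_iff real_vec_def k'_def t_def \<sigma>_def v_def axis_def field_simps)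
        moreover have "\<bar>t\<bar> = v l (k $ l) / D"
          using v_pos[OF k, of l] D0 by (simp add: t_def \<sigma>_def abs_mult)
        ultimately show ?thesis
          using Lip[of "real_vec k /\<^sub>R D" t l] u by (simp add: u_def)
      qed
      then have min: "u \<le> min 1 (Q * v l (k $ l) / D)" for l using u by simp
      have "u\<^sup>2 \<le> u" using u by (simp add: power2_eq_square mult_left_le)
      also have "u = (\<Prod>l\<in>(UNIV :: 'd set). u powr p)"
        using u card by (simp add: powr_realpow[symmetric] powr_powr p_def)
      also have "\<dots> \<le> (\<Prod>l\<in>UNIV. h l (k $ l))"
        using u p min in_supp unfolding h_def by (intro prod_mono) (auto intro!: powr_mono2)
      finally show ?thesis by (simp add: u_def)
    qed
    have "(\<Sum>k\<in>diff_box n. (K (real_vec k /\<^sub>R D))\<^sup>2 / overlap_volume n k)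
        \<le> (\<Sum>k\<in>diff_box n. \<Prod>l\<in>UNIV. h l (k $ l) / v l (k $ l))"
    proof (rule sum_mono)
      fix k assume k: "k \<in> diff_box n"
      have "(K (real_vec k /\<^sub>R D))\<^sup>2 / overlap_volume n k \<le> (\<Prod>l\<in>UNIV. h l (k $ l)) / overlap_volume n k"
        using overlap_volume_pos[OF k] by (intro divide_right_mono le k) auto
      then show "(K (real_vec k /\<^sub>R D))\<^sup>2 / overlap_volume n k \<le> (\<Prod>l\<in>UNIV. h l (k $ l) / v l (k $ l))"
        by (simp add: overlap_volume_eq[OF k] v_def prod_dividef)
    qed
    also have "\<dots> = (\<Prod>l\<in>UNIV. \<Sum>j\<in>{j. \<bar>j\<bar> < int (n $ l)}. h l j / v l j)"
      unfolding diff_box_def by (rule sum_vec_prod) (rule finite_abs_less_int)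
    also have "\<dots> \<le> (\<Prod>l\<in>UNIV. c * (D / real (n $ l)))"
    proof (rule prod_mono, intro conjI)
      fix l
      show "0 \<le> (\<Sum>j\<in>{j. \<bar>j\<bar> < int (n $ l)}. h l j / v l j)"
        by (intro sum_nonneg divide_nonneg_nonneg)
           (auto simp: h_def v_def less_imp_le[OF abs_of_int_less_of_nat])
      show "(\<Sum>j\<in>{j. \<bar>j\<bar> < int (n $ l)}. h l j / v l j) \<le> c * (D / real (n $ l))"
        unfolding h_def v_def by (rule c(2)[OF D])
    qed
    also have "\<dots> = c ^ CARD('d) * (D ^ CARD('d) / real (card (lattice_box n)))"
      by (simp add: prod.distrib prod_dividef card_lattice_box power_mult_distrib)
    finally show "(\<Sum>k\<in>diff_box n. (K (real_vec k /\<^sub>R D))\<^sup>2 / overlap_volume n k)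
         \<le> c ^ CARD('d) * (D ^ CARD('d) / real (card (lattice_box n)))" .
  qed (use c in auto)
qed

section \<open>Second-order stationary processes\<close>

lemma borel_measurable_cinner [measurable (raw)]:
  fixes f g :: "'w \<Rightarrow> 'h::separable_complex_hilbert_space"
  assumes "f \<in> borel_measurable M" "g \<in> borel_measurable M"
  shows "(\<lambda>\<omega>. cinner (f \<omega>) (g \<omega>)) \<in> borel_measurable M"
  using assms by (rule borel_measurable_continuous_Pair)
    (intro bounded_bilinear.continuous_on[OF bounded_bilinear_cinner] continuous_intros)

lemma borel_measurable_scaleC [measurable (raw)]:
  fixes f :: "'w \<Rightarrow> complex" and g :: "'w \<Rightarrow> 'h::separable_complex_hilbert_space"
  assumes "f \<in> borel_measurable M" "g \<in> borel_measurable M"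
  shows "(\<lambda>\<omega>. f \<omega> *\<^sub>C g \<omega>) \<in> borel_measurable M"
  using assms by (rule borel_measurable_continuous_Pair)
    (intro bounded_bilinear.continuous_on[OF bounded_bilinear_scaleC] continuous_intros)

text \<open>The bound does not depend on F, as a dominating function for truncated expansions must
  not.\<close>

lemma sum_Bessel_mult_le:
  assumes "complete_orthonormal E" "finite F" "F \<subseteq> E"
  shows "(\<Sum>e\<in>F. cmod (cinner x e) * cmod (cinner e y)) \<le> norm x * norm y"
proof -
  have sym: "cmod (cinner e y) = cmod (cinner y e)" for e
    by (metis cinner_commute complex_mod_cnj)
  have "(\<Sum>e\<in>F. cmod (cinner x e) * cmod (cinner e y))
      \<le> L2_set (\<lambda>e. cmod (cinner x e)) F * L2_set (\<lambda>e. cmod (cinner y e)) F"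
    using L2_set_mult_ineq[of "\<lambda>e. cmod (cinner x e)" "\<lambda>e. cmod (cinner y e)" F] by (simp add: sym)
  also have "\<dots> \<le> norm x * norm y"
    using Bessel_inequality[OF assms] unfolding L2_set_def
    by (intro mult_mono real_le_lsqrt) (auto intro: sum_nonneg)
  finally show ?thesis .
qed

lemma cinner_tensor_op:
  "cinner (tensor_op x y e) (tensor_op x' y' e) = cinner x x' * (cinner y' e * cinner e y)"
  by (simp add: tensor_op_def cinner_scaleC_left cinner_scaleC_right mult_ac flip: cinner_commute[of y' e])

lemma hs_inner_tensor_op:
  assumes "complete_orthonormal E"
  shows "((\<lambda>e. cinner (tensor_op x y e) (tensor_op x' y' e)) has_sum cinner x x' * cinner y' y) E"
    "hs_inner E (tensor_op x y) (tensor_op x' y') = cinner x x' * cinner y' y"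
proof -
  show has_sum: "((\<lambda>e. cinner (tensor_op x y e) (tensor_op x' y' e)) has_sum cinner x x' * cinner y' y) E"
    unfolding cinner_tensor_op by (intro has_sum_cmult_right has_sum_Parseval assms)
  then show "hs_inner E (tensor_op x y) (tensor_op x' y') = cinner x x' * cinner y' y"
    unfolding hs_inner_def by (rule infsumI)
qed

lemma sum_cinner_tensor_op_le:
  assumes "complete_orthonormal E" "finite F" "F \<subseteq> E"
  shows "cmod (\<Sum>e\<in>F. cinner (tensor_op x y e) (tensor_op x' y' e)) \<le> norm x * norm y * norm x' * norm y'"
proof -
  have "cmod (\<Sum>e\<in>F. cinner (tensor_op x y e) (tensor_op x' y' e))
      \<le> cmod (cinner x x') * (\<Sum>e\<in>F. cmod (cinner y' e) * cmod (cinner e y))"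
    unfolding cinner_tensor_op sum_distrib_left by (rule order_trans[OF norm_sum]) (simp add: norm_mult)
  also have "\<dots> \<le> (norm x * norm x') * (norm y' * norm y)"
    by (intro mult_mono cinner_Cauchy_Schwarz sum_Bessel_mult_le[OF assms]) (auto intro: sum_nonneg)
  finally show ?thesis by (simp add: mult_ac)
qed

lemma norm_tensor_op_le: "norm (tensor_op x y z) \<le> norm z * (norm x * norm y)"
  using mult_right_mono[OF cinner_Cauchy_Schwarz[of z y], of "norm x"]
  by (simp add: tensor_op_def norm_scaleC mult_ac)

section \<open>Covariance operators of a stationary process\<close>

locale stationary_process =
  fixes E :: "'h::separable_complex_hilbert_space set" and M :: "'w measure"
    and X :: "int ^ 'd::finite \<Rightarrow> 'w \<Rightarrow> 'h"
  assumes cons: "complete_orthonormal E" and stat: "second_order_stationary E M X"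
begin

sublocale prob_space M
  using stat by (simp add: second_order_stationary_def)

lemma measurable_X [measurable]: "X t \<in> borel_measurable M"
  using stat by (simp add: second_order_stationary_def)

text \<open>Reality of the process enters here; it removes the conjugations in the fourth-order
  cumulant.\<close>

lemma conj_X: "\<omega> \<in> space M \<Longrightarrow> conj_element E (X t \<omega>) = X t \<omega>"
  using stat conj_element_real[OF cons] by (simp add: second_order_stationary_def)

lemma integrable_norm_mult: "integrable M (\<lambda>\<omega>. norm (X t \<omega>) * norm (X s \<omega>))"
proof (rule Bochner_Integration.integrable_bound)
  show "integrable M (\<lambda>\<omega>. (norm (X t \<omega>))\<^sup>2 + (norm (X s \<omega>))\<^sup>2)"
    using stat by (intro Bochner_Integration.integrable_add) (simp_all add: second_order_stationary_def)
  have "norm (X t \<omega>) * norm (X s \<omega>) \<le> (norm (X t \<omega>))\<^sup>2 + (norm (X s \<omega>))\<^sup>2" for \<omega>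
    using sum_squares_bound[of "norm (X t \<omega>)" "norm (X s \<omega>)"]
      mult_nonneg_nonneg[OF norm_ge_zero norm_ge_zero, of "X t \<omega>" "X s \<omega>"]
    unfolding mult.assoc by linarith
  then show "AE \<omega> in M. norm (norm (X t \<omega>) * norm (X s \<omega>)) \<le> norm ((norm (X t \<omega>))\<^sup>2 + (norm (X s \<omega>))\<^sup>2)"
    by simp
qed simp

lemma integrable_tensor: "integrable M (\<lambda>\<omega>. tensor_op (X t \<omega>) (X s \<omega>) z)"
  by (rule Bochner_Integration.integrable_bound[OF integrable_mult_right[OF integrable_norm_mult, of "norm z" t s]])
     (auto simp: tensor_op_def[abs_def] norm_tensor_op_le[unfolded tensor_op_def])

lemma expect_tensor: "expect_op M (\<lambda>\<omega>. tensor_op (X t \<omega>) (X s \<omega>)) = cov_op M X (t - s)"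
proof -
  have "expect_op M (\<lambda>\<omega>. tensor_op (X (s + (t - s)) \<omega>) (X s \<omega>))
      = expect_op M (\<lambda>\<omega>. tensor_op (X (0 + (t - s)) \<omega>) (X 0 \<omega>))"
    using stat unfolding second_order_stationary_def by blast
  then show ?thesis by (simp add: cov_op_def)
qed

lemma integral_tensor: "(\<integral>\<omega>. tensor_op (X t \<omega>) (X s \<omega>) z \<partial>M) = cov_op M X (t - s) z"
  by (simp add: expect_op_def flip: expect_tensor)

lemma cinner_cov: "cinner (cov_op M X (t - s) x) y = (\<integral>\<omega>. cinner x (X s \<omega>) * cinner (X t \<omega>) y \<partial>M)"
  using integral_bounded_linear[OF bounded_linear_cinner_left integrable_tensor, of t s x y]
  by (simp add: integral_tensor) (simp add: tensor_op_def cinner_scaleC_left)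

lemma bounded_clinear_cov: "bounded_clinear (cov_op M X k)"
  unfolding bounded_clinear_def
proof (intro conjI allI)
  have cov: "cov_op M X k z = (\<integral>\<omega>. tensor_op (X k \<omega>) (X 0 \<omega>) z \<partial>M)" for z
    using integral_tensor[of k 0 z] by simp
  show scale: "cov_op M X k (c *\<^sub>C x) = c *\<^sub>C cov_op M X k x" for c x
    using integral_bounded_linear[OF bounded_linear_scaleC_right integrable_tensor, of c k 0 x]
    by (simp add: cov) (simp add: tensor_op_def cinner_scaleC_left scaleC_scaleC)
  show "bounded_linear (cov_op M X k)"
  proof (rule bounded_linear_intro)
    show "cov_op M X k (x + y) = cov_op M X k x + cov_op M X k y" for x y
      using Bochner_Integration.integral_add[OF integrable_tensor integrable_tensor, of k 0 x k 0 y]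
      by (simp add: cov) (simp add: tensor_op_def cinner_add_left scaleC_add_left)
    show "cov_op M X k (r *\<^sub>R x) = r *\<^sub>R cov_op M X k x" for r x
      by (simp add: scaleR_scaleC scale)
    show "norm (cov_op M X k x) \<le> norm x * (\<integral>\<omega>. norm (X k \<omega>) * norm (X 0 \<omega>) \<partial>M)" for x
    proof -
      have "norm (cov_op M X k x) \<le> (\<integral>\<omega>. norm x * (norm (X k \<omega>) * norm (X 0 \<omega>)) \<partial>M)"
        unfolding cov
        by (rule order_trans[OF Bochner_Integration.integral_norm_bound integral_mono[OF integrable_norm]])
           (auto intro: integrable_tensor integrable_norm_mult norm_tensor_op_le)
      then show ?thesis by simp
    qed
  qed
qed

text \<open>By stationarity C(-k) is an explicit adjoint of C(k), which is what the lemmas on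
  \<open>abs_op\<close> ask for.\<close>

lemma cov_adjoint: "cinner (cov_op M X k x) y = cinner x (cov_op M X (- k) y)"
proof -
  have "cinner x (cov_op M X (- k) y) = cnj (cinner (cov_op M X (0 - k) y) x)"
    by (simp flip: cinner_commute)
  also have "\<dots> = (\<integral>\<omega>. cnj (cinner y (X k \<omega>) * cinner (X 0 \<omega>) x) \<partial>M)"
    unfolding cinner_cov by (rule Bochner_Integration.integral_cnj[symmetric])
  also have "\<dots> = (\<integral>\<omega>. cinner x (X 0 \<omega>) * cinner (X k \<omega>) y \<partial>M)"
    by (simp flip: cinner_commute add: mult.commute)
  also have "\<dots> = cinner (cov_op M X (k - 0) x) y" unfolding cinner_cov ..
  finally show ?thesis by simp
qed

text \<open>E <X(t), X(s)> is the trace of C(t - s): the diagonal sums are expectations of truncated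
  Parseval sums, and |X(t)| |X(s)| dominates these.\<close>

lemma sum_cov_diagonal_tendsto:
  assumes F: "\<And>m. finite (F m)" "\<And>m. F m \<subseteq> E" "filterlim F (finite_subsets_at_top E) sequentially"
  shows "(\<lambda>m. \<Sum>e\<in>F m. cinner (cov_op M X (t - s) e) e) \<longlonglongrightarrow> (\<integral>\<omega>. cinner (X t \<omega>) (X s \<omega>) \<partial>M)"
proof -
  have int: "integrable M (\<lambda>\<omega>. cinner e (X s \<omega>) * cinner (X t \<omega>) e)" for e
    using integrable_bounded_linear[OF bounded_linear_cinner_left integrable_tensor, of t s e e]
    by (simp add: tensor_op_def cinner_scaleC_left)
  have "(\<lambda>m. \<integral>\<omega>. (\<Sum>e\<in>F m. cinner (X t \<omega>) e * cinner e (X s \<omega>)) \<partial>M) \<longlonglongrightarrow> (\<integral>\<omega>. cinner (X t \<omega>) (X s \<omega>) \<partial>M)"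
  proof (rule integral_dominated_convergence[OF _ _ integrable_norm_mult[of t s]])
    show "AE \<omega> in M. (\<lambda>m. \<Sum>e\<in>F m. cinner (X t \<omega>) e * cinner e (X s \<omega>)) \<longlonglongrightarrow> cinner (X t \<omega>) (X s \<omega>)"
      using has_sum_Parseval[OF cons] filterlim_compose[OF _ F(3)] unfolding has_sum_def by blast
    show "AE \<omega> in M. norm (\<Sum>e\<in>F m. cinner (X t \<omega>) e * cinner e (X s \<omega>)) \<le> norm (X t \<omega>) * norm (X s \<omega>)" for m
    proof (rule AE_I2)
      fix \<omega>
      have "norm (\<Sum>e\<in>F m. cinner (X t \<omega>) e * cinner e (X s \<omega>))
          \<le> (\<Sum>e\<in>F m. cmod (cinner (X t \<omega>) e) * cmod (cinner e (X s \<omega>)))"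
        by (rule order_trans[OF norm_sum]) (simp add: norm_mult)
      then show "norm (\<Sum>e\<in>F m. cinner (X t \<omega>) e * cinner e (X s \<omega>)) \<le> norm (X t \<omega>) * norm (X s \<omega>)"
        using sum_Bessel_mult_le[OF cons F(1,2)] by (rule order_trans)
    qed
  qed auto
  moreover have "(\<integral>\<omega>. (\<Sum>e\<in>F m. cinner (X t \<omega>) e * cinner e (X s \<omega>)) \<partial>M)
      = (\<Sum>e\<in>F m. cinner (cov_op M X (t - s) e) e)" for m
    unfolding cinner_cov using int by (simp add: mult.commute)
  ultimately show ?thesis by simp
qed

lemma exhausting_sequence:
  obtains F :: "nat \<Rightarrow> 'h set"
  where "\<And>m. finite (F m)" "\<And>m. F m \<subseteq> E" "filterlim F (finite_subsets_at_top E) sequentially"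
  using filterlim_finite_subsets_at_top[OF countable_complete_orthonormal[OF cons]] by blast

text \<open>\<open>enn2real\<close> sends infinity to 0, so a bound by \<open>\<tau>\<close> is
  meaningful only where the trace norm is known to be finite.\<close>

definition \<tau> :: "int ^ 'd \<Rightarrow> real" where
  "\<tau> k = enn2real (trace_norm E (cov_op M X k))"

lemma \<tau>_nonneg: "0 \<le> \<tau> k" by (simp add: \<tau>_def)

lemma hs_le_cov: "trace_norm E (cov_op M X k) < \<infinity> \<Longrightarrow> hs_le E (cov_op M X k) (\<tau> k)"
  unfolding \<tau>_def by (rule hs_le_trace_norm[OF cons _ bounded_clinear_cov cov_adjoint])

lemma integral_cinner_le:
  assumes "trace_norm E (cov_op M X (t - s)) < \<infinity>"
  shows "cmod (\<integral>\<omega>. cinner (X t \<omega>) (X s \<omega>) \<partial>M) \<le> \<tau> (t - s)"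
proof -
  obtain F :: "nat \<Rightarrow> 'h set" where F: "\<And>m. finite (F m)" "\<And>m. F m \<subseteq> E"
    "filterlim F (finite_subsets_at_top E) sequentially"
    using exhausting_sequence by blast
  have "cmod (\<Sum>e\<in>F m. cinner (cov_op M X (t - s) e) e) \<le> \<tau> (t - s)" for m
    using sum_cinner_le_trace_norm[OF cons assms bounded_clinear_cov cov_adjoint F(1,2)]
    by (intro order_trans[OF norm_sum]) (simp add: \<tau>_def)
  then show ?thesis
    by (intro LIMSEQ_le_const2[OF tendsto_norm[OF sum_cov_diagonal_tendsto[OF F]]]) auto
qed

end

section \<open>The variance of quadratic forms in the process\<close>

text \<open>Schur's test: 2 a_p a_q <= a_p^2 + a_q^2 decouples the two indices, after which row sums
  and column sums act separately.\<close>

lemma weighted_Schur_bound: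
  fixes a :: "'a \<Rightarrow> real"
  assumes H: "\<And>p q. p \<in> P \<Longrightarrow> q \<in> P \<Longrightarrow> 0 \<le> H p q"
    and row: "\<And>p. p \<in> P \<Longrightarrow> (\<Sum>q\<in>P. H p q) \<le> S" and col: "\<And>q. q \<in> P \<Longrightarrow> (\<Sum>p\<in>P. H p q) \<le> S"
  shows "(\<Sum>p\<in>P. \<Sum>q\<in>P. a p * a q * H p q) \<le> S * (\<Sum>p\<in>P. (a p)\<^sup>2)"
proof -
  have "(\<Sum>p\<in>P. \<Sum>q\<in>P. a p * a q * H p q) \<le> (\<Sum>p\<in>P. \<Sum>q\<in>P. ((a p)\<^sup>2 * H p q + (a q)\<^sup>2 * H p q) / 2)"
  proof (intro sum_mono)
    fix p q assume "p \<in> P" "q \<in> P"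
    then have "a p * a q * H p q \<le> ((a p)\<^sup>2 + (a q)\<^sup>2) / 2 * H p q"
      using sum_squares_bound[of "a p" "a q"] H by (intro mult_right_mono) auto
    then show "a p * a q * H p q \<le> ((a p)\<^sup>2 * H p q + (a q)\<^sup>2 * H p q) / 2"
      by (simp add: algebra_simps)
  qed
  also have "\<dots> = ((\<Sum>p\<in>P. (a p)\<^sup>2 * (\<Sum>q\<in>P. H p q)) + (\<Sum>q\<in>P. (a q)\<^sup>2 * (\<Sum>p\<in>P. H p q))) / 2"
  proof -
    have "(\<Sum>p\<in>P. \<Sum>q\<in>P. (a q)\<^sup>2 * H p q) = (\<Sum>q\<in>P. (a q)\<^sup>2 * (\<Sum>p\<in>P. H p q))"
      unfolding sum_distrib_left by (rule sum.swap)
    then show ?thesis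
      by (simp add: sum.distrib sum_distrib_left flip: sum_divide_distrib)
  qed
  also have "\<dots> \<le> ((\<Sum>p\<in>P. (a p)\<^sup>2 * S) + (\<Sum>q\<in>P. (a q)\<^sup>2 * S)) / 2"
    using row col by (intro divide_right_mono add_mono sum_mono mult_left_mono) auto
  also have "\<dots> = S * (\<Sum>p\<in>P. (a p)\<^sup>2)" by (simp add: sum_distrib_left mult.commute)
  finally show ?thesis .
qed

text \<open>Written as a lower limit, the form in which measurability and Fatou's lemma apply
  directly.\<close>

lemma (in stationary_process) hs_norm_sqr_liminf:
  assumes "\<And>m. finite (F m)" "\<And>m. F m \<subseteq> E" "filterlim F (finite_subsets_at_top E) sequentially"
  shows "(hs_norm E A)\<^sup>2 = liminf (\<lambda>m. \<Sum>e\<in>F m. ennreal ((norm (A e))\<^sup>2))"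
proof -
  have "((\<lambda>e. ennreal ((norm (A e))\<^sup>2)) has_sum (hs_norm E A)\<^sup>2) E"
    unfolding hs_norm_sqr by (intro has_sum_infsum nonneg_summable_on_complete) simp
  then have "(\<lambda>m. \<Sum>e\<in>F m. ennreal ((norm (A e))\<^sup>2)) \<longlonglongrightarrow> (hs_norm E A)\<^sup>2"
    unfolding has_sum_def by (rule filterlim_compose[OF _ assms(3)])
  then show ?thesis by (simp add: lim_imp_Liminf)
qed

lemma (in stationary_process) measurable_hs_norm_sqr:
  assumes [measurable]: "\<And>e. (\<lambda>\<omega>. A \<omega> e) \<in> borel_measurable M"
  shows "(\<lambda>\<omega>. (hs_norm E (A \<omega>))\<^sup>2) \<in> borel_measurable M"
proof -
  obtain F :: "nat \<Rightarrow> 'h set" where F: "\<And>m. finite (F m)" "\<And>m. F m \<subseteq> E"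
    "filterlim F (finite_subsets_at_top E) sequentially"
    using exhausting_sequence by blast
  show ?thesis unfolding hs_norm_sqr_liminf[OF F] by measurable
qed

section \<open>Fourth moments and the covariance of tensor products\<close>

locale fourth_order_process = stationary_process E M X
  for E :: "'h::separable_complex_hilbert_space set" and M :: "'w measure"
    and X :: "int ^ 'd::finite \<Rightarrow> 'w \<Rightarrow> 'h" +
  assumes fourth: "\<And>t. integrable M (\<lambda>\<omega>. norm (X t \<omega>) ^ 4)"
    and trace_class: "\<And>k. trace_norm E (cov_op M X k) < \<infinity>"
begin

definition Z :: "(int ^ 'd) \<times> (int ^ 'd) \<Rightarrow> 'w \<Rightarrow> 'h \<Rightarrow> 'h" where
  "Z p \<omega> = tensor_op (X (fst p) \<omega>) (X (snd p) \<omega>)"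

definition C :: "(int ^ 'd) \<times> (int ^ 'd) \<Rightarrow> 'h \<Rightarrow> 'h" where
  "C p = cov_op M X (fst p - snd p)"

text \<open>This is the Hilbert-Schmidt covariance E <Z p - C p, Z q - C q> in expanded
  form.\<close>

definition \<Gamma> :: "(int ^ 'd) \<times> (int ^ 'd) \<Rightarrow> (int ^ 'd) \<times> (int ^ 'd) \<Rightarrow> complex" where
  "\<Gamma> p q = (\<integral>\<omega>. hs_inner E (Z p \<omega>) (Z q \<omega>) \<partial>M) - hs_inner E (C p) (C q)"

lemma hs_le_C: "hs_le E (C p) (\<tau> (fst p - snd p))"
  unfolding C_def by (rule hs_le_cov[OF trace_class])

lemma measurable_Z [measurable]: "(\<lambda>\<omega>. Z p \<omega> e) \<in> borel_measurable M"
  unfolding Z_def tensor_op_def by measurable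

lemma integrable_Z: "integrable M (\<lambda>\<omega>. Z p \<omega> e)"
  unfolding Z_def by (rule integrable_tensor)

lemma integral_Z: "(\<integral>\<omega>. Z p \<omega> e \<partial>M) = C p e"
  unfolding Z_def C_def by (rule integral_tensor)

lemma integrable_norm_mult4:
  "integrable M (\<lambda>\<omega>. norm (X a \<omega>) * norm (X b \<omega>) * norm (X c \<omega>) * norm (X d \<omega>))"
proof (rule Bochner_Integration.integrable_bound)
  show "integrable M (\<lambda>\<omega>. norm (X a \<omega>) ^ 4 + norm (X b \<omega>) ^ 4 + (norm (X c \<omega>) ^ 4 + norm (X d \<omega>) ^ 4))"
    by (intro Bochner_Integration.integrable_add fourth)
  have two: "x * y \<le> x\<^sup>2 + y\<^sup>2" if "0 \<le> x" "0 \<le> y" for x y :: real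
    using sum_squares_bound[of x y] mult_nonneg_nonneg[OF that] unfolding mult.assoc by linarith
  have "x * y * z * w \<le> x ^ 4 + y ^ 4 + (z ^ 4 + w ^ 4)" if "0 \<le> x" "0 \<le> y" "0 \<le> z" "0 \<le> w" for x y z w :: real
  proof -
    have "(x * y) * (z * w) \<le> (x * y)\<^sup>2 + (z * w)\<^sup>2" using that by (intro two) auto
    moreover have "(x * y)\<^sup>2 \<le> (x\<^sup>2)\<^sup>2 + (y\<^sup>2)\<^sup>2" "(z * w)\<^sup>2 \<le> (z\<^sup>2)\<^sup>2 + (w\<^sup>2)\<^sup>2"
      using two[of "x\<^sup>2" "y\<^sup>2"] two[of "z\<^sup>2" "w\<^sup>2"] by (simp_all add: power_mult_distrib)
    ultimately show ?thesis by (simp add: mult.assoc)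
  qed
  then show "AE \<omega> in M. norm (norm (X a \<omega>) * norm (X b \<omega>) * norm (X c \<omega>) * norm (X d \<omega>))
      \<le> norm (norm (X a \<omega>) ^ 4 + norm (X b \<omega>) ^ 4 + (norm (X c \<omega>) ^ 4 + norm (X d \<omega>) ^ 4))"
    by simp
qed simp

lemma sum_cinner_Z_le:
  assumes "finite F" "F \<subseteq> E"
  shows "cmod (\<Sum>e\<in>F. cinner (Z p \<omega> e) (Z q \<omega> e))
    \<le> norm (X (fst p) \<omega>) * norm (X (snd p) \<omega>) * norm (X (fst q) \<omega>) * norm (X (snd q) \<omega>)"
  unfolding Z_def by (rule sum_cinner_tensor_op_le[OF cons assms])

lemma integrable_cinner_Z:
  assumes "e \<in> E"
  shows "integrable M (\<lambda>\<omega>. cinner (Z p \<omega> e) (Z q \<omega> e))"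
  by (rule Bochner_Integration.integrable_bound[OF integrable_norm_mult4[of "fst p" "snd p" "fst q" "snd q"]])
     (use sum_cinner_Z_le[of "{e}"] assms in auto)

lemma sum_integral_cinner_Z_tendsto:
  assumes F: "\<And>m. finite (F m)" "\<And>m. F m \<subseteq> E" "filterlim F (finite_subsets_at_top E) sequentially"
  shows "(\<lambda>m. \<Sum>e\<in>F m. \<integral>\<omega>. cinner (Z p \<omega> e) (Z q \<omega> e) \<partial>M) \<longlonglongrightarrow> (\<integral>\<omega>. hs_inner E (Z p \<omega>) (Z q \<omega>) \<partial>M)"
proof -
  have "(\<lambda>m. \<integral>\<omega>. (\<Sum>e\<in>F m. cinner (Z p \<omega> e) (Z q \<omega> e)) \<partial>M) \<longlonglongrightarrow> (\<integral>\<omega>. hs_inner E (Z p \<omega>) (Z q \<omega>) \<partial>M)"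
  proof (rule integral_dominated_convergence[OF _ _ integrable_norm_mult4[of "fst p" "snd p" "fst q" "snd q"]])
    show "AE \<omega> in M. (\<lambda>m. \<Sum>e\<in>F m. cinner (Z p \<omega> e) (Z q \<omega> e)) \<longlonglongrightarrow> hs_inner E (Z p \<omega>) (Z q \<omega>)"
    proof (rule AE_I2)
      fix \<omega>
      have "((\<lambda>e. cinner (Z p \<omega> e) (Z q \<omega> e)) has_sum hs_inner E (Z p \<omega>) (Z q \<omega>)) E"
        unfolding Z_def hs_inner_tensor_op(2)[OF cons] by (rule hs_inner_tensor_op(1)[OF cons])
      then show "(\<lambda>m. \<Sum>e\<in>F m. cinner (Z p \<omega> e) (Z q \<omega> e)) \<longlonglongrightarrow> hs_inner E (Z p \<omega>) (Z q \<omega>)"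
        unfolding has_sum_def by (rule filterlim_compose[OF _ F(3)])
    qed
    show "(\<lambda>\<omega>. hs_inner E (Z p \<omega>) (Z q \<omega>)) \<in> borel_measurable M"
      unfolding Z_def hs_inner_tensor_op(2)[OF cons] by measurable
  qed (use sum_cinner_Z_le[OF F(1,2)] in auto)
  moreover have "(\<integral>\<omega>. (\<Sum>e\<in>F m. cinner (Z p \<omega> e) (Z q \<omega> e)) \<partial>M)
      = (\<Sum>e\<in>F m. \<integral>\<omega>. cinner (Z p \<omega> e) (Z q \<omega> e) \<partial>M)" for m
    using F(2) by (intro Bochner_Integration.integral_sum integrable_cinner_Z) auto
  ultimately show ?thesis by simp
qed

lemma covariance_Z:
  assumes e: "e \<in> E"
  shows "integrable M (\<lambda>\<omega>. cinner (Z p \<omega> e - C p e) (Z q \<omega> e - C q e))"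
    "(\<integral>\<omega>. cinner (Z p \<omega> e - C p e) (Z q \<omega> e - C q e) \<partial>M)
      = (\<integral>\<omega>. cinner (Z p \<omega> e) (Z q \<omega> e) \<partial>M) - cinner (C p e) (C q e)"
proof -
  have expand: "cinner (Z p \<omega> e - C p e) (Z q \<omega> e - C q e)
      = cinner (Z p \<omega> e) (Z q \<omega> e) - cinner (Z p \<omega> e) (C q e) - cinner (C p e) (Z q \<omega> e) + cinner (C p e) (C q e)" for \<omega>
    by (simp add: cinner_diff_left cinner_diff_right)
  note int = integrable_cinner_Z[OF e, of p q]
    integrable_bounded_linear[OF bounded_linear_cinner_left integrable_Z, of p e "C q e"]
    integrable_bounded_linear[OF bounded_linear_cinner_right integrable_Z, of "C p e" q e]
  have "(\<integral>\<omega>. cinner (Z p \<omega> e) (C q e) \<partial>M) = cinner (C p e) (C q e)"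
    "(\<integral>\<omega>. cinner (C p e) (Z q \<omega> e) \<partial>M) = cinner (C p e) (C q e)"
    using integral_bounded_linear[OF bounded_linear_cinner_left integrable_Z, of p e "C q e"]
      integral_bounded_linear[OF bounded_linear_cinner_right integrable_Z, of "C p e" q e]
    by (simp_all add: integral_Z)
  with int show "integrable M (\<lambda>\<omega>. cinner (Z p \<omega> e - C p e) (Z q \<omega> e - C q e))"
    "(\<integral>\<omega>. cinner (Z p \<omega> e - C p e) (Z q \<omega> e - C q e) \<partial>M)
      = (\<integral>\<omega>. cinner (Z p \<omega> e) (Z q \<omega> e) \<partial>M) - cinner (C p e) (C q e)"
    unfolding expand by (simp_all add: prob_space)
qed

text \<open>Over finitely many basis vectors the expected squared norm is exactly a quadratic form
  in the weights, and these forms converge to the one with matrix \<open>\<Gamma>\<close>. As an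
  upper bound is wanted, Fatou's lemma suffices for the passage to the full norm.\<close>

lemma nn_integral_hs_norm_le:
  assumes P: "finite P" and bound: "(\<Sum>p\<in>P. \<Sum>q\<in>P. cmod (a p) * cmod (a q) * cmod (\<Gamma> p q)) \<le> S"
  shows "(\<integral>\<^sup>+\<omega>. (hs_norm E (\<lambda>z. \<Sum>p\<in>P. a p *\<^sub>C (Z p \<omega> z - C p z)))\<^sup>2 \<partial>M) \<le> ennreal S"
proof -
  obtain F :: "nat \<Rightarrow> 'h set" where F: "\<And>m. finite (F m)" "\<And>m. F m \<subseteq> E"
    "filterlim F (finite_subsets_at_top E) sequentially"
    using exhausting_sequence by blast
  define g where "g \<omega> e = (\<Sum>p\<in>P. a p *\<^sub>C (Z p \<omega> e - C p e))" for \<omega> e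
  have g_meas [measurable]: "(\<lambda>\<omega>. g \<omega> e) \<in> borel_measurable M" for e
    unfolding g_def by measurable
  define G where "G e = (\<Sum>p\<in>P. \<Sum>q\<in>P. a p * cnj (a q) *
      ((\<integral>\<omega>. cinner (Z p \<omega> e) (Z q \<omega> e) \<partial>M) - cinner (C p e) (C q e)))" for e
  have sq: "cinner (g \<omega> e) (g \<omega> e)
      = (\<Sum>p\<in>P. \<Sum>q\<in>P. a p * cnj (a q) * cinner (Z p \<omega> e - C p e) (Z q \<omega> e - C q e))" for \<omega> e
    unfolding g_def cinner_sum_left cinner_sum_right cinner_scaleC_left cinner_scaleC_right
    by (subst sum.swap) (simp add: sum_distrib_left mult_ac)
  have int: "integrable M (\<lambda>\<omega>. cinner (g \<omega> e) (g \<omega> e))" if "e \<in> E" for e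
    unfolding sq using that by (intro Bochner_Integration.integrable_sum integrable_mult_right covariance_Z)
  have integral: "(\<integral>\<omega>. cinner (g \<omega> e) (g \<omega> e) \<partial>M) = G e" if "e \<in> E" for e
    unfolding sq G_def using that by (simp add: covariance_Z)
  have norm_g: "(norm (g \<omega> e))\<^sup>2 = Re (cinner (g \<omega> e) (g \<omega> e))" for \<omega> e
    by (simp add: cinner_self)
  have int_norm: "integrable M (\<lambda>\<omega>. (norm (g \<omega> e))\<^sup>2)" "(\<integral>\<omega>. (norm (g \<omega> e))\<^sup>2 \<partial>M) = Re (G e)" if "e \<in> E" for e
    unfolding norm_g using int[OF that] integral[OF that] by (simp_all add: integral_Re)
  have G_nonneg: "0 \<le> Re (G e)" if "e \<in> E" for e
    unfolding int_norm(2)[OF that, symmetric] by simp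
  have nn: "(\<integral>\<^sup>+\<omega>. (\<Sum>e\<in>F m. ennreal ((norm (g \<omega> e))\<^sup>2)) \<partial>M) = ennreal (Re (\<Sum>e\<in>F m. G e))" for m
  proof -
    have "(\<integral>\<^sup>+\<omega>. (\<Sum>e\<in>F m. ennreal ((norm (g \<omega> e))\<^sup>2)) \<partial>M) = (\<Sum>e\<in>F m. \<integral>\<^sup>+\<omega>. ennreal ((norm (g \<omega> e))\<^sup>2) \<partial>M)"
      by (rule nn_integral_sum) measurable
    also have "\<dots> = (\<Sum>e\<in>F m. ennreal (Re (G e)))"
    proof (rule sum.cong)
      fix e assume "e \<in> F m"
      then have "e \<in> E" using F(2) by blast
      then show "(\<integral>\<^sup>+\<omega>. ennreal ((norm (g \<omega> e))\<^sup>2) \<partial>M) = ennreal (Re (G e))"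
        by (simp add: nn_integral_eq_integral[OF int_norm(1)] int_norm(2))
    qed simp
    also have "\<dots> = ennreal (Re (\<Sum>e\<in>F m. G e))"
      using F(2) G_nonneg by (subst sum_ennreal) auto
    finally show ?thesis .
  qed
  have "(\<lambda>m. \<Sum>e\<in>F m. cinner (C p e) (C q e)) \<longlonglongrightarrow> hs_inner E (C p) (C q)" for p q
    using has_sum_infsum[OF hs_inner_summable_bound(1)[OF hs_le_C hs_le_C]]
    unfolding has_sum_def hs_inner_def by (rule filterlim_compose[OF _ F(3)])
  then have "(\<lambda>m. \<Sum>p\<in>P. \<Sum>q\<in>P. a p * cnj (a q) * ((\<Sum>e\<in>F m. \<integral>\<omega>. cinner (Z p \<omega> e) (Z q \<omega> e) \<partial>M)
      - (\<Sum>e\<in>F m. cinner (C p e) (C q e)))) \<longlonglongrightarrow> (\<Sum>p\<in>P. \<Sum>q\<in>P. a p * cnj (a q) * \<Gamma> p q)"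
    unfolding \<Gamma>_def by (intro tendsto_intros sum_integral_cinner_Z_tendsto F)
  moreover have "(\<Sum>p\<in>P. \<Sum>q\<in>P. a p * cnj (a q) * ((\<Sum>e\<in>F m. \<integral>\<omega>. cinner (Z p \<omega> e) (Z q \<omega> e) \<partial>M)
      - (\<Sum>e\<in>F m. cinner (C p e) (C q e)))) = (\<Sum>e\<in>F m. G e)" for m
  proof -
    have "(\<Sum>e\<in>F m. G e) = (\<Sum>p\<in>P. \<Sum>e\<in>F m. \<Sum>q\<in>P. a p * cnj (a q) *
      ((\<integral>\<omega>. cinner (Z p \<omega> e) (Z q \<omega> e) \<partial>M) - cinner (C p e) (C q e)))"
      unfolding G_def by (rule sum.swap)
    also have "\<dots> = (\<Sum>p\<in>P. \<Sum>q\<in>P. \<Sum>e\<in>F m. a p * cnj (a q) *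
      ((\<integral>\<omega>. cinner (Z p \<omega> e) (Z q \<omega> e) \<partial>M) - cinner (C p e) (C q e)))"
      by (intro sum.cong refl sum.swap)
    finally show ?thesis by (simp add: sum_distrib_left[symmetric] sum_subtractf)
  qed
  ultimately have "(\<lambda>m. \<Sum>e\<in>F m. G e) \<longlonglongrightarrow> (\<Sum>p\<in>P. \<Sum>q\<in>P. a p * cnj (a q) * \<Gamma> p q)" (is "_ \<longlonglongrightarrow> ?G")
    by simp
  then have "(\<lambda>m. ennreal (Re (\<Sum>e\<in>F m. G e))) \<longlonglongrightarrow> ennreal (Re ?G)"
    by (intro tendsto_ennrealI tendsto_Re)
  then have "liminf (\<lambda>m. ennreal (Re (\<Sum>e\<in>F m. G e))) = ennreal (Re ?G)"
    by (simp add: lim_imp_Liminf)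
  moreover have "(\<integral>\<^sup>+\<omega>. (hs_norm E (g \<omega>))\<^sup>2 \<partial>M) \<le> liminf (\<lambda>m. ennreal (Re (\<Sum>e\<in>F m. G e)))"
    unfolding hs_norm_sqr_liminf[OF F] nn[symmetric] by (rule nn_integral_liminf) measurable
  moreover have "Re ?G \<le> S"
  proof -
    have "Re ?G \<le> cmod ?G" by (rule complex_Re_le_cmod)
    also have "\<dots> \<le> (\<Sum>p\<in>P. \<Sum>q\<in>P. cmod (a p * cnj (a q) * \<Gamma> p q))"
      by (intro order_trans[OF norm_sum] sum_mono norm_sum)
    also have "\<dots> \<le> S" using bound by (simp add: norm_mult)
    finally show ?thesis .
  qed
  ultimately show ?thesis
    unfolding g_def by (simp add: ennreal_leI order_trans)
qed

lemma expect_tensor_conj: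
  "expect_op M (\<lambda>\<omega>. tensor_op (X u \<omega>) (conj_element E (X v \<omega>))) = cov_op M X (u - v)"
  unfolding expect_tensor[symmetric] expect_op_def
  by (intro ext Bochner_Integration.integral_cong) (simp_all add: conj_X)

text \<open>The definition of the cumulant, solved for the fourth moment, leaves a product of two
  traces and a Hilbert-Schmidt inner product; each is dominated by a product of trace norms.\<close>

lemma \<Gamma>_le:
  "cmod (\<Gamma> (t, s) (t', s')) \<le> cmod (cum4 E M (X t) (X s) (X t') (X s'))
     + \<tau> (t - t') * \<tau> (s' - s) + \<tau> (t - s') * \<tau> (t' - s)"
proof -
  have "\<Gamma> (t, s) (t', s') = cum4 E M (X t) (X s) (X t') (X s')
      + (\<integral>\<omega>. cinner (X t \<omega>) (X t' \<omega>) \<partial>M) * (\<integral>\<omega>. cinner (X s' \<omega>) (X s \<omega>) \<partial>M)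
      + hs_inner E (cov_op M X (t - s')) (cov_op M X (t' - s))"
    unfolding cum4_def expect_tensor_conj expect_tensor by (simp add: \<Gamma>_def Z_def C_def)
  moreover have "cmod (hs_inner E (cov_op M X (t - s')) (cov_op M X (t' - s))) \<le> \<tau> (t - s') * \<tau> (t' - s)"
    by (intro hs_inner_summable_bound hs_le_cov trace_class)
  moreover have "cmod ((\<integral>\<omega>. cinner (X t \<omega>) (X t' \<omega>) \<partial>M) * (\<integral>\<omega>. cinner (X s' \<omega>) (X s \<omega>) \<partial>M))
      \<le> \<tau> (t - t') * \<tau> (s' - s)"
    unfolding norm_mult by (intro mult_mono integral_cinner_le trace_class \<tau>_nonneg norm_ge_zero)
  ultimately show ?thesis
    by (smt (verit) norm_triangle_ineq)
qed

text \<open>Exchanging the two pairs conjugates the cumulant. The summability hypothesis sums over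
  the first pair, so the row sums in Schur's test are reduced to column sums in this way.\<close>

lemma cmod_cum4_swap:
  "cmod (cum4 E M (X t) (X s) (X t') (X s')) = cmod (cum4 E M (X t') (X s') (X t) (X s))"
proof -
  have hs: "hs_inner E A B = cnj (hs_inner E B A)" for A B
    unfolding hs_inner_def by (simp flip: infsum_cnj cinner_commute)
  have fourth: "(\<integral>\<omega>. hs_inner E (tensor_op (X t \<omega>) (X s \<omega>)) (tensor_op (X t' \<omega>) (X s' \<omega>)) \<partial>M)
      = cnj (\<integral>\<omega>. hs_inner E (tensor_op (X t' \<omega>) (X s' \<omega>)) (tensor_op (X t \<omega>) (X s \<omega>)) \<partial>M)"
    unfolding Bochner_Integration.integral_cnj[symmetric] hs[symmetric] ..
  have second: "(\<integral>\<omega>. cinner (X u \<omega>) (X v \<omega>) \<partial>M) = cnj (\<integral>\<omega>. cinner (X v \<omega>) (X u \<omega>) \<partial>M)" for u v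
    unfolding Bochner_Integration.integral_cnj[symmetric] cinner_commute[symmetric] ..
  have "cum4 E M (X t) (X s) (X t') (X s') = cnj (cum4 E M (X t') (X s') (X t) (X s))"
    unfolding cum4_def expect_tensor_conj expect_tensor complex_cnj_diff complex_cnj_mult
      hs[symmetric] fourth[symmetric] second[symmetric] ..
  then show ?thesis by (metis complex_mod_cnj)
qed

end

section \<open>Bias and variance of the estimator\<close>

lemma hs_le_cong:
  assumes "hs_le E A c" "\<And>e. e \<in> E \<Longrightarrow> B e = A e"
  shows "hs_le E B c"
proof (rule hs_leI)
  fix F assume F: "finite F" "F \<subseteq> E"
  then have "(\<Sum>e\<in>F. (norm (B e))\<^sup>2) = (\<Sum>e\<in>F. (norm (A e))\<^sup>2)"
    using assms(2) by (intro sum.cong) auto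
  then show "(\<Sum>e\<in>F. (norm (B e))\<^sup>2) \<le> c\<^sup>2"
    using hs_leD(2)[OF assms(1) F] by simp
qed (rule hs_leD(1)[OF assms(1)])

lemma has_sum_diff:
  fixes f g :: "'a \<Rightarrow> 'b::real_normed_vector"
  assumes "(f has_sum a) A" "(g has_sum b) A"
  shows "((\<lambda>x. f x - g x) has_sum (a - b)) A"
  using assms unfolding has_sum_def sum_subtractf by (rule tendsto_diff)

lemma bounded_clinear_eqI:
  assumes E: "complete_orthonormal E" and A: "bounded_clinear A" and B: "bounded_clinear B"
    and eq: "\<And>e. e \<in> E \<Longrightarrow> A e = B e"
  shows "A = B"
proof
  fix x
  have "((\<lambda>e. A (cinner x e *\<^sub>C e)) has_sum A x) E" "((\<lambda>e. B (cinner x e *\<^sub>C e)) has_sum B x) E"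
    using A B has_sum_bounded_linear[OF _ has_sum_orthonormal_expansion[OF E]]
    unfolding bounded_clinear_def by blast+
  moreover have "((\<lambda>e. A (cinner x e *\<^sub>C e)) has_sum A x) E \<longleftrightarrow> ((\<lambda>e. B (cinner x e *\<^sub>C e)) has_sum A x) E"
    using eq by (intro has_sum_cong) (simp add: bounded_clinear_scaleC[OF A] bounded_clinear_scaleC[OF B])
  ultimately show "A x = B x" using has_sum_unique by blast
qed

section \<open>From the spectral density back to the covariances\<close>

context stationary_process
begin

text \<open>The weight g is kept general to serve both the plain trace sum (g = 0) and the power-law
  class (g = |k|^\<beta>).\<close>

lemma weighted_trace_sum_le:
  assumes bound: "(\<Sum>\<^sub>\<infinity>k. trace_norm E (cov_op M X k) * ennreal (1 + g k)) \<le> ennreal L"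
    and g: "\<And>k. 0 \<le> g k" and L: "0 \<le> L"
  shows "trace_norm E (cov_op M X k) < \<infinity>" "finite G \<Longrightarrow> (\<Sum>k\<in>G. \<tau> k * (1 + g k)) \<le> L"
proof -
  have le: "(\<Sum>k\<in>G. trace_norm E (cov_op M X k) * ennreal (1 + g k)) \<le> ennreal L" if "finite G" for G
    using order_trans[OF sum_le_infsum_ennreal bound] that by blast
  show fin: "trace_norm E (cov_op M X k) < \<infinity>" for k
  proof (rule ccontr)
    assume "\<not> trace_norm E (cov_op M X k) < \<infinity>"
    then have "trace_norm E (cov_op M X k) = top" by (simp add: less_top[symmetric])
    moreover have "0 < 1 + g k" using g[of k] by linarith
    ultimately show False using le[of "{k}"] by (simp add: ennreal_top_mult top_unique)
  qed
  assume "finite G"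
  have "ennreal (\<Sum>k\<in>G. \<tau> k * (1 + g k)) = (\<Sum>k\<in>G. trace_norm E (cov_op M X k) * ennreal (1 + g k))"
  proof (subst sum_ennreal[symmetric])
    show "(\<Sum>k\<in>G. ennreal (\<tau> k * (1 + g k))) = (\<Sum>k\<in>G. trace_norm E (cov_op M X k) * ennreal (1 + g k))"
      using g fin by (intro sum.cong refl) (simp add: \<tau>_def ennreal_mult)
  qed (use g \<tau>_nonneg in auto)
  then show "(\<Sum>k\<in>G. \<tau> k * (1 + g k)) \<le> L"
    using le[OF \<open>finite G\<close>] L by (metis ennreal_le_iff)
qed

lemma summable_cov_trace_sum:
  assumes "summable_cov E M X"
  shows "trace_norm E (cov_op M X k) < \<infinity>" "\<exists>L\<ge>0. \<forall>G. finite G \<longrightarrow> sum \<tau> G \<le> L"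
proof -
  let ?L = "enn2real (\<Sum>\<^sub>\<infinity>k. trace_norm E (cov_op M X k))"
  have "(\<Sum>\<^sub>\<infinity>k. trace_norm E (cov_op M X k) * ennreal (1 + 0)) \<le> ennreal ?L"
    using assms by (simp add: summable_cov_def)
  note le = weighted_trace_sum_le[OF this]
  show "trace_norm E (cov_op M X k) < \<infinity>" by (rule le(1)) simp_all
  show "\<exists>L\<ge>0. \<forall>G. finite G \<longrightarrow> sum \<tau> G \<le> L"
    using le(2) by (intro exI[of _ ?L]) simp
qed

lemma abs_summable_cov:
  assumes "\<And>k. trace_norm E (cov_op M X k) < \<infinity>" "\<And>G. finite G \<Longrightarrow> sum \<tau> G \<le> L" "e \<in> E"
  shows "(\<lambda>k. norm (cov_op M X k e)) summable_on UNIV"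
proof (rule summable_on_comparison_test)
  show "\<tau> summable_on UNIV"
    using assms(2) \<tau>_nonneg by (intro nonneg_bdd_above_summable_on bdd_aboveI2[where M = L]) auto
qed (use hs_leD(4)[OF hs_le_cov[OF assms(1)] assms(3)] in auto)

end

text \<open>Both series converge absolutely at each element of E, so equal densities make the scalar
  Fourier series with coefficients <C(k) e - C'(k) e, y> vanish at every \<theta>.\<close>

lemma cov_op_unique:
  fixes X :: "int ^ 'd::finite \<Rightarrow> 'w \<Rightarrow> 'h::separable_complex_hilbert_space" and X' :: "int ^ 'd \<Rightarrow> 'v \<Rightarrow> 'h"
  assumes "stationary_process E M X" "summable_cov E M X"
    and "stationary_process E M' X'" "summable_cov E M' X'"
    and eq: "spectral_density M X = spectral_density M' X'"
  shows "cov_op M X = cov_op M' X'"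
proof -
  interpret X: stationary_process E M X by fact
  interpret X': stationary_process E M' X' by fact
  obtain L where L: "\<And>G. finite G \<Longrightarrow> sum X.\<tau> G \<le> L"
    using X.summable_cov_trace_sum(2)[OF assms(2)] by blast
  obtain L' where L': "\<And>G. finite G \<Longrightarrow> sum X'.\<tau> G \<le> L'"
    using X'.summable_cov_trace_sum(2)[OF assms(4)] by blast
  have "cov_op M X k e = cov_op M' X' k e" if e: "e \<in> E" for k e
  proof -
    note abs = X.abs_summable_cov[OF X.summable_cov_trace_sum(1)[OF assms(2)] L e]
      X'.abs_summable_cov[OF X'.summable_cov_trace_sum(1)[OF assms(4)] L' e]
    have summable: "(\<lambda>k. cis (real_vec k \<bullet> \<theta>) *\<^sub>C cov_op M X k e) summable_on UNIV"
      "(\<lambda>k. cis (real_vec k \<bullet> \<theta>) *\<^sub>C cov_op M' X' k e) summable_on UNIV" for \<theta>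
      by (rule abs_summable_summable, simp add: norm_scaleC abs)+
    define a where "a y k = cinner (cov_op M X k e) y - cinner (cov_op M' X' k e) y" for y k
    have "a y k = 0" for y k
    proof (rule Fourier_coefficients_unique[of "a y"])
      have "(\<lambda>k. norm (cov_op M X k e) * norm y + norm (cov_op M' X' k e) * norm y) summable_on UNIV"
        by (intro summable_on_add summable_on_cmult_left abs)
      moreover have "norm (a y k) \<le> norm (cov_op M X k e) * norm y + norm (cov_op M' X' k e) * norm y" for k
        unfolding a_def by (rule order_trans[OF norm_triangle_ineq4 add_mono]) (rule cinner_Cauchy_Schwarz)+
      ultimately show "(\<lambda>k. norm (a y k)) summable_on UNIV"
        by (rule summable_on_comparison_test) simp_all
      fix \<theta>
      have "complex_of_real (1 / (2 * pi) ^ CARD('d)) *\<^sub>C (\<Sum>\<^sub>\<infinity>k. cis (real_vec k \<bullet> \<theta>) *\<^sub>C cov_op M X k e)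
          = complex_of_real (1 / (2 * pi) ^ CARD('d)) *\<^sub>C (\<Sum>\<^sub>\<infinity>k. cis (real_vec k \<bullet> \<theta>) *\<^sub>C cov_op M' X' k e)"
        using fun_cong[OF fun_cong[OF eq, of \<theta>], of e] by (simp only: spectral_density_def)
      from arg_cong[OF this, of "\<lambda>v. complex_of_real ((2 * pi) ^ CARD('d)) *\<^sub>C v"]
      have sums: "(\<Sum>\<^sub>\<infinity>k. cis (real_vec k \<bullet> \<theta>) *\<^sub>C cov_op M X k e)
          = (\<Sum>\<^sub>\<infinity>k. cis (real_vec k \<bullet> \<theta>) *\<^sub>C cov_op M' X' k e)"
        by (simp add: scaleC_scaleC flip: of_real_mult)
      have "((\<lambda>k. cinner (cis (real_vec k \<bullet> \<theta>) *\<^sub>C cov_op M X k e) y - cinner (cis (real_vec k \<bullet> \<theta>) *\<^sub>C cov_op M' X' k e) y)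
          has_sum (cinner (\<Sum>\<^sub>\<infinity>k. cis (real_vec k \<bullet> \<theta>) *\<^sub>C cov_op M X k e) y
            - cinner (\<Sum>\<^sub>\<infinity>k. cis (real_vec k \<bullet> \<theta>) *\<^sub>C cov_op M' X' k e) y)) UNIV"
        by (intro has_sum_diff has_sum_bounded_linear[OF bounded_linear_cinner_left] has_sum_infsum summable)
      then have "((\<lambda>k. cis (real_vec k \<bullet> \<theta>) * a y k) has_sum 0) UNIV"
        unfolding sums by (simp add: a_def cinner_scaleC_left right_diff_distrib)
      then show "(\<Sum>\<^sub>\<infinity>k. cis (real_vec k \<bullet> \<theta>) * a y k) = 0" by (rule infsumI)
    qed
    \<comment> \<open>Taking y to be the difference itself turns vanishing coefficients into a
      vanishing norm.\<close>
    then have "cinner (cov_op M X k e - cov_op M' X' k e) (cov_op M X k e - cov_op M' X' k e) = 0"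
      by (simp add: a_def cinner_diff_left)
    then show ?thesis by (simp add: cinner_self_eq_zero)
  qed
  then have "cov_op M X k = cov_op M' X' k" for k
    by (rule bounded_clinear_eqI[OF X.cons X.bounded_clinear_cov X'.bounded_clinear_cov])
  then show ?thesis by (rule ext)
qed

text \<open>The coefficient of a tensor product in the estimator depends on the two sites through
  their difference only, so the mean and the sum of squared weights can both be regrouped by
  lag.\<close>

definition estimator_weight :: "(real ^ 'd \<Rightarrow> real) \<Rightarrow> nat ^ 'd \<Rightarrow> real \<Rightarrow> real ^ 'd \<Rightarrow> int ^ 'd \<Rightarrow> complex" where
  "estimator_weight K n D \<theta> k = complex_of_real (1 / (2 * pi) ^ CARD('d)) *
     (cis (real_vec k \<bullet> \<theta>) * complex_of_real (K (real_vec k /\<^sub>R D) / overlap_volume n k))"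

lemma spectral_estimator_eq:
  "spectral_estimator K n D X \<theta> \<omega> z =
     (\<Sum>t\<in>lattice_box n. \<Sum>s\<in>lattice_box n. estimator_weight K n D \<theta> (t - s) *\<^sub>C tensor_op (X t \<omega>) (X s \<omega>) z)"
  by (simp add: spectral_estimator_def estimator_weight_def scaleC_sum_right scaleC_scaleC)

lemma inverse_two_pi_power: "0 \<le> 1 / (2 * pi) ^ m" "1 / (2 * pi) ^ m \<le> 1"
proof -
  have "1 \<le> (2 * pi) ^ m" using pi_ge_two by (intro one_le_power) linarith
  then show "0 \<le> 1 / (2 * pi) ^ m" "1 / (2 * pi) ^ m \<le> 1" by simp_all
qed

text \<open>The overlap volume V is the multiplicity of the lag k, so a squared weight of order (K /
  V)^2 contributes K^2 / V. The factor 1 / (2 pi)^d is discarded as at most 1.\<close>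

lemma cmod_estimator_weight:
  fixes \<theta> :: "real ^ 'd::finite"
  assumes "k \<in> diff_box n" "0 \<le> K (real_vec k /\<^sub>R D)"
  shows "overlap_volume n k * (cmod (estimator_weight K n D \<theta> k))\<^sup>2
    \<le> (K (real_vec k /\<^sub>R D))\<^sup>2 / overlap_volume n k"
proof -
  let ?c = "1 / (2 * pi) ^ CARD('d)" and ?V = "overlap_volume n k" and ?K = "K (real_vec k /\<^sub>R D)"
  have V: "0 < ?V" by (rule overlap_volume_pos[OF assms(1)])
  have "cmod (estimator_weight K n D \<theta> k) = ?c * (?K / ?V)"
    using V assms(2) inverse_two_pi_power(1)[of "CARD('d)"]
    by (simp add: estimator_weight_def norm_mult norm_divide norm_power)
  also have "\<dots> \<le> 1 * (?K / ?V)"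
    using V assms(2) by (intro mult_right_mono inverse_two_pi_power) auto
  finally have "?V * (cmod (estimator_weight K n D \<theta> k))\<^sup>2 \<le> ?V * (?K / ?V)\<^sup>2"
    using V by (intro mult_left_mono power_mono) auto
  also have "\<dots> = ?K\<^sup>2 / ?V" using V by (simp add: power2_eq_square)
  finally show ?thesis .
qed

section \<open>Mean and variance of the estimator\<close>

context stationary_process
begin

lemma expect_spectral_estimator:
  "expect_op M (spectral_estimator K n D X \<theta>) z =
     (\<Sum>t\<in>lattice_box n. \<Sum>s\<in>lattice_box n. estimator_weight K n D \<theta> (t - s) *\<^sub>C cov_op M X (t - s) z)"
proof -
  have int: "integrable M (\<lambda>\<omega>. estimator_weight K n D \<theta> (t - s) *\<^sub>C tensor_op (X t \<omega>) (X s \<omega>) z)"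
    and integral: "(\<integral>\<omega>. estimator_weight K n D \<theta> (t - s) *\<^sub>C tensor_op (X t \<omega>) (X s \<omega>) z \<partial>M)
      = estimator_weight K n D \<theta> (t - s) *\<^sub>C cov_op M X (t - s) z" for t s
    using integrable_bounded_linear[OF bounded_linear_scaleC_right integrable_tensor]
      integral_bounded_linear[OF bounded_linear_scaleC_right integrable_tensor]
    by (auto simp: integral_tensor)
  show ?thesis
    unfolding expect_op_def spectral_estimator_eq by (simp add: int integral)
qed

lemma measurable_spectral_estimator [measurable]:
  "(\<lambda>\<omega>. spectral_estimator K n D X \<theta> \<omega> z) \<in> borel_measurable M"
  unfolding spectral_estimator_eq tensor_op_def by measurable

text \<open>The error terms carry K(k / D) - 1; flatness extracts D^(-\<beta>) |k|^\<beta>, and the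
  weight of the power-law class absorbs the second factor, whence the constant c L.\<close>

lemma bias_bound:
  fixes K :: "real ^ 'd \<Rightarrow> real"
  assumes trace_class: "\<And>k. trace_norm E (cov_op M X k) < \<infinity>"
    and sum: "\<And>G. finite G \<Longrightarrow> (\<Sum>k\<in>G. \<tau> k * (1 + norm (real_vec k) powr \<beta>)) \<le> L"
    and flat: "\<And>x. \<bar>1 - K x\<bar> \<le> c * norm x powr \<beta>" and c: "0 \<le> c" and D: "0 < D"
    and K: "\<And>x. 0 \<le> K x" and box: "\<And>k. 0 < K (real_vec k /\<^sub>R D) \<Longrightarrow> k \<in> diff_box n"
  shows "hs_le E (\<lambda>z. expect_op M (spectral_estimator K n D X \<theta>) z - spectral_density M X \<theta> z)
           (c * L * D powr (- \<beta>))"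
proof -
  define c0 where "c0 = complex_of_real (1 / (2 * pi) ^ CARD('d))"
  define u where "u k = cis (real_vec k \<bullet> \<theta>) * complex_of_real (K (real_vec k /\<^sub>R D) - 1)" for k
  define v where "v k z = (c0 * u k) *\<^sub>C cov_op M X k z" for k z
  have c0: "cmod c0 \<le> 1"
    unfolding c0_def norm_of_real using inverse_two_pi_power[of "CARD('d)"] by simp
  have v: "hs_le E (v k) (cmod (c0 * u k) * \<tau> k)" for k
    unfolding v_def by (intro hs_le_scaleC hs_le_cov trace_class)
  have v_sum: "(\<Sum>k\<in>G. cmod (c0 * u k) * \<tau> k) \<le> c * L * D powr (- \<beta>)" if "finite G" for G
  proof -
    have "(\<Sum>k\<in>G. cmod (c0 * u k) * \<tau> k) \<le> (\<Sum>k\<in>G. c * D powr (- \<beta>) * (\<tau> k * (1 + norm (real_vec k) powr \<beta>)))"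
    proof (rule sum_mono)
      fix k
      have "cmod (c0 * u k) \<le> 1 * cmod (u k)"
        unfolding norm_mult by (intro mult_right_mono c0) auto
      also have "\<dots> = \<bar>1 - K (real_vec k /\<^sub>R D)\<bar>"
        unfolding u_def norm_mult norm_of_real by (simp add: abs_minus_commute)
      also have "\<dots> \<le> c * norm (real_vec k /\<^sub>R D) powr \<beta>" by (rule flat)
      also have "\<dots> = c * D powr (- \<beta>) * norm (real_vec k) powr \<beta>"
        using D by (simp add: powr_mult powr_minus inverse_powr mult_ac)
      also have "\<dots> \<le> c * D powr (- \<beta>) * (1 + norm (real_vec k) powr \<beta>)"
        using c by (intro mult_left_mono) auto
      finally have "cmod (c0 * u k) * \<tau> k \<le> c * D powr (- \<beta>) * (1 + norm (real_vec k) powr \<beta>) * \<tau> k"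
        by (rule mult_right_mono[OF _ \<tau>_nonneg])
      then show "cmod (c0 * u k) * \<tau> k \<le> c * D powr (- \<beta>) * (\<tau> k * (1 + norm (real_vec k) powr \<beta>))"
        by (simp only: mult_ac)
    qed
    also have "\<dots> \<le> c * D powr (- \<beta>) * L"
      unfolding sum_distrib_left[symmetric] using c by (intro mult_left_mono sum that) auto
    finally show ?thesis by (simp add: mult_ac)
  qed
  have "expect_op M (spectral_estimator K n D X \<theta>) e - spectral_density M X \<theta> e = (\<Sum>\<^sub>\<infinity>k. v k e)" if e: "e \<in> E" for e
  proof -
    define w where "w k = (cis (real_vec k \<bullet> \<theta>) * complex_of_real (K (real_vec k /\<^sub>R D))) *\<^sub>C cov_op M X k e" for k
    have "expect_op M (spectral_estimator K n D X \<theta>) e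
        = (\<Sum>k\<in>diff_box n. overlap_volume n k *\<^sub>R (estimator_weight K n D \<theta> k *\<^sub>C cov_op M X k e))"
      unfolding expect_spectral_estimator by (rule sum_lattice_box_diff)
    also have "\<dots> = (\<Sum>k\<in>diff_box n. c0 *\<^sub>C w k)"
    proof (rule sum.cong)
      fix k assume "k \<in> diff_box n"
      then have "overlap_volume n k \<noteq> 0" using overlap_volume_pos by force
      then show "overlap_volume n k *\<^sub>R (estimator_weight K n D \<theta> k *\<^sub>C cov_op M X k e) = c0 *\<^sub>C w k"
        by (simp add: estimator_weight_def scaleR_scaleC scaleC_scaleC w_def c0_def)
    qed simp
    finally have expect: "expect_op M (spectral_estimator K n D X \<theta>) e = (\<Sum>k\<in>diff_box n. c0 *\<^sub>C w k)" .
    \<comment> \<open>The kernel vanishes off the box of differences, so the finite sum extends to a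
      series over all lags and can be compared with the density term by term.\<close>
    have "w k = 0" if "k \<notin> diff_box n" for k
      using box[of k] K[of "real_vec k /\<^sub>R D"] that by (force simp: w_def)
    then have w_sum: "((\<lambda>k. c0 *\<^sub>C w k) has_sum (\<Sum>k\<in>diff_box n. c0 *\<^sub>C w k)) UNIV"
      by (intro has_sum_finite_neutralI) (auto simp: finite_diff_box)
    have "hs_le E (\<lambda>z. cis (real_vec k \<bullet> \<theta>) *\<^sub>C cov_op M X k z) (\<tau> k)" for k
      using hs_le_scaleC[OF hs_le_cov[OF trace_class], of "cis (real_vec k \<bullet> \<theta>)" k] by simp
    moreover have "sum \<tau> G \<le> L" if "finite G" for G
      using sum[OF that] \<tau>_nonneg by (intro order_trans[OF sum_mono sum[OF that]]) (simp add: mult_left_le distrib_left)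
    ultimately have "(\<lambda>k. cis (real_vec k \<bullet> \<theta>) *\<^sub>C cov_op M X k e) summable_on UNIV"
      by (rule hs_le_infsum(2)) (use e in auto)
    then have "((\<lambda>k. c0 *\<^sub>C (cis (real_vec k \<bullet> \<theta>) *\<^sub>C cov_op M X k e)) has_sum spectral_density M X \<theta> e) UNIV"
      unfolding spectral_density_def c0_def
      by (intro has_sum_bounded_linear[OF bounded_linear_scaleC_right] has_sum_infsum)
    with w_sum have "((\<lambda>k. c0 *\<^sub>C w k - c0 *\<^sub>C (cis (real_vec k \<bullet> \<theta>) *\<^sub>C cov_op M X k e))
        has_sum (expect_op M (spectral_estimator K n D X \<theta>) e - spectral_density M X \<theta> e)) UNIV"
      unfolding expect by (rule has_sum_diff)
    moreover have "c0 *\<^sub>C w k - c0 *\<^sub>C (cis (real_vec k \<bullet> \<theta>) *\<^sub>C cov_op M X k e) = v k e" for k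
      unfolding w_def v_def u_def scaleC_scaleC scaleC_diff_left[symmetric]
      by (simp add: algebra_simps)
    ultimately show ?thesis by (simp add: infsumI)
  qed
  then show ?thesis
    by (intro hs_le_cong[OF hs_le_infsum(1)[OF v v_sum]])
qed

end

text \<open>A finite set of pairs is enclosed in a rectangle, where the sum becomes iterated and
  comparable with the iterated infinite sums in \<open>cum_bound\<close>.\<close>

lemma sum_cum4_le:
  assumes bound: "cum_bound E M X \<le> ennreal \<kappa>" and \<kappa>: "0 \<le> \<kappa>" and P: "finite P"
  shows "(\<Sum>(u, v)\<in>P. cmod (cum4 E M (X u) (X v) (X w) (X 0))) \<le> \<kappa>"
proof -
  let ?f = "\<lambda>u v. cmod (cum4 E M (X u) (X v) (X w) (X 0))"
  have "ennreal (\<Sum>(u, v)\<in>P. ?f u v) \<le> ennreal (\<Sum>(u, v)\<in>fst ` P \<times> snd ` P. ?f u v)"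
    using P by (intro ennreal_leI sum_mono2) (force simp: image_iff)+
  also have "\<dots> = (\<Sum>u\<in>fst ` P. \<Sum>v\<in>snd ` P. ennreal (?f u v))"
    by (simp add: sum.cartesian_product[symmetric] sum_nonneg)
  also have "\<dots> \<le> (\<Sum>u\<in>fst ` P. \<Sum>\<^sub>\<infinity>v. ennreal (?f u v))"
    using P by (intro sum_mono sum_le_infsum_ennreal) auto
  also have "\<dots> \<le> (\<Sum>\<^sub>\<infinity>u. \<Sum>\<^sub>\<infinity>v. ennreal (?f u v))"
    using P by (intro sum_le_infsum_ennreal) auto
  also have "\<dots> \<le> cum_bound E M X"
    unfolding cum_bound_def by (rule SUP_upper) simp
  also note bound
  finally show ?thesis using \<kappa> by simp
qed

context fourth_order_process
begin

text \<open>In the constant, \<kappa> bounds the row and column sums of the cumulants, and each of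
  the two products of second-order terms adds L^2.\<close>

lemma variance_bound:
  assumes sum: "\<And>G. finite G \<Longrightarrow> sum \<tau> G \<le> L"
    and shift: "\<And>t s w v \<tau>. cum4 E M (X (t + \<tau>)) (X (s + \<tau>)) (X (w + \<tau>)) (X (v + \<tau>)) =
                 cum4 E M (X t) (X s) (X w) (X v)"
    and cum: "cum_bound E M X \<le> ennreal \<kappa>" "0 \<le> \<kappa>"
    and K: "\<And>x. 0 \<le> K x"
  shows "(\<integral>\<^sup>+\<omega>. (hs_norm E (\<lambda>z. spectral_estimator K n D X \<theta> \<omega> z
              - expect_op M (spectral_estimator K n D X \<theta>) z))\<^sup>2 \<partial>M)
     \<le> ennreal ((\<kappa> + 2 * L\<^sup>2) * (\<Sum>k\<in>diff_box n. (K (real_vec k /\<^sub>R D))\<^sup>2 / overlap_volume n k))"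
proof -
  define T where "T = lattice_box n"
  define P where "P = T \<times> T"
  define a where "a p = estimator_weight K n D \<theta> (fst p - snd p)" for p
  define H where "H p q = (case (p, q) of ((t, s), (t', s')) \<Rightarrow>
      cmod (cum4 E M (X t) (X s) (X t') (X s')) + \<tau> (t - t') * \<tau> (s' - s) + \<tau> (t - s') * \<tau> (t' - s))" for p q
  have T: "finite T" by (simp add: T_def finite_lattice_box)
  have L: "0 \<le> L" using sum[of "{}"] by simp
  have sum_\<tau>: "(\<Sum>x\<in>T. \<tau> (y - x)) \<le> L" "(\<Sum>x\<in>T. \<tau> (x - y)) \<le> L" for y
  proof -
    have "(\<Sum>x\<in>T. \<tau> (y - x)) = sum \<tau> ((\<lambda>x. y - x) ` T)" "(\<Sum>x\<in>T. \<tau> (x - y)) = sum \<tau> ((\<lambda>x. x - y) ` T)"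
      by (simp_all add: sum.reindex inj_on_def)
    then show "(\<Sum>x\<in>T. \<tau> (y - x)) \<le> L" "(\<Sum>x\<in>T. \<tau> (x - y)) \<le> L"
      using sum T by simp_all
  qed
  \<comment> \<open>In each second-order term the summation variables separate, with one factor
    \<open>\<tau>\<close> for each.\<close>
  have prod_le: "(\<Sum>x\<in>T. \<Sum>y\<in>T. f x * g y) \<le> L\<^sup>2"
    if "sum f T \<le> L" "sum g T \<le> L" "\<And>x. 0 \<le> f x" "\<And>x. 0 \<le> g x" for f g :: "int ^ 'd \<Rightarrow> real"
  proof -
    have "(\<Sum>x\<in>T. \<Sum>y\<in>T. f x * g y) = sum f T * sum g T" by (simp add: sum_product)
    also have "\<dots> \<le> L * L" using that L by (intro mult_mono) (auto intro: sum_nonneg)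
    finally show ?thesis by (simp add: power2_eq_square)
  qed
  \<comment> \<open>Shifting all four arguments by -s' brings the last one to 0, so
    \<open>cum_bound\<close> applies with w = t' - s'.\<close>
  have col_cum: "(\<Sum>(t, s)\<in>P. cmod (cum4 E M (X t) (X s) (X t') (X s'))) \<le> \<kappa>" for t' s'
  proof -
    have "cum4 E M (X t) (X s) (X t') (X s') = cum4 E M (X (t - s')) (X (s - s')) (X (t' - s')) (X 0)" for t s
      using shift[of "t - s'" s' "s - s'" "t' - s'" 0] by simp
    then have "(\<Sum>(t, s)\<in>P. cmod (cum4 E M (X t) (X s) (X t') (X s')))
        = (\<Sum>(u, v)\<in>(\<lambda>(t, s). (t - s', s - s')) ` P. cmod (cum4 E M (X u) (X v) (X (t' - s')) (X 0)))"
      by (simp add: sum.reindex inj_on_def case_prod_unfold o_def prod_eq_iff)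
    also have "\<dots> \<le> \<kappa>"
      using T by (intro sum_cum4_le cum) (simp add: P_def)
    finally show ?thesis .
  qed
  have col: "(\<Sum>p\<in>P. H p q) \<le> \<kappa> + 2 * L\<^sup>2" for q
  proof -
    obtain t' s' where q: "q = (t', s')" by force
    have "(\<Sum>p\<in>P. H p q) = (\<Sum>(t, s)\<in>P. cmod (cum4 E M (X t) (X s) (X t') (X s')))
        + (\<Sum>t\<in>T. \<Sum>s\<in>T. \<tau> (t - t') * \<tau> (s' - s)) + (\<Sum>t\<in>T. \<Sum>s\<in>T. \<tau> (t - s') * \<tau> (t' - s))"
      by (simp add: H_def q P_def sum.cartesian_product case_prod_unfold sum.distrib)
    also have "\<dots> \<le> \<kappa> + L\<^sup>2 + L\<^sup>2"
      by (intro add_mono col_cum prod_le sum_\<tau> \<tau>_nonneg)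
    finally show ?thesis by simp
  qed
  have row: "(\<Sum>q\<in>P. H p q) \<le> \<kappa> + 2 * L\<^sup>2" for p
  proof -
    obtain t s where p: "p = (t, s)" by force
    have "(\<Sum>q\<in>P. H p q) = (\<Sum>(t', s')\<in>P. cmod (cum4 E M (X t') (X s') (X t) (X s)))
        + (\<Sum>t'\<in>T. \<Sum>s'\<in>T. \<tau> (t - t') * \<tau> (s' - s)) + (\<Sum>t'\<in>T. \<Sum>s'\<in>T. \<tau> (t' - s) * \<tau> (t - s'))"
      by (simp add: H_def p P_def sum.cartesian_product case_prod_unfold sum.distrib mult.commute
          cmod_cum4_swap[of t s])
    also have "\<dots> \<le> \<kappa> + L\<^sup>2 + L\<^sup>2"
      by (intro add_mono col_cum prod_le sum_\<tau> \<tau>_nonneg)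
    finally show ?thesis by simp
  qed
  have H: "cmod (\<Gamma> p q) \<le> H p q" "0 \<le> H p q" for p q
    using \<Gamma>_le[of "fst p" "snd p" "fst q" "snd q"] \<tau>_nonneg
    by (auto simp: H_def case_prod_unfold)
  have "(\<Sum>p\<in>P. \<Sum>q\<in>P. cmod (a p) * cmod (a q) * cmod (\<Gamma> p q))
      \<le> (\<Sum>p\<in>P. \<Sum>q\<in>P. cmod (a p) * cmod (a q) * H p q)"
    by (intro sum_mono mult_left_mono H) auto
  also have "\<dots> \<le> (\<kappa> + 2 * L\<^sup>2) * (\<Sum>p\<in>P. (cmod (a p))\<^sup>2)"
    by (intro weighted_Schur_bound H row col)
  also have "(\<Sum>p\<in>P. (cmod (a p))\<^sup>2) = (\<Sum>t\<in>T. \<Sum>s\<in>T. (cmod (estimator_weight K n D \<theta> (t - s)))\<^sup>2)"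
    by (simp add: P_def a_def sum.cartesian_product case_prod_unfold)
  also have "\<dots> = (\<Sum>k\<in>diff_box n. overlap_volume n k *\<^sub>R (cmod (estimator_weight K n D \<theta> k))\<^sup>2)"
    unfolding T_def by (rule sum_lattice_box_diff)
  also have "(\<kappa> + 2 * L\<^sup>2) * \<dots> \<le> (\<kappa> + 2 * L\<^sup>2) * (\<Sum>k\<in>diff_box n. (K (real_vec k /\<^sub>R D))\<^sup>2 / overlap_volume n k)"
    using cum(2) L K by (intro mult_left_mono sum_mono) (auto intro: cmod_estimator_weight)
  finally have "(\<integral>\<^sup>+\<omega>. (hs_norm E (\<lambda>z. \<Sum>p\<in>P. a p *\<^sub>C (Z p \<omega> z - C p z)))\<^sup>2 \<partial>M)
     \<le> ennreal ((\<kappa> + 2 * L\<^sup>2) * (\<Sum>k\<in>diff_box n. (K (real_vec k /\<^sub>R D))\<^sup>2 / overlap_volume n k))"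
    using T by (intro nn_integral_hs_norm_le) (auto simp: P_def)
  moreover have "(\<Sum>p\<in>P. a p *\<^sub>C (Z p \<omega> z - C p z))
      = spectral_estimator K n D X \<theta> \<omega> z - expect_op M (spectral_estimator K n D X \<theta>) z" for \<omega> z
    unfolding spectral_estimator_eq expect_spectral_estimator sum_subtractf[symmetric] scaleC_diff_right[symmetric]
    by (simp add: P_def T_def a_def Z_def C_def sum.cartesian_product case_prod_unfold)
  ultimately show ?thesis by simp
qed

end

section \<open>Mean squared error and uniform rates\<close>

lemma hs_norm_sqr_add_le:
  "(hs_norm E (\<lambda>z. A z + B z))\<^sup>2 \<le> 2 * (hs_norm E A)\<^sup>2 + 2 * (hs_norm E B)\<^sup>2"
  unfolding hs_norm_sqr[of E "\<lambda>z. A z + B z"]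
proof (rule infsum_ennreal_le)
  fix F assume F: "finite F" "F \<subseteq> E"
  have "(norm (A e + B e))\<^sup>2 \<le> 2 * (norm (A e))\<^sup>2 + 2 * (norm (B e))\<^sup>2" for e
  proof -
    have "(norm (A e + B e))\<^sup>2 \<le> (norm (A e) + norm (B e))\<^sup>2"
      by (intro power_mono norm_triangle_ineq) simp
    then show ?thesis
      using sum_squares_bound[of "norm (A e)" "norm (B e)"] by (simp add: power2_sum)
  qed
  then have "(\<Sum>e\<in>F. ennreal ((norm (A e + B e))\<^sup>2))
      \<le> (\<Sum>e\<in>F. 2 * ennreal ((norm (A e))\<^sup>2) + 2 * ennreal ((norm (B e))\<^sup>2))"
    by (intro sum_mono) (simp add: ennreal_leI flip: ennreal_plus ennreal_numeral ennreal_mult)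
  also have "\<dots> = 2 * (\<Sum>e\<in>F. ennreal ((norm (A e))\<^sup>2)) + 2 * (\<Sum>e\<in>F. ennreal ((norm (B e))\<^sup>2))"
    by (simp add: sum.distrib sum_distrib_left del: sum_ennreal)
  also have "\<dots> \<le> 2 * (hs_norm E A)\<^sup>2 + 2 * (hs_norm E B)\<^sup>2"
    unfolding hs_norm_sqr by (intro add_mono mult_left_mono sum_le_infsum_ennreal F) auto
  finally show "(\<Sum>e\<in>F. ennreal ((norm (A e + B e))\<^sup>2)) \<le> 2 * (hs_norm E A)\<^sup>2 + 2 * (hs_norm E B)\<^sup>2" .
qed

text \<open>The inequality |a + b|^2 <= 2 |a|^2 + 2 |b|^2 replaces the exact bias-variance identity:
  no cross term has to be shown to vanish, infinite values are allowed, and the rate is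
  unaffected.\<close>

lemma (in stationary_process) mean_square_error_le:
  "(\<integral>\<^sup>+\<omega>. (hs_norm E (\<lambda>z. spectral_estimator K n D X \<theta> \<omega> z - f z))\<^sup>2 \<partial>M)
    \<le> 2 * (\<integral>\<^sup>+\<omega>. (hs_norm E (\<lambda>z. spectral_estimator K n D X \<theta> \<omega> z
             - expect_op M (spectral_estimator K n D X \<theta>) z))\<^sup>2 \<partial>M)
      + 2 * (hs_norm E (\<lambda>z. expect_op M (spectral_estimator K n D X \<theta>) z - f z))\<^sup>2"
  (is "?mse \<le> 2 * ?var + 2 * ?bias\<^sup>2")
proof -
  let ?V = "\<lambda>\<omega>. (hs_norm E (\<lambda>z. spectral_estimator K n D X \<theta> \<omega> z
             - expect_op M (spectral_estimator K n D X \<theta>) z))\<^sup>2"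
  have V: "?V \<in> borel_measurable M"
    by (rule measurable_hs_norm_sqr) measurable
  have "?mse \<le> (\<integral>\<^sup>+\<omega>. 2 * ?V \<omega> + 2 * ?bias\<^sup>2 \<partial>M)"
    using hs_norm_sqr_add_le[of E "\<lambda>z. spectral_estimator K n D X \<theta> _ z
        - expect_op M (spectral_estimator K n D X \<theta>) z"
        "\<lambda>z. expect_op M (spectral_estimator K n D X \<theta>) z - f z"]
    by (intro nn_integral_mono) simp
  also have "\<dots> = 2 * ?var + 2 * ?bias\<^sup>2"
    using V by (simp add: nn_integral_add nn_integral_cmult emeasure_space_1)
  finally show ?thesis .
qed

text \<open>Membership of f in the class speaks about some process (M', X') with density f, not
  about the given one; equality of the covariances carries the weighted trace bound over to (M,
  X).\<close>

lemma admissible_process: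
  fixes M :: "'w measure" and X :: "int ^ 'd::finite \<Rightarrow> 'w \<Rightarrow> 'h::separable_complex_hilbert_space"
  assumes cons: "complete_orthonormal E" and L: "0 \<le> L"
    and f: "f \<in> power_law_class TYPE('w) E \<beta> L" and MX: "(M, X) \<in> admissible_processes E f"
  shows "fourth_order_process E M X" "spectral_density M X = f"
    "cum4 E M (X (t + h)) (X (s + h)) (X (w + h)) (X (v + h)) = cum4 E M (X t) (X s) (X w) (X v)"
    "cum_bound E M X < \<infinity>"
    "finite G \<Longrightarrow> (\<Sum>k\<in>G. stationary_process.\<tau> E M X k * (1 + norm (real_vec k) powr \<beta>)) \<le> L"
    "finite G \<Longrightarrow> sum (stationary_process.\<tau> E M X) G \<le> L"
proof -
  from MX have X: "second_order_stationary E M X" "summable_cov E M X" "spectral_density M X = f"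
    "\<And>t. integrable M (\<lambda>\<omega>. norm (X t \<omega>) ^ 4)"
    "\<And>t s w v h. cum4 E M (X (t + h)) (X (s + h)) (X (w + h)) (X (v + h)) = cum4 E M (X t) (X s) (X w) (X v)"
    "cum_bound E M X < \<infinity>"
    by (simp_all add: admissible_processes_def)
  interpret stationary_process E M X
    using cons X(1) by unfold_locales
  from f obtain M' :: "'w measure" and X' :: "int ^ 'd \<Rightarrow> 'w \<Rightarrow> 'h" where X':
    "f = spectral_density M' X'" "second_order_stationary E M' X'" "summable_cov E M' X'"
    "(\<Sum>\<^sub>\<infinity>k. trace_norm E (cov_op M' X' k) * ennreal (1 + norm (real_vec k) powr \<beta>)) \<le> ennreal L"
    unfolding power_law_class_def by blast
  have X'_stat: "stationary_process E M' X'"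
    using cons X'(2) by unfold_locales
  have "cov_op M X = cov_op M' X'"
    by (rule cov_op_unique[OF stationary_process_axioms X(2) X'_stat X'(3)]) (simp add: X(3) X'(1))
  with X'(4) have "(\<Sum>\<^sub>\<infinity>k. trace_norm E (cov_op M X k) * ennreal (1 + norm (real_vec k) powr \<beta>)) \<le> ennreal L"
    by simp
  note trace = weighted_trace_sum_le[OF this powr_ge_zero L]
  show "fourth_order_process E M X"
    using trace(1) X(4) by unfold_locales
  show "spectral_density M X = f" by (rule X(3))
  show "cum4 E M (X (t + h)) (X (s + h)) (X (w + h)) (X (v + h)) = cum4 E M (X t) (X s) (X w) (X v)" by (rule X(5))
  show "cum_bound E M X < \<infinity>" by (rule X(6))
  show sum: "(\<Sum>k\<in>G. \<tau> k * (1 + norm (real_vec k) powr \<beta>)) \<le> L" if "finite G"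
    using trace(2)[OF that] .
  show "sum \<tau> G \<le> L" if "finite G"
    using \<tau>_nonneg by (intro order_trans[OF sum_mono sum[OF that]]) (simp add: mult_left_le distrib_left)
qed

theorem theorem5p2:
  fixes E :: "'h::separable_complex_hilbert_space set"
    and n :: "nat \<Rightarrow> nat ^ 'd::finite"
    and K :: "real ^ 'd \<Rightarrow> real"
    and \<Delta> :: "nat \<Rightarrow> real"
    and \<beta> L \<epsilon> :: real
    and lam :: nat
  assumes cons: "complete_orthonormal E"
    and n_lim: "\<And>l. filterlim (\<lambda>\<nu>. n \<nu> $ l) at_top sequentially"
    and K_nonneg: "\<And>u. 0 \<le> K u"
    and K_cont: "continuous_on UNIV K"
    and K_supp: "bounded {t. K t > 0}" "0 \<in> {t. K t > 0}"
    and K_sup: "bdd_above (range K)" "(SUP u. K u) = K 0" "K 0 = 1"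
    and eps: "0 < \<epsilon>"
    and K_diff: "\<And>u. norm u < \<epsilon> \<Longrightarrow> K differentiable (at u)"
    and K_grad: "bdd_above ((\<lambda>u. norm (gradient K u)) ` {u. norm u < \<epsilon>})"
    and bw_pos: "\<And>\<nu>. 0 < \<Delta> \<nu>"
    and bw_supp: "\<And>\<nu> k. real_vec k \<in> (\<lambda>u. \<Delta> \<nu> *\<^sub>R u) ` {t. K t > 0} \<Longrightarrow>
                   k \<in> {a - b | a b. a \<in> lattice_box (n \<nu>) \<and> b \<in> lattice_box (n \<nu>)}"
    and bw_lim: "(\<lambda>\<nu>. \<Delta> \<nu> ^ CARD('d) / real (card (lattice_box (n \<nu>)))) \<longlonglongrightarrow> 0"
    and pos: "0 < \<beta>" "0 < L"
    and lam: "max 0 (\<beta> - 1) < real lam"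
    and K_smooth: "partials_exist (lam + 1) K"
    and K_flat: "\<And>\<alpha> js. 1 \<le> multi_size \<alpha> \<Longrightarrow> multi_size \<alpha> \<le> lam \<Longrightarrow>
                   js \<in> orderings_of \<alpha> \<Longrightarrow> iter_partial js K 0 = 0"
    and K_top: "\<And>\<alpha> js. multi_size \<alpha> = lam + 1 \<Longrightarrow> js \<in> orderings_of \<alpha> \<Longrightarrow>
                   bounded (range (iter_partial js K))"
  shows
    "(\<exists>c. \<forall>\<^sub>F \<nu> in sequentially.
        (SUP f\<in>power_law_class TYPE('w) E \<beta> L.
         SUP (M :: 'w measure, X)\<in>admissible_processes E f.
         SUP \<theta>\<in>cbox (\<chi> l. - pi) (\<chi> l. pi).
           hs_norm E (\<lambda>z. expect_op M (spectral_estimator K (n \<nu>) (\<Delta> \<nu>) X \<theta>) z - f \<theta> z))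
        \<le> ennreal (c * \<Delta> \<nu> powr (- \<beta>)))
     \<and>
     ((\<exists>\<delta>>0. \<forall>\<nu>. \<delta> \<le> \<Delta> \<nu>) \<longrightarrow>
      (\<forall>f\<in>power_law_class TYPE('w) E \<beta> L. \<forall>(M :: 'w measure, X)\<in>admissible_processes E f.
      \<exists>c. \<forall>\<^sub>F \<nu> in sequentially.
        (SUP \<theta>\<in>cbox (\<chi> l. - pi) (\<chi> l. pi).
           \<integral>\<^sup>+\<omega>. (hs_norm E (\<lambda>z. spectral_estimator K (n \<nu>) (\<Delta> \<nu>) X \<theta> \<omega> z
                     - expect_op M (spectral_estimator K (n \<nu>) (\<Delta> \<nu>) X \<theta>) z))\<^sup>2 \<partial>M)
        \<le> ennreal (c * (\<Delta> \<nu> ^ CARD('d) / real (card (lattice_box (n \<nu>)))))))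
     \<and>
     ((\<forall>\<nu>. \<Delta> \<nu> = real (card (lattice_box (n \<nu>))) powr (1 / (2 * \<beta> + real CARD('d)))) \<longrightarrow>
      (\<forall>\<kappa>::real. \<exists>c. \<forall>\<^sub>F \<nu> in sequentially.
        (SUP f\<in>power_law_class TYPE('w) E \<beta> L.
         SUP (M :: 'w measure, X)\<in>{(M, X). (M, X) \<in> admissible_processes E f \<and>
                                           cum_bound E M X \<le> ennreal \<kappa>}.
         SUP \<theta>\<in>cbox (\<chi> l. - pi) (\<chi> l. pi).
           sqrt_ennreal (\<integral>\<^sup>+\<omega>. (hs_norm E (\<lambda>z. spectral_estimator K (n \<nu>) (\<Delta> \<nu>) X \<theta> \<omega> z
                                       - f \<theta> z))\<^sup>2 \<partial>M))
        \<le> ennreal (c * real (card (lattice_box (n \<nu>))) powr (- \<beta> / (2 * \<beta> + real CARD('d))))))"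
proof -
  let ?V = "\<lambda>\<nu> \<theta> (M :: 'w measure) X. \<integral>\<^sup>+\<omega>. (hs_norm E (\<lambda>z. spectral_estimator K (n \<nu>) (\<Delta> \<nu>) X \<theta> \<omega> z
      - expect_op M (spectral_estimator K (n \<nu>) (\<Delta> \<nu>) X \<theta>) z))\<^sup>2 \<partial>M"
  have K_le: "K u \<le> 1" for u
    using cSUP_upper[OF UNIV_I K_sup(1), of u] K_sup(2,3) by simp
  obtain R where R: "0 \<le> R" "\<And>x. R < norm x \<Longrightarrow> K x = 0"
  proof -
    obtain R0 where R0: "\<And>x. K x > 0 \<Longrightarrow> norm x \<le> R0"
      using K_supp(1) by (auto simp: bounded_iff)
    show thesis
    proof (rule that[of "max R0 0"])
      show "K x = 0" if "max R0 0 < norm x" for x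
        using R0[of x] K_nonneg[of x] that by (cases "K x = 0") auto
    qed simp
  qed
  obtain cf where cf: "0 \<le> cf" "\<And>x. \<bar>1 - K x\<bar> \<le> cf * norm x powr \<beta>"
    by (rule kernel_flat_at_origin[of lam K \<beta>])
      (rule K_smooth, erule (2) K_flat, erule (1) K_top, rule K_nonneg, rule K_le, rule K_sup,
        rule pos, use lam in simp, blast)
  obtain Q where Q: "0 \<le> Q" "\<And>x i t. \<bar>K (x + t *\<^sub>R axis i 1) - K x\<bar> \<le> Q * \<bar>t\<bar>"
    by (rule kernel_axis_Lipschitz[of lam K R])
      (rule K_smooth, erule (1) K_top, erule R, rule R, blast)
  have box: "k \<in> diff_box (n \<nu>)" if "0 < K (real_vec k /\<^sub>R \<Delta> \<nu>)" for \<nu> k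
  proof -
    have "real_vec k \<in> (\<lambda>u. \<Delta> \<nu> *\<^sub>R u) ` {t. K t > 0}"
      using that bw_pos[of \<nu>] by (intro image_eqI[of _ _ "real_vec k /\<^sub>R \<Delta> \<nu>"]) auto
    from bw_supp[OF this] show ?thesis by (auto intro: lattice_box_diff)
  qed
  \<comment> \<open>As K(0) > 0, lag 0 is a difference of lattice points, so no box is empty and the
    bounds below hold for all \<nu>, not just eventually.\<close>
  have N_pos: "1 \<le> real (card (lattice_box (n \<nu>)))" for \<nu>
  proof -
    have "real_vec 0 \<in> (\<lambda>u. \<Delta> \<nu> *\<^sub>R u) ` {t. K t > 0}"
      using K_supp(2) by (intro image_eqI[of _ _ 0]) (auto simp: real_vec_def vec_eq_iff)
    from bw_supp[OF this] have "lattice_box (n \<nu>) \<noteq> {}" by auto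
    then have "0 < card (lattice_box (n \<nu>))" by (simp add: card_gt_0_iff finite_lattice_box)
    then show ?thesis by linarith
  qed
  have L: "0 \<le> L" using pos by simp
  have bias: "hs_norm E (\<lambda>z. expect_op M (spectral_estimator K (n \<nu>) (\<Delta> \<nu>) X \<theta>) z - f \<theta> z)
      \<le> ennreal (cf * L * \<Delta> \<nu> powr (- \<beta>))"
    if f: "f \<in> power_law_class TYPE('w) E \<beta> L" and MX: "(M, X) \<in> admissible_processes E f"
    for f \<nu> \<theta> and M :: "'w measure" and X
  proof -
    note adm = admissible_process[OF cons L f MX]
    interpret fourth_order_process E M X by (rule adm(1))
    show ?thesis
      unfolding adm(2)[symmetric]
      by (intro hs_norm_le bias_bound trace_class adm(5) cf bw_pos K_nonneg box)
  qed
  \<comment> \<open>The constant \<open>ck\<close> precedes f, the process, \<theta> and \<kappa>;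
    the uniform mean squared error bound rests on this order of quantifiers.\<close>
  have variance: "\<exists>ck\<ge>0. \<forall>\<nu> \<theta> f. \<forall>M :: 'w measure. \<forall>X \<kappa>.
      f \<in> power_law_class TYPE('w) E \<beta> L \<longrightarrow> (M, X) \<in> admissible_processes E f \<longrightarrow>
      0 \<le> \<kappa> \<longrightarrow> cum_bound E M X \<le> ennreal \<kappa> \<longrightarrow>
        ?V \<nu> \<theta> M X \<le> ennreal ((\<kappa> + 2 * L\<^sup>2) * (ck * (\<Delta> \<nu> ^ CARD('d) / real (card (lattice_box (n \<nu>))))))"
    if \<delta>: "0 < \<delta>" "\<And>\<nu>. \<delta> \<le> \<Delta> \<nu>" for \<delta>
  proof -
    obtain ck where ck: "0 \<le> ck" "\<And>n D. \<delta> \<le> D \<Longrightarrow> (\<And>k. 0 < K (real_vec k /\<^sub>R D) \<Longrightarrow> k \<in> diff_box n) \<Longrightarrow>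
       (\<Sum>k\<in>diff_box n. (K (real_vec k /\<^sub>R D))\<^sup>2 / overlap_volume n k)
         \<le> ck * (D ^ CARD('d) / real (card (lattice_box n)))"
      using kernel_square_sum_bound[OF K_nonneg K_le R(2) R(1) Q(2) Q(1) \<delta>(1)] by blast
    show ?thesis
    proof (intro exI[of _ ck] conjI ck(1) allI impI)
      fix \<nu> \<theta> f \<kappa> and M :: "'w measure" and X :: "int ^ 'd \<Rightarrow> 'w \<Rightarrow> 'h"
      assume f: "f \<in> power_law_class TYPE('w) E \<beta> L" and MX: "(M, X) \<in> admissible_processes E f"
        and \<kappa>: "0 \<le> \<kappa>" "cum_bound E M X \<le> ennreal \<kappa>"
      note adm = admissible_process[OF cons L f MX]
      interpret fourth_order_process E M X by (rule adm(1))
      have "?V \<nu> \<theta> M X \<le> ennreal ((\<kappa> + 2 * L\<^sup>2) * (\<Sum>k\<in>diff_box (n \<nu>). (K (real_vec k /\<^sub>R \<Delta> \<nu>))\<^sup>2 / overlap_volume (n \<nu>) k))"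
        by (rule variance_bound[OF adm(6) adm(3) \<kappa>(2,1) K_nonneg])
      also have "\<dots> \<le> ennreal ((\<kappa> + 2 * L\<^sup>2) * (ck * (\<Delta> \<nu> ^ CARD('d) / real (card (lattice_box (n \<nu>))))))"
        using \<kappa>(1) by (intro ennreal_leI mult_left_mono ck(2) \<delta>(2) box) auto
      finally show "?V \<nu> \<theta> M X \<le> ennreal ((\<kappa> + 2 * L\<^sup>2) * (ck * (\<Delta> \<nu> ^ CARD('d) / real (card (lattice_box (n \<nu>))))))" .
    qed
  qed
  show ?thesis
  proof (intro conjI impI allI)
    show "\<exists>c. \<forall>\<^sub>F \<nu> in sequentially.
        (SUP f\<in>power_law_class TYPE('w) E \<beta> L.
         SUP (M :: 'w measure, X)\<in>admissible_processes E f.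
         SUP \<theta>\<in>cbox (\<chi> l. - pi) (\<chi> l. pi).
           hs_norm E (\<lambda>z. expect_op M (spectral_estimator K (n \<nu>) (\<Delta> \<nu>) X \<theta>) z - f \<theta> z))
        \<le> ennreal (c * \<Delta> \<nu> powr (- \<beta>))"
      by (intro exI[of _ "cf * L"] always_eventually allI SUP_least) (auto intro!: SUP_least bias)
  next
    assume "\<exists>\<delta>>0. \<forall>\<nu>. \<delta> \<le> \<Delta> \<nu>"
    then obtain \<delta> where \<delta>: "0 < \<delta>" "\<And>\<nu>. \<delta> \<le> \<Delta> \<nu>" by blast
    from variance[OF \<delta>] obtain ck where ck: "\<And>\<nu> \<theta> f X \<kappa>. \<And>M :: 'w measure.
      f \<in> power_law_class TYPE('w) E \<beta> L \<Longrightarrow> (M, X) \<in> admissible_processes E f \<Longrightarrow>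
      0 \<le> \<kappa> \<Longrightarrow> cum_bound E M X \<le> ennreal \<kappa> \<Longrightarrow>
        ?V \<nu> \<theta> M X \<le> ennreal ((\<kappa> + 2 * L\<^sup>2) * (ck * (\<Delta> \<nu> ^ CARD('d) / real (card (lattice_box (n \<nu>))))))"
      by blast
    have "\<exists>c. \<forall>\<^sub>F \<nu> in sequentially.
        (SUP \<theta>\<in>cbox (\<chi> l. - pi) (\<chi> l. pi).
           ?V \<nu> \<theta> M X)
        \<le> ennreal (c * (\<Delta> \<nu> ^ CARD('d) / real (card (lattice_box (n \<nu>)))))"
      if f: "f \<in> power_law_class TYPE('w) E \<beta> L" and MX: "(M, X) \<in> admissible_processes E f"
      for f and M :: "'w measure" and X :: "int ^ 'd \<Rightarrow> 'w \<Rightarrow> 'h"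
    \<comment> \<open>For a single process its own cumulant bound serves as \<kappa>, so this
      constant depends on the process.\<close>
    proof (intro exI[of _ "(enn2real (cum_bound E M X) + 2 * L\<^sup>2) * ck"] always_eventually allI SUP_least)
      fix \<nu> \<theta>
      have "cum_bound E M X \<le> ennreal (enn2real (cum_bound E M X))"
        using admissible_process(4)[OF cons L f MX] by simp
      from ck[OF f MX _ this]
      show "?V \<nu> \<theta> M X \<le> ennreal ((enn2real (cum_bound E M X) + 2 * L\<^sup>2) * ck *
                (\<Delta> \<nu> ^ CARD('d) / real (card (lattice_box (n \<nu>)))))"
        by (simp add: mult.assoc)
    qed
    then show "\<forall>f\<in>power_law_class TYPE('w) E \<beta> L. \<forall>(M :: 'w measure, X)\<in>admissible_processes E f.
      \<exists>c. \<forall>\<^sub>F \<nu> in sequentially.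
        (SUP \<theta>\<in>cbox (\<chi> l. - pi) (\<chi> l. pi).
           ?V \<nu> \<theta> M X)
        \<le> ennreal (c * (\<Delta> \<nu> ^ CARD('d) / real (card (lattice_box (n \<nu>)))))"
      by blast
  next
    fix \<kappa> :: real
    assume \<Delta>: "\<forall>\<nu>. \<Delta> \<nu> = real (card (lattice_box (n \<nu>))) powr (1 / (2 * \<beta> + real CARD('d)))"
    define N where "N \<nu> = real (card (lattice_box (n \<nu>)))" for \<nu>
    define r where "r \<nu> = N \<nu> powr (- \<beta> / (2 * \<beta> + real CARD('d)))" for \<nu>
    have N: "1 \<le> N \<nu>" for \<nu> using N_pos by (simp add: N_def)
    have b: "0 < 2 * \<beta> + real CARD('d)" using pos(1) by (simp add: add_pos_nonneg)
    have \<Delta>N: "\<Delta> \<nu> = N \<nu> powr (1 / (2 * \<beta> + real CARD('d)))" for \<nu> using \<Delta> by (simp add: N_def)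
    have r0: "0 \<le> r \<nu>" for \<nu> by (simp add: r_def)
    have \<Delta>_bias: "\<Delta> \<nu> powr (- \<beta>) = r \<nu>" for \<nu>
      by (simp add: \<Delta>N r_def powr_powr)
    \<comment> \<open>The bandwidth balances the two errors: d / (2 \<beta> + d) - 1 = -2 \<beta> /
      (2 \<beta> + d), so the order of the variance is the square of the order of the bias.\<close>
    have \<Delta>_var: "\<Delta> \<nu> ^ CARD('d) / N \<nu> = (r \<nu>)\<^sup>2" for \<nu>
    proof -
      have "\<Delta> \<nu> ^ CARD('d) / N \<nu> = N \<nu> powr (real CARD('d) / (2 * \<beta> + real CARD('d)) - 1)"
        using N[of \<nu>] by (simp add: \<Delta>N powr_powr powr_diff flip: powr_realpow)
      also have "real CARD('d) / (2 * \<beta> + real CARD('d)) - 1 = - \<beta> / (2 * \<beta> + real CARD('d)) * 2"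
        using b by (simp add: field_simps)
      also have "N \<nu> powr \<dots> = (r \<nu>)\<^sup>2"
        using N[of \<nu>] by (simp add: r_def powr_powr flip: powr_realpow)
      finally show ?thesis .
    qed
    \<comment> \<open>A bandwidth that is a positive power of |T_n| >= 1 is at least 1, which
      supplies the lower bound required for the variance.\<close>
    have \<Delta>_ge: "1 \<le> \<Delta> \<nu>" for \<nu>
      using N[of \<nu>] b by (simp add: \<Delta>N ge_one_powr_ge_zero)
    from variance[of 1, OF zero_less_one \<Delta>_ge] obtain ck where ck0: "0 \<le> ck" and ck: "\<And>\<nu> \<theta> f X \<kappa>. \<And>M :: 'w measure.
      f \<in> power_law_class TYPE('w) E \<beta> L \<Longrightarrow> (M, X) \<in> admissible_processes E f \<Longrightarrow>
      0 \<le> \<kappa> \<Longrightarrow> cum_bound E M X \<le> ennreal \<kappa> \<Longrightarrow>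
        ?V \<nu> \<theta> M X \<le> ennreal ((\<kappa> + 2 * L\<^sup>2) * (ck * (\<Delta> \<nu> ^ CARD('d) / real (card (lattice_box (n \<nu>))))))"
      by blast
    \<comment> \<open>\<kappa> is an arbitrary real number; for a negative one
      \<open>ennreal \<kappa>\<close> is 0, so max 0 \<kappa> gives the same bound.\<close>
    define cv where "cv = (max 0 \<kappa> + 2 * L\<^sup>2) * ck"
    define c where "c = sqrt (2 * cv + 2 * (cf * L)\<^sup>2)"
    have cv0: "0 \<le> cv" using ck0 by (simp add: cv_def)
    have mse: "sqrt_ennreal (\<integral>\<^sup>+\<omega>. (hs_norm E (\<lambda>z. spectral_estimator K (n \<nu>) (\<Delta> \<nu>) X \<theta> \<omega> z
                                       - f \<theta> z))\<^sup>2 \<partial>M) \<le> ennreal (c * r \<nu>)"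
      if f: "f \<in> power_law_class TYPE('w) E \<beta> L" and MX: "(M, X) \<in> admissible_processes E f"
        and \<kappa>: "cum_bound E M X \<le> ennreal \<kappa>"
      for f \<nu> \<theta> and M :: "'w measure" and X :: "int ^ 'd \<Rightarrow> 'w \<Rightarrow> 'h"
    proof (rule sqrt_ennreal_le)
      interpret fourth_order_process E M X by (rule admissible_process(1)[OF cons L f MX])
      have "cum_bound E M X \<le> ennreal (max 0 \<kappa>)"
        using \<kappa> by (auto simp: max_def ennreal_neg)
      from ck[OF f MX _ this]
      have var: "?V \<nu> \<theta> M X \<le> ennreal (cv * (r \<nu>)\<^sup>2)"
        unfolding \<Delta>_var[unfolded N_def] by (simp add: cv_def mult.assoc)
      have "(hs_norm E (\<lambda>z. expect_op M (spectral_estimator K (n \<nu>) (\<Delta> \<nu>) X \<theta>) z - f \<theta> z))\<^sup>2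
          \<le> (ennreal (cf * L * r \<nu>))\<^sup>2"
        using bias[OF f MX, of \<nu> \<theta>] unfolding \<Delta>_bias by (intro power_mono) auto
      also have "\<dots> = ennreal ((cf * L)\<^sup>2 * (r \<nu>)\<^sup>2)"
        using cf(1) L r0 by (simp add: ennreal_power power_mult_distrib)
      finally have "2 * ?V \<nu> \<theta> M X
          + 2 * (hs_norm E (\<lambda>z. expect_op M (spectral_estimator K (n \<nu>) (\<Delta> \<nu>) X \<theta>) z - f \<theta> z))\<^sup>2
          \<le> 2 * ennreal (cv * (r \<nu>)\<^sup>2) + 2 * ennreal ((cf * L)\<^sup>2 * (r \<nu>)\<^sup>2)"
        using var by (intro add_mono mult_left_mono) auto
      also have "\<dots> = ennreal (2 * (cv * (r \<nu>)\<^sup>2) + 2 * ((cf * L)\<^sup>2 * (r \<nu>)\<^sup>2))"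
        using cv0 by (simp add: ennreal_plus ennreal_mult)
      also have "2 * (cv * (r \<nu>)\<^sup>2) + 2 * ((cf * L)\<^sup>2 * (r \<nu>)\<^sup>2) = (c * r \<nu>)\<^sup>2"
        using cv0 by (simp add: c_def power_mult_distrib algebra_simps)
      finally show "(\<integral>\<^sup>+\<omega>. (hs_norm E (\<lambda>z. spectral_estimator K (n \<nu>) (\<Delta> \<nu>) X \<theta> \<omega> z
                                       - f \<theta> z))\<^sup>2 \<partial>M) \<le> ennreal ((c * r \<nu>)\<^sup>2)"
        using mean_square_error_le by (rule order_trans[rotated])
      show "0 \<le> c * r \<nu>" using cv0 r0 by (simp add: c_def)
    qed
    show "\<exists>c. \<forall>\<^sub>F \<nu> in sequentially.
        (SUP f\<in>power_law_class TYPE('w) E \<beta> L.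
         SUP (M :: 'w measure, X)\<in>{(M, X). (M, X) \<in> admissible_processes E f \<and>
                                           cum_bound E M X \<le> ennreal \<kappa>}.
         SUP \<theta>\<in>cbox (\<chi> l. - pi) (\<chi> l. pi).
           sqrt_ennreal (\<integral>\<^sup>+\<omega>. (hs_norm E (\<lambda>z. spectral_estimator K (n \<nu>) (\<Delta> \<nu>) X \<theta> \<omega> z
                                       - f \<theta> z))\<^sup>2 \<partial>M))
        \<le> ennreal (c * real (card (lattice_box (n \<nu>))) powr (- \<beta> / (2 * \<beta> + real CARD('d))))"
      using mse unfolding r_def N_def
      by (intro exI[of _ c] always_eventually allI SUP_least) (auto intro!: SUP_least)
  qed
qed

end
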